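(* Let $\tilde G=(\tilde V,\tilde E)$ be a connected, infinite graph of bounded degree, and suppose that there are real numbers $\alpha\in[1,2]$ and $\beta$ with $2\le\beta\le\alpha+1$ and $\beta>\alpha$, and constants $0<c\le C<\infty$, such that $$c\,k^{\alpha}\le |B_{\tilde G}(v,k)|\le C\,k^{\alpha}\qquad\text{for all } v\in\tilde V,\ k\ge 1,$$ $$c\,d_{\tilde G}(u,v)^{\beta-\alpha}\le R^{\tilde G}_{\mathrm{eff}}(u,v)\le C\,d_{\tilde G}(u,v)^{\beta-\alpha}\qquad\text{for all } u\ne v\in\tilde V.$$ Fix $o\in\tilde V$ and $\gamma>0$, let $f_\gamma(v)=\lfloor d_{\tilde G}(o,v)^{\gamma}\rfloor$ for $v\in\tilde V$, and let $G=\mathrm{Comb}(\tilde G,f_\gamma)$. Then: (1) if $\gamma\le\beta-\alpha$, the graph $G$ has the infinite collision property; (2) if $\gamma>\beta-\alpha$, the graph $G$ has the finite collision property.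
   Context: $\mathbb N=\{0,1,2,\dots\}$. $d_{\tilde G}$ is the graph distance and $B_{\tilde G}(v,k)=\{u\in\tilde V: d_{\tilde G}(u,v)\le k\}$. Comb graph: for a connected, locally finite, infinite graph $\tilde G=(\tilde V,\tilde E)$ and $f:\tilde V\to\mathbb N\cup\{\infty\}$, $\mathrm{Comb}(\tilde G,f)$ is the graph with vertex set $V=\{(v,n)\in\tilde V\times\mathbb N: 0\le n\le f(v)\}$ and edges $\{(u,0),(v,0)\}$ for $\{u,v\}\in\tilde E$ together with $\{(v,m),(v,n)\}$ for $v\in\tilde V$, $|m-n|=1$ (both endpoints in $V$). Effective resistance: for disjoint non-empty vertex sets $A,B$ of a graph $\Gamma$, $R^{\Gamma}_{\mathrm{eff}}(A,B)=\big(\inf\{\mathcal E(f,f): f|_A=1,\ f|_B=0,\ \mathcal E(f,f)<\infty\}\big)^{-1}$, where $\mathcal E(f,f)=\frac12\sum_{x,y:\,x\sim y}(f(x)-f(y))^2$ (sum over ordered pairs of neighbours); $R^\Gamma_{\mathrm{eff}}(u,v)=R^\Gamma_{\mathrm{eff}}(\{u\},\{v\})$. Collisions: let $X,Y$ be independent discrete-time simple random walks on $G$ (at each step moving to a uniformly chosen neighbour), with law $\mathbb P_{x,y}=\mathbb P_x\otimes\mathbb P_y$ when started at $x,y\in V$, and let $\mathcal Z=|\{n\in\mathbb N: X_n=Y_n\}|$. $G$ has the infinite collision property if $\mathbb P_{x,x}(\mathcal Z=\infty)=1$ for all $x\in V$, and the finite collision property if $\mathbb P_{x,x}(\mathcal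 Z<\infty)=1$ for all $x\in V$. *)

theory Defs
  imports "HOL-Probability.Probability"
begin

section \<open>Graphs\<close>

text \<open>
  A graph is given by its vertex set \<open>V\<close> and its adjacency relation \<open>E\<close>; the edge joining \<open>u\<close> and
  \<open>v\<close> is represented by the two ordered pairs \<open>(u, v)\<close> and \<open>(v, u)\<close>.
\<close>

definition simple_graph :: "'a set \<Rightarrow> 'a rel \<Rightarrow> bool" where
  "simple_graph V E \<longleftrightarrow> E \<subseteq> V \<times> V \<and> sym E \<and> irrefl E"

definition connected_graph :: "'a set \<Rightarrow> 'a rel \<Rightarrow> bool" where
  "connected_graph V E \<longleftrightarrow> V \<noteq> {} \<and> (\<forall>u\<in>V. \<forall>v\<in>V. (u, v) \<in> E\<^sup>*)"

abbreviation neighbours :: "'a rel \<Rightarrow> 'a \<Rightarrow> 'a set" where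
  "neighbours E v \<equiv> E `` {v}"

definition bounded_degree :: "'a set \<Rightarrow> 'a rel \<Rightarrow> bool" where
  "bounded_degree V E \<longleftrightarrow> (\<exists>D. \<forall>v\<in>V. finite (neighbours E v) \<and> card (neighbours E v) \<le> D)"

text \<open>The length of a shortest walk; only meaningful for \<open>u\<close> and \<open>v\<close> in the same component.\<close>

definition graph_dist :: "'a rel \<Rightarrow> 'a \<Rightarrow> 'a \<Rightarrow> nat" where
  "graph_dist E u v = (LEAST n. (u, v) \<in> E ^^ n)"

definition graph_ball :: "'a set \<Rightarrow> 'a rel \<Rightarrow> 'a \<Rightarrow> nat \<Rightarrow> 'a set" where
  "graph_ball V E v k = {u \<in> V. graph_dist E u v \<le> k}"


section \<open>Comb graphs\<close>

definition comb_verts :: "'a set \<Rightarrow> ('a \<Rightarrow> enat) \<Rightarrow> ('a \<times> nat) set" where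
  "comb_verts V f = {(v, n). v \<in> V \<and> enat n \<le> f v}"

definition comb_edges :: "'a set \<Rightarrow> 'a rel \<Rightarrow> ('a \<Rightarrow> enat) \<Rightarrow> ('a \<times> nat) rel" where
  "comb_edges V E f =
     {((u, 0), (v, 0)) | u v. (u, v) \<in> E} \<union>
     {((v, m), (v, n)) | v m n. (v, m) \<in> comb_verts V f \<and> (v, n) \<in> comb_verts V f \<and>
                                \<bar>int m - int n\<bar> = 1}"

definition power_profile :: "'a rel \<Rightarrow> 'a \<Rightarrow> real \<Rightarrow> 'a \<Rightarrow> enat" where
  "power_profile E r \<gamma> v = enat (nat \<lfloor>real (graph_dist E r v) powr \<gamma>\<rfloor>)"


section \<open>Effective resistance\<close>

text \<open>
  Energies and resistances take values in \<open>[0, \<infinity>]\<close>, with \<open>inverse 0 = \<infinity>\<close> and \<open>inverse \<infinity> = 0\<close>. The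
  sum over \<open>E\<close> is over ordered pairs of neighbours, so each edge is counted twice.
\<close>

definition energy :: "'a rel \<Rightarrow> ('a \<Rightarrow> real) \<Rightarrow> ennreal" where
  "energy E f = (\<Sum>\<^sub>\<infinity>(x, y)\<in>E. ennreal ((f x - f y)\<^sup>2)) / 2"

definition eff_resistance :: "'a rel \<Rightarrow> 'a set \<Rightarrow> 'a set \<Rightarrow> ennreal" where
  "eff_resistance E A B =
     inverse (Inf {energy E f | f. (\<forall>x\<in>A. f x = 1) \<and> (\<forall>x\<in>B. f x = 0) \<and> energy E f < \<infinity>})"


section \<open>Simple random walk and collisions\<close>

text \<open>One step of the walk from \<open>x\<close>: the uniform distribution on the neighbours of \<open>x\<close>.\<close>

definition srw_step :: "'a set \<Rightarrow> 'a rel \<Rightarrow> 'a \<Rightarrow> 'a measure" where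
  "srw_step V E x =
     point_measure V (\<lambda>y. if (x, y) \<in> E then ennreal (1 / real (card (neighbours E x))) else 0)"

text \<open>
  The conditional law of the position at time \<open>n\<close> given the positions \<open>\<omega> 0, \<dots>, \<omega> (n - 1)\<close>, for the
  walk started at \<open>x\<close>.
\<close>

definition srw_kernel :: "'a set \<Rightarrow> 'a rel \<Rightarrow> 'a \<Rightarrow> nat \<Rightarrow> (nat \<Rightarrow> 'a) \<Rightarrow> 'a measure" where
  "srw_kernel V E x n \<omega> =
     (case n of 0 \<Rightarrow> return (count_space V) x | Suc m \<Rightarrow> srw_step V E (\<omega> m))"

text \<open>
  The law of the walk started at \<open>x\<close>, on the space of trajectories \<open>nat \<Rightarrow> V\<close> with the product
  sigma-algebra, obtained from these kernels by the Ionescu-Tulcea theorem. The lemma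
  \<open>emeasure_srw_law_cylinder\<close> below gives its finite-dimensional distributions.
\<close>

definition srw_law :: "'a set \<Rightarrow> 'a rel \<Rightarrow> 'a \<Rightarrow> (nat \<Rightarrow> 'a) measure" where
  "srw_law V E x =
     projective_family.lim UNIV (Ionescu_Tulcea.CI (srw_kernel V E x) (\<lambda>_. count_space V))
       (\<lambda>_. count_space V)"

definition collision_law :: "'a set \<Rightarrow> 'a rel \<Rightarrow> 'a \<Rightarrow> 'a \<Rightarrow> ((nat \<Rightarrow> 'a) \<times> (nat \<Rightarrow> 'a)) measure" where
  "collision_law V E x y = srw_law V E x \<Otimes>\<^sub>M srw_law V E y"

definition collision_times :: "(nat \<Rightarrow> 'a) \<times> (nat \<Rightarrow> 'a) \<Rightarrow> nat set" where
  "collision_times = (\<lambda>(X, Y). {n. X n = Y n})"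

text \<open>
  A connected, locally finite graph is countable, and for countable \<open>V\<close> the events below are
  measurable in the product sigma-algebra.
\<close>

definition infinite_collision_property :: "'a set \<Rightarrow> 'a rel \<Rightarrow> bool" where
  "infinite_collision_property V E \<longleftrightarrow>
     (\<forall>x\<in>V. measure (collision_law V E x x)
        {\<omega> \<in> space (collision_law V E x x). infinite (collision_times \<omega>)} = 1)"

definition finite_collision_property :: "'a set \<Rightarrow> 'a rel \<Rightarrow> bool" where
  "finite_collision_property V E \<longleftrightarrow>
     (\<forall>x\<in>V. measure (collision_law V E x x)
        {\<omega> \<in> space (collision_law V E x x). finite (collision_times \<omega>)} = 1)"

locale srw_graph =
  fixes V :: "'a set" and E :: "'a rel" and x :: 'a
  assumes edges: "E \<subseteq> V \<times> V" and start: "x \<in> V"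
    and locally_finite: "\<And>v. v \<in> V \<Longrightarrow> finite (neighbours E v)"
    and no_isolated: "\<And>v. v \<in> V \<Longrightarrow> neighbours E v \<noteq> {}"
begin

lemma prob_space_srw_step:
  assumes "v \<in> V"
  shows "prob_space (srw_step V E v)"
proof
  let ?N = "neighbours E v"
  have fin: "finite ?N" and ne: "?N \<noteq> {}" using assms locally_finite no_isolated by auto
  have sub: "?N \<subseteq> V" using edges by auto
  have "emeasure (srw_step V E v) (space (srw_step V E v)) =
      (\<integral>\<^sup>+y. (if (v, y) \<in> E then ennreal (1 / real (card ?N)) else 0) \<partial>count_space V)"
    by (auto simp: srw_step_def point_measure_def emeasure_density intro!: nn_integral_cong)
  also have "\<dots> = (\<Sum>y\<in>?N. ennreal (1 / real (card ?N)))"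
    using sub fin by (subst nn_integral_count_space'[where A = ?N]) (auto intro!: sum.cong)
  also have "\<dots> = 1"
    using fin ne by (simp add: sum_ennreal[symmetric] ennreal_of_nat_eq_real_of_nat ennreal_mult[symmetric])
  finally show "emeasure (srw_step V E v) (space (srw_step V E v)) = 1" .
qed

lemma srw_step_measurable:
  "srw_step V E \<in> measurable (count_space V) (subprob_algebra (count_space V))"
proof -
  have "space (srw_step V E v) = V" "sets (srw_step V E v) = Pow V" for v
    by (simp_all add: srw_step_def space_point_measure sets_point_measure)
  then show ?thesis
    using prob_space_imp_subprob_space[OF prob_space_srw_step] by (auto simp: space_subprob_algebra)
qed

sublocale srw: Ionescu_Tulcea "srw_kernel V E x" "\<lambda>_. count_space V"
proof (rule Ionescu_Tulcea.intro)
  fix n :: nat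
  show "srw_kernel V E x n \<in>
      measurable (PiM {0..<n} (\<lambda>_. count_space V)) (subprob_algebra (count_space V))"
  proof (cases n)
    case 0
    have "return (count_space V) x \<in> space (subprob_algebra (count_space V))"
      using start by (auto simp: space_subprob_algebra intro!: prob_space_imp_subprob_space prob_space_return)
    then show ?thesis using 0 by (simp add: srw_kernel_def[abs_def])
  next
    case (Suc m)
    show ?thesis
      unfolding srw_kernel_def[abs_def] Suc
      using measurable_compose[OF measurable_component_singleton[of m "{0..<Suc m}" "\<lambda>_. count_space V"]
          srw_step_measurable]
      by simp
  qed
next
  fix n :: nat and \<omega> assume "\<omega> \<in> space (PiM {0..<n} (\<lambda>_. count_space V))"
  then show "prob_space (srw_kernel V E x n \<omega>)"
    using start by (auto simp: srw_kernel_def space_PiM PiE_iff split: nat.split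
        intro!: prob_space_return prob_space_srw_step)
qed

lemma srw_law_eq: "srw_law V E x = srw.PF.lim"
  by (simp add: srw_law_def)

lemma emeasure_srw_step:
  assumes "v \<in> V" and "y \<in> V"
  shows "emeasure (srw_step V E v) {y} =
    (if (v, y) \<in> E then ennreal (1 / real (card (neighbours E v))) else 0)"
  using assms by (simp add: srw_step_def emeasure_point_measure_finite2)

lemma sets_singleton:
  fixes n :: nat
  assumes "\<And>i. i < n \<Longrightarrow> w i \<in> V"
  shows "{restrict w {0..<n}} \<in> sets (PiM {0..<n} (\<lambda>_. count_space V))"
proof -
  have "{restrict w {0..<n}} = (\<Pi>\<^sub>E i\<in>{0..<n}. {w i})"
    by (auto simp: PiE_singleton restrict_def extensional_def fun_eq_iff PiE_iff)
  then show ?thesis using assms by (auto intro!: sets_PiM_I_finite)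
qed

lemma emeasure_C_singleton:
  assumes "\<And>i. i < n \<Longrightarrow> w i \<in> V"
  shows "emeasure (srw.C 0 n (\<lambda>_. undefined)) {restrict w {0..<n}} =
    (\<Prod>i<n. emeasure (srw_kernel V E x i w) {w i})"
  using assms
proof (induction n)
  case 0
  have "{\<lambda>_::nat. undefined} \<in> sets (PiM {} (\<lambda>_. count_space V))"
    by (simp add: PiM_empty)
  then show ?case by (simp add: restrict_def)
next
  case (Suc n)
  let ?M = "\<lambda>_::nat. count_space V" and ?u = "\<lambda>_::nat. undefined :: 'a"
  have u: "?u \<in> space (PiM {0..<0} ?M)" by (simp add: space_PiM)
  have w: "\<And>i. i < n \<Longrightarrow> w i \<in> V" "w n \<in> V" using Suc.prems by auto
  have A: "{restrict w {0..<Suc n}} \<in> sets (PiM {0..<Suc n} ?M)"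
    using sets_singleton[of "Suc n" w] Suc.prems by blast
  have sp: "space (srw.C 0 n ?u) = space (PiM {0..<n} ?M)"
    using srw.space_C[OF u, of n] by simp
  have st: "sets (srw.C 0 n ?u) = sets (PiM {0..<n} ?M)"
    using srw.sets_C[OF u, of n] by simp
  have B: "{restrict w {0..<n}} \<in> sets (srw.C 0 n ?u)"
    using sets_singleton[of n w] w by (simp add: st)
  have k: "emeasure (srw.eP n \<omega>) {restrict w {0..<Suc n}} =
      emeasure (srw_kernel V E x n w) {w n} * indicator {restrict w {0..<n}} \<omega>"
    if \<omega>: "\<omega> \<in> space (PiM {0..<n} ?M)" for \<omega>
  proof -
    have ext: "\<omega> \<in> extensional {0..<n}" using \<omega> by (simp add: space_PiM PiE_iff)
    have eq: "fun_upd \<omega> n y = restrict w {0..<Suc n} \<longleftrightarrow> y = w n \<and> \<omega> = restrict w {0..<n}" for y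
    proof safe
      assume h: "fun_upd \<omega> n y = restrict w {0..<Suc n}"
      show "y = w n" using fun_cong[OF h, of n] by simp
      show "\<omega> = restrict w {0..<n}"
      proof
        fix i show "\<omega> i = restrict w {0..<n} i"
          using fun_cong[OF h, of i] ext by (cases "i < n") (auto simp: extensional_def)
      qed
    qed (auto simp: fun_eq_iff)
    have "((\<lambda>y. fun_upd \<omega> n y) -` {restrict w {0..<Suc n}} \<inter> space (count_space V)) =
        (if \<omega> = restrict w {0..<n} then {w n} else {})"
      by (simp only: vimage_def singleton_iff eq space_count_space) (use w in auto)
    moreover have "srw_kernel V E x n (restrict w {0..<n}) = srw_kernel V E x n w"
      by (simp add: srw_kernel_def split: nat.split)
    ultimately show ?thesis
      using srw.emeasure_eP[OF \<omega> A] by (simp split: split_indicator)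
  qed
  have "emeasure (srw.C 0 (Suc n) ?u) {restrict w {0..<Suc n}} =
      (\<integral>\<^sup>+\<omega>. emeasure (srw.eP n \<omega>) {restrict w {0..<Suc n}} \<partial>srw.C 0 n ?u)"
  proof -
    have "srw.eP n \<in> measurable (srw.C 0 n ?u) (subprob_algebra (PiM {0..<Suc n} ?M))"
      using srw.measurable_eP[of n] by (simp add: measurable_cong_sets[OF st refl])
    moreover have "space (srw.C 0 n ?u) \<noteq> {}"
      using srw.prob_space_C[OF u, of n] by (rule prob_space.not_empty)
    ultimately show ?thesis using A by (simp add: emeasure_bind)
  qed
  also have "\<dots> = (\<integral>\<^sup>+\<omega>. emeasure (srw_kernel V E x n w) {w n} *
      indicator {restrict w {0..<n}} \<omega> \<partial>srw.C 0 n ?u)"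
    by (intro nn_integral_cong) (simp add: sp k)
  also have "\<dots> = emeasure (srw_kernel V E x n w) {w n} *
      emeasure (srw.C 0 n ?u) {restrict w {0..<n}}"
    using B by (rule nn_integral_cmult_indicator)
  also have "\<dots> = (\<Prod>i<Suc n. emeasure (srw_kernel V E x i w) {w i})"
    by (subst Suc.IH[OF w(1)]) (simp_all only: prod.lessThan_Suc mult.commute)
  finally show ?case .
qed

lemma emeasure_srw_law_cylinder:
  assumes w: "\<And>i. i \<le> n \<Longrightarrow> w i \<in> V"
  shows "emeasure (srw_law V E x) {\<omega> \<in> space (srw_law V E x). \<forall>i\<le>n. \<omega> i = w i} =
    (if w 0 = x
     then \<Prod>i<n. if (w i, w (Suc i)) \<in> E then ennreal (1 / real (card (neighbours E (w i)))) else 0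
     else 0)"
proof -
  let ?M = "\<lambda>_::nat. count_space V"
  let ?W = "{restrict w {0..<Suc n}}"
  have W: "?W \<in> sets (PiM {0..<Suc n} ?M)" using sets_singleton[of "Suc n" w] w by simp
  have eq: "restrict \<omega> {0..<Suc n} = restrict w {0..<Suc n} \<longleftrightarrow> (\<forall>i\<le>n. \<omega> i = w i)" for \<omega>
    by (auto simp: fun_eq_iff restrict_def less_Suc_eq_le)
  have "{\<omega> \<in> space (srw_law V E x). \<forall>i\<le>n. \<omega> i = w i} = srw.PF.emb UNIV {0..<Suc n} ?W"
    by (auto simp: srw_law_eq prod_emb_def space_PiM eq)
  then have "emeasure (srw_law V E x) {\<omega> \<in> space (srw_law V E x). \<forall>i\<le>n. \<omega> i = w i} =
      emeasure (srw.CI {0..<Suc n}) ?W"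
    using srw.lim[OF _ W] by (simp add: srw_law_eq)
  also have "\<dots> = emeasure (srw.C 0 (Suc n) (\<lambda>_. undefined)) ?W"
    using srw.emeasure_CI[OF order_refl W] prod_emb_id[of ?W "{0..<Suc n}" ?M] sets.sets_into_space[OF W]
    by (simp add: space_PiM)
  also have "\<dots> = (\<Prod>i<Suc n. emeasure (srw_kernel V E x i w) {w i})"
    using w by (intro emeasure_C_singleton) simp
  also have "\<dots> = emeasure (return (count_space V) x) {w 0} *
      (\<Prod>i<n. emeasure (srw_step V E (w i)) {w (Suc i)})"
    by (subst prod.lessThan_Suc_shift) (simp add: srw_kernel_def)
  also have "(\<Prod>i<n. emeasure (srw_step V E (w i)) {w (Suc i)}) =
      (\<Prod>i<n. if (w i, w (Suc i)) \<in> E then ennreal (1 / real (card (neighbours E (w i)))) else 0)"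
    using w by (intro prod.cong refl) (simp add: emeasure_srw_step)
  finally show ?thesis using w[of 0] by (auto split: split_indicator)
qed

end

end

theory Submission
  imports Defs
begin

text \<open>
  \<^bold>\<open>Short teeth.\<close> Sum over \<open>t\<close> the even-time transition densities of the walk killed on leaving a
  finite set \<open>B\<close>; this is the expected number of collisions, weighted by the inverse degree, of two
  walks before either leaves \<open>B\<close>. Decomposing at the first collision, two walks from \<open>(x, y)\<close> meet with
  probability at least the quotient of this quantity at \<open>(x, y)\<close> by its maximum on the diagonal. Take
  for \<open>B\<close> the part of the comb over a ball of radius \<open>r\<close>. For \<open>\<gamma> \<le> \<beta> - \<alpha>\<close> the diagonal values
  are at most of order \<open>r powr (\<beta> - \<alpha>)\<close>, because they are bounded by resistances, and for fixed \<open>x, y\<close>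
  a cutoff function shows that the value at \<open>(x, y)\<close> is at least of this order. Hence the probability
  of meeting is bounded below uniformly, so it is \<open>1\<close>, from each pair of starting points that are joined
  by a path of even length.

  \<^bold>\<open>Tall teeth.\<close> Let \<open>\<beta> - \<alpha> < g \<le> min \<gamma> \<beta>\<close>. Comparing the heat kernel with its average over the
  first \<open>k powr g\<close> levels of the teeth in an annulus of radius \<open>k\<close> shows that it is at most of order
  \<open>k powr - (\<alpha> + g)\<close> at times of order \<open>k powr (\<beta> + g)\<close>. The same averaging shows that, for each
  level \<open>l\<close>, the expected number of collisions at level \<open>l\<close> in such a time scale is of order
  \<open>k powr (\<beta> - \<alpha> - g)\<close>, which is summable over dyadic \<open>k\<close> even after multiplication by \<open>ln k\<close>. A
  collision at level \<open>l\<close> is followed on average by order \<open>l\<close> collisions in the same tooth below level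
  \<open>2 * l\<close>, so the probability of a collision in a tooth is bounded by the expected number of collisions
  weighted by the inverse of their level. By the Borel-Cantelli lemma, only finitely many teeth contain
  a collision.
\<close>

section \<open>Killed random walks on locally finite graphs\<close>

text \<open>On a bipartite graph the energy of the kernel at a single time says nothing about its
  decay. This parity obstacle shapes both halves: short teeth are treated with the Dirichlet form of
  the two-step walk, which controls differences along paths of even length, and tall teeth with the
  sum of the kernels at two consecutive times. All analysis takes place on a finite set
  \<open>B\<close>, where self-adjointness and summation by parts concern finite sums. For tall
  teeth the bounds are uniform in \<open>B\<close>, so \<open>B\<close> is chosen after the time
  horizon and so large that killing is not felt. The restriction g \<le> \<beta> comes from
  averaging over about \<open>k powr \<alpha>\<close> teeth and \<open>k powr g\<close> levels:
  variation along the teeth costs \<open>k powr (g - \<alpha>)\<close> times the energy, and this is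
  absorbed by the cost \<open>k powr (\<beta> - \<alpha>)\<close> of moving along the base. The
  factor \<open>ln k\<close> is the harmonic sum of the inverse levels, whose number is polynomial
  in \<open>k\<close>.\<close>

locale lf_graph =
  fixes V :: "'b set" and E :: "'b rel"
  assumes edges: "E \<subseteq> V \<times> V" and sym_E: "sym E"
    and locally_finite: "\<And>v. v \<in> V \<Longrightarrow> finite (neighbours E v)"
    and no_isolated: "\<And>v. v \<in> V \<Longrightarrow> neighbours E v \<noteq> {}"
begin

definition deg :: "'b \<Rightarrow> real" where
  "deg x = real (card (neighbours E x))"

definition avg :: "'b \<Rightarrow> ('b \<Rightarrow> real) \<Rightarrow> real" where
  "avg x f = (\<Sum>y\<in>neighbours E x. f y) / deg x"

definition pavg :: "('b \<Rightarrow> 'b \<Rightarrow> real) \<Rightarrow> 'b \<Rightarrow> 'b \<Rightarrow> real" where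
  "pavg f x y = avg x (\<lambda>x'. avg y (f x'))"

text \<open>Only the value is cut off at \<open>B\<close>, not the argument; hence self-adjointness
  below is stated for arguments supported in \<open>B\<close>.\<close>

definition killed :: "'b set \<Rightarrow> ('b \<Rightarrow> real) \<Rightarrow> 'b \<Rightarrow> real" where
  "killed B f x = (if x \<in> B then avg x f else 0)"

text \<open>The transition density, with respect to the degree, of the walk killed on leaving \<open>B\<close>.\<close>

fun kern :: "'b set \<Rightarrow> nat \<Rightarrow> 'b \<Rightarrow> 'b \<Rightarrow> real" where
  "kern B 0 x y = (if x = y \<and> x \<in> B then 1 / deg x else 0)"
| "kern B (Suc t) x y = killed B (\<lambda>x'. kern B t x' y) x"

definition ip :: "'b set \<Rightarrow> ('b \<Rightarrow> real) \<Rightarrow> ('b \<Rightarrow> real) \<Rightarrow> real" where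
  "ip B f g = (\<Sum>x\<in>B. deg x * f x * g x)"

text \<open>For \<open>f\<close> supported in \<open>B\<close> this is the energy on the whole
  graph, edges leaving \<open>B\<close> included; see \<open>energy_supp\<close>.\<close>

definition dirichlet :: "'b set \<Rightarrow> ('b \<Rightarrow> real) \<Rightarrow> real" where
  "dirichlet B f = ip B f f - ip B f (killed B f)"

section \<open>Averages over neighbours and over pairs of neighbours\<close>

lemma finite_neighbours [simp]: "finite (neighbours E x)"
proof (cases "x \<in> V")
  case False
  then have "neighbours E x = {}" using edges by auto
  then show ?thesis by simp
qed (rule locally_finite)

lemma edge_sym: "(x, y) \<in> E \<longleftrightarrow> (y, x) \<in> E"
  using sym_E by (auto dest: symD)

lemma deg_ge_1: "x \<in> V \<Longrightarrow> 1 \<le> deg x"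
  using no_isolated[of x] by (simp add: deg_def Suc_le_eq card_gt_0_iff)

lemma deg_pos: "x \<in> V \<Longrightarrow> 0 < deg x"
  using deg_ge_1[of x] by simp

lemma deg_nonneg: "0 \<le> deg x"
  by (simp add: deg_def)

lemma deg_avg: "x \<in> V \<Longrightarrow> deg x * avg x f = (\<Sum>y\<in>neighbours E x. f y)"
  using deg_pos[of x] by (simp add: avg_def)

lemma avg_mono: "(\<And>y. (x, y) \<in> E \<Longrightarrow> f y \<le> g y) \<Longrightarrow> avg x f \<le> avg x g"
  unfolding avg_def by (intro divide_right_mono sum_mono) (auto simp: deg_nonneg)

lemma avg_cong: "(\<And>y. (x, y) \<in> E \<Longrightarrow> f y = g y) \<Longrightarrow> avg x f = avg x g"
  unfolding avg_def by (auto intro!: arg_cong2[where f = "(/)"] sum.cong)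

lemma avg_const: "x \<in> V \<Longrightarrow> avg x (\<lambda>_. c) = c"
  using no_isolated[of x] by (simp add: avg_def deg_def)

lemma avg_zero [simp]: "avg x (\<lambda>_. 0) = 0"
  by (simp add: avg_def)

lemma avg_nonneg: "(\<And>y. (x, y) \<in> E \<Longrightarrow> 0 \<le> f y) \<Longrightarrow> 0 \<le> avg x f"
  using avg_mono[of x "\<lambda>_. 0" f] by simp

lemma avg_add: "avg x (\<lambda>y. f y + g y) = avg x f + avg x g"
  by (simp add: avg_def sum.distrib add_divide_distrib)

lemma avg_diff: "avg x (\<lambda>y. f y - g y) = avg x f - avg x g"
  by (simp add: avg_def sum_subtractf diff_divide_distrib)

lemma avg_cmult: "avg x (\<lambda>y. c * f y) = c * avg x f"
  by (simp add: avg_def sum_distrib_left)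

lemma avg_sum: "avg x (\<lambda>y. \<Sum>i\<in>I. f i y) = (\<Sum>i\<in>I. avg x (f i))"
  unfolding avg_def by (subst sum.swap) (simp add: sum_divide_distrib)

lemma avg_swap: "avg x (\<lambda>x'. avg y (f x')) = avg y (\<lambda>y'. avg x (\<lambda>x'. f x' y'))"
proof -
  have "avg x (\<lambda>x'. avg y (f x')) = (\<Sum>x'\<in>neighbours E x. \<Sum>y'\<in>neighbours E y. f x' y') / deg y / deg x"
    by (simp add: avg_def sum_divide_distrib)
  also have "\<dots> = (\<Sum>y'\<in>neighbours E y. \<Sum>x'\<in>neighbours E x. f x' y') / deg x / deg y"
    by (subst sum.swap) (simp add: mult.commute)
  finally show ?thesis by (simp add: avg_def sum_divide_distrib)
qed

lemma tendsto_avg: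
  assumes "\<And>y. (x, y) \<in> E \<Longrightarrow> ((\<lambda>n. f n y) \<longlongrightarrow> g y) F"
  shows "((\<lambda>n. avg x (f n)) \<longlongrightarrow> avg x g) F"
proof (cases "neighbours E x = {}")
  case False
  then have "deg x \<noteq> 0" by (simp add: deg_def)
  then show ?thesis unfolding avg_def using assms by (intro tendsto_divide tendsto_sum tendsto_const) auto
qed (simp add: avg_def)

lemma pavg_mono:
  "(\<And>x' y'. (x, x') \<in> E \<Longrightarrow> (y, y') \<in> E \<Longrightarrow> f x' y' \<le> g x' y') \<Longrightarrow> pavg f x y \<le> pavg g x y"
  unfolding pavg_def by (intro avg_mono) auto

lemma pavg_cong:
  "(\<And>x' y'. (x, x') \<in> E \<Longrightarrow> (y, y') \<in> E \<Longrightarrow> f x' y' = g x' y') \<Longrightarrow> pavg f x y = pavg g x y"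
  unfolding pavg_def by (intro avg_cong) auto

lemma pavg_const: "x \<in> V \<Longrightarrow> y \<in> V \<Longrightarrow> pavg (\<lambda>_ _. c) x y = c"
  unfolding pavg_def by (simp add: avg_const)

lemma pavg_zero [simp]: "pavg (\<lambda>_ _. 0) x y = 0"
  by (simp add: pavg_def)

lemma pavg_nonneg:
  "(\<And>x' y'. (x, x') \<in> E \<Longrightarrow> (y, y') \<in> E \<Longrightarrow> 0 \<le> f x' y') \<Longrightarrow> 0 \<le> pavg f x y"
  using pavg_mono[of x y "\<lambda>_ _. 0" f] by simp

lemma pavg_diff: "pavg (\<lambda>x y. f x y - g x y) x y = pavg f x y - pavg g x y"
  by (simp add: pavg_def avg_diff)

lemma pavg_cmult: "pavg (\<lambda>x y. c * f x y) x y = c * pavg f x y"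
  by (simp add: pavg_def avg_cmult)

lemma pavg_sum: "pavg (\<lambda>x y. \<Sum>i\<in>I. f i x y) x y = (\<Sum>i\<in>I. pavg (f i) x y)"
  by (simp add: pavg_def avg_sum)

lemma tendsto_pavg:
  assumes "\<And>x' y'. (x, x') \<in> E \<Longrightarrow> (y, y') \<in> E \<Longrightarrow> ((\<lambda>n. f n x' y') \<longlongrightarrow> g x' y') F"
  shows "((\<lambda>n. pavg (f n) x y) \<longlongrightarrow> pavg g x y) F"
  unfolding pavg_def using assms by (intro tendsto_avg) auto

section \<open>Symmetry of the killed transition density\<close>

lemma kern_outside: "x \<notin> B \<or> y \<notin> B \<Longrightarrow> kern B t x y = 0"
  by (induction t arbitrary: x) (auto simp: killed_def)

lemma kern_nonneg: "0 \<le> kern B t x y"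
  by (induction t arbitrary: x) (auto simp: killed_def deg_nonneg intro!: avg_nonneg)

text \<open>The defining recursion peels off the first step, this one the last. Averages in the two
  variables commute, and division by the degree makes the one-step density symmetric.\<close>

lemma kern_Suc_right: "B \<subseteq> V \<Longrightarrow> kern B (Suc t) x y = killed B (kern B t x) y"
proof (induction t arbitrary: x y)
  case 0
  have *: "avg a (\<lambda>b. if b = c \<and> b \<in> B then 1 / deg b else 0) =
      (if (a, c) \<in> E \<and> c \<in> B then 1 / (deg a * deg c) else 0)" for a c
  proof -
    have "(\<Sum>b\<in>neighbours E a. if b = c \<and> b \<in> B then 1 / deg b else 0) =
        (\<Sum>b\<in>neighbours E a. if b = c then (if c \<in> B then 1 / deg c else 0) else 0)"
      by (intro sum.cong) auto
    then show ?thesis by (simp add: avg_def)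
  qed
  have "avg y (\<lambda>b. if x = b \<and> x \<in> B then 1 / deg x else 0) =
      avg y (\<lambda>b. if b = x \<and> b \<in> B then 1 / deg b else 0)"
    by (intro avg_cong) auto
  then show ?case using edge_sym[of x y] by (auto simp: killed_def * mult.commute)
next
  case (Suc t)
  have "kern B (Suc (Suc t)) x y = killed B (\<lambda>x'. killed B (kern B t x') y) x"
    using Suc by simp
  also have "\<dots> = (if x \<in> B \<and> y \<in> B then avg x (\<lambda>x'. avg y (kern B t x')) else 0)"
    by (simp add: killed_def)
  also have "\<dots> = killed B (\<lambda>y'. killed B (\<lambda>x'. kern B t x' y') x) y"
    unfolding avg_swap[of x y] by (simp add: killed_def)
  also have "(\<lambda>y'. killed B (\<lambda>x'. kern B t x' y') x) = kern B (Suc t) x"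
    by (rule ext) simp
  finally show ?case .
qed

lemma kern_Suc_fun: "B \<subseteq> V \<Longrightarrow> kern B (Suc t) x = killed B (kern B t x)"
  by (rule ext) (rule kern_Suc_right)

lemma kern_sym: "B \<subseteq> V \<Longrightarrow> kern B t x y = kern B t y x"
proof (induction t arbitrary: x y)
  case (Suc t)
  have "kern B (Suc t) x y = killed B (\<lambda>x'. kern B t y x') x"
    using Suc by (simp add: killed_def cong: avg_cong)
  then show ?case using kern_Suc_right[OF Suc.prems, of t y x] by simp
qed auto

text \<open>One step is taken off each end, so two time units of the kernel are one step of a pair
  of walks. This is why even times count collisions.\<close>

lemma kern_Suc_Suc:
  assumes "B \<subseteq> V"
  shows "kern B (Suc (Suc t)) x y = (if x \<in> B \<and> y \<in> B then pavg (kern B t) x y else 0)"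
proof -
  have "kern B (Suc (Suc t)) x y = killed B (\<lambda>x'. killed B (kern B t x') y) x"
    by (subst kern.simps) (use kern_Suc_right[OF assms, of t] in \<open>simp only:\<close>)
  then show ?thesis by (simp add: killed_def pavg_def)
qed

end


section \<open>Self-adjointness and energy on a finite set\<close>

locale killed_walk = lf_graph V E for V :: "'b set" and E :: "'b rel" +
  fixes B :: "'b set"
  assumes finB: "finite B" and BV: "B \<subseteq> V"
begin

definition supp :: "('b \<Rightarrow> real) \<Rightarrow> bool" where
  "supp f \<longleftrightarrow> (\<forall>x. x \<notin> B \<longrightarrow> f x = 0)"

lemma suppI: "(\<And>x. x \<notin> B \<Longrightarrow> f x = 0) \<Longrightarrow> supp f"
  by (simp add: supp_def)

lemma suppD: "supp f \<Longrightarrow> x \<notin> B \<Longrightarrow> f x = 0"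
  by (simp add: supp_def)

lemma supp_in: "supp f \<Longrightarrow> f x \<noteq> 0 \<Longrightarrow> x \<in> B"
  by (auto simp: supp_def)

lemma supp_kern: "supp (kern B t x)"
  by (rule suppI) (simp add: kern_outside)

lemma supp_killed: "supp (killed B f)"
  by (rule suppI) (simp add: killed_def)

lemma supp_add: "supp f \<Longrightarrow> supp g \<Longrightarrow> supp (\<lambda>x. f x + g x)"
  by (simp add: supp_def)

lemma supp_sum: "(\<And>i. i \<in> I \<Longrightarrow> supp (f i)) \<Longrightarrow> supp (\<lambda>x. \<Sum>i\<in>I. f i x)"
  by (simp add: supp_def)

lemma ip_commute: "ip B f g = ip B g f"
  by (simp add: ip_def mult.assoc mult.left_commute mult.commute)

lemma ip_add: "ip B (\<lambda>x. f x + g x) h = ip B f h + ip B g h"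
  by (simp add: ip_def algebra_simps sum.distrib)

lemma ip_diff: "ip B (\<lambda>x. f x - g x) h = ip B f h - ip B g h"
  by (simp add: ip_def algebra_simps sum_subtractf)

lemma ip_cmult: "ip B (\<lambda>x. a * f x) h = a * ip B f h"
  by (simp add: ip_def algebra_simps sum_distrib_left)

lemma ip_add_right: "ip B h (\<lambda>x. f x + g x) = ip B h f + ip B h g"
  by (simp add: ip_def algebra_simps sum.distrib)

lemma ip_diff_right: "ip B h (\<lambda>x. f x - g x) = ip B h f - ip B h g"
  by (simp add: ip_def algebra_simps sum_subtractf)

lemma ip_cmult_right: "ip B h (\<lambda>x. a * f x) = a * ip B h f"
  by (simp add: ip_def algebra_simps sum_distrib_left)

lemma ip_nonneg: "(\<And>x. x \<in> B \<Longrightarrow> 0 \<le> f x) \<Longrightarrow> (\<And>x. x \<in> B \<Longrightarrow> 0 \<le> g x) \<Longrightarrow> 0 \<le> ip B f g"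
  unfolding ip_def by (intro sum_nonneg mult_nonneg_nonneg) (auto simp: deg_nonneg)

lemma ip_self_nonneg: "0 \<le> ip B f f"
  unfolding ip_def by (intro sum_nonneg) (simp add: mult.assoc deg_nonneg)

lemma ip_killed: "ip B f (killed B g) = (\<Sum>x\<in>B. f x * (\<Sum>y\<in>neighbours E x. g y))"
  unfolding ip_def
proof (intro sum.cong refl)
  fix x assume x: "x \<in> B"
  then have "x \<in> V" using BV by auto
  from deg_avg[OF this, of g] x
  show "deg x * f x * killed B g x = f x * (\<Sum>y\<in>neighbours E x. g y)"
    by (metis killed_def mult.assoc mult.commute)
qed

lemma sum_neighbours_swap:
  "(\<Sum>x\<in>B. \<Sum>y\<in>B \<inter> neighbours E x. F x y) = (\<Sum>y\<in>B. \<Sum>x\<in>B \<inter> neighbours E y. F x y)"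
proof -
  have "(\<Sum>x\<in>B. \<Sum>y\<in>B \<inter> neighbours E x. F x y) = (\<Sum>x\<in>B. \<Sum>y\<in>B. if (x, y) \<in> E then F x y else 0)"
    by (rule sum.cong[OF refl]) (simp add: sum.inter_restrict finB)
  also have "\<dots> = (\<Sum>y\<in>B. \<Sum>x\<in>B. if (x, y) \<in> E then F x y else 0)"
    by (rule sum.swap)
  also have "\<dots> = (\<Sum>y\<in>B. \<Sum>x\<in>B \<inter> neighbours E y. F x y)"
    by (rule sum.cong[OF refl]) (simp add: sum.inter_restrict finB edge_sym)
  finally show ?thesis .
qed

lemma sum_neighbours_supp:
  "supp g \<Longrightarrow> (\<Sum>y\<in>neighbours E x. g y) = (\<Sum>y\<in>B \<inter> neighbours E x. g y)"
  by (intro sum.mono_neutral_right) (auto dest: suppD)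

lemma killed_selfadjoint:
  assumes "supp f" "supp g"
  shows "ip B f (killed B g) = ip B (killed B f) g"
proof -
  have "ip B f (killed B g) = (\<Sum>x\<in>B. \<Sum>y\<in>B \<inter> neighbours E x. f x * g y)"
    by (simp add: ip_killed sum_neighbours_supp[OF assms(2)] sum_distrib_left)
  also have "\<dots> = (\<Sum>y\<in>B. \<Sum>x\<in>B \<inter> neighbours E y. f x * g y)"
    by (rule sum_neighbours_swap)
  also have "\<dots> = ip B g (killed B f)"
    by (simp add: ip_killed sum_neighbours_supp[OF assms(1)] sum_distrib_left mult.commute)
  finally show ?thesis by (simp add: ip_commute)
qed

lemma ip_kern_0:
  assumes "x \<in> B"
  shows "ip B f (kern B 0 x) = f x"
proof -
  have d: "deg x \<noteq> 0" using deg_pos[of x] assms BV by auto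
  have "ip B f (kern B 0 x) = (\<Sum>y\<in>B. if y = x then f x else 0)"
    unfolding ip_def using assms d by (intro sum.cong) auto
  then show ?thesis using assms finB by simp
qed

text \<open>Self-adjointness moves one step at a time from the left factor to the right, until the
  left factor is the point density that evaluates at \<open>x\<close>.\<close>

lemma ip_kern_kern:
  assumes x: "x \<in> B"
  shows "ip B (kern B s x) (kern B t x) = kern B (s + t) x x"
proof (induction s arbitrary: t)
  case 0
  show ?case using ip_kern_0[OF x, of "kern B t x"]
    by (simp add: ip_commute[of "kern B 0 x"] del: kern.simps)
next
  case (Suc s)
  have "ip B (kern B (Suc s) x) (kern B t x) = ip B (kern B s x) (kern B (Suc t) x)"
    unfolding kern_Suc_fun[OF BV] by (rule killed_selfadjoint[symmetric]) (rule supp_kern)+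
  then show ?case using Suc[of "Suc t"] by (simp del: kern.simps)
qed

lemma energy_supp:
  assumes "supp f"
  shows "energy E f = ennreal (dirichlet B f)" and "0 \<le> dirichlet B f"
proof -
  \<comment> \<open>Edges starting in \<open>B\<close> together with their reverses: a finite
    symmetric set; on every other edge \<open>f\<close> vanishes at both ends.\<close>
  let ?A = "Sigma B (neighbours E)" let ?A' = "(\<lambda>(x, y). (y, x)) ` ?A"
  let ?E = "?A \<union> ?A'"
  have fin: "finite ?A" "finite ?E" using finB by auto
  have sub: "?E \<subseteq> E" using edge_sym by auto
  have symE: "bij_betw (\<lambda>(x, y). (y, x)) ?E ?E"
    by (intro bij_betwI[where g = "\<lambda>(x, y). (y, x)"]) auto
  have s1: "(\<Sum>(x, y)\<in>?E. (f x)\<^sup>2) = ip B f f"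
  proof -
    have "(\<Sum>(x, y)\<in>?E. (f x)\<^sup>2) = (\<Sum>(x, y)\<in>?A. (f x)\<^sup>2)"
      using fin edge_sym by (intro sum.mono_neutral_right) (auto dest: supp_in[OF assms])
    also have "\<dots> = (\<Sum>x\<in>B. \<Sum>y\<in>neighbours E x. (f x)\<^sup>2)"
      using finB by (subst sum.Sigma) auto
    finally show ?thesis by (simp add: ip_def deg_def power2_eq_square mult.assoc)
  qed
  have s2: "(\<Sum>(x, y)\<in>?E. (f y)\<^sup>2) = ip B f f"
    unfolding s1[symmetric]
    by (subst sum.reindex_bij_betw[OF symE, symmetric]) (auto simp: case_prod_beta)
  have s3: "(\<Sum>(x, y)\<in>?E. f x * f y) = ip B f (killed B f)"
  proof -
    have "(\<Sum>(x, y)\<in>?E. f x * f y) = (\<Sum>(x, y)\<in>?A. f x * f y)"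
      using fin edge_sym by (intro sum.mono_neutral_right) (auto dest: supp_in[OF assms])
    also have "\<dots> = (\<Sum>x\<in>B. \<Sum>y\<in>neighbours E x. f x * f y)"
      using finB by (subst sum.Sigma) auto
    finally show ?thesis by (simp add: ip_killed sum_distrib_left)
  qed
  have "(\<Sum>(x, y)\<in>?E. (f x - f y)\<^sup>2) =
      (\<Sum>(x, y)\<in>?E. (f x)\<^sup>2) + (\<Sum>(x, y)\<in>?E. (f y)\<^sup>2) - 2 * (\<Sum>(x, y)\<in>?E. f x * f y)"
    by (simp add: sum.distrib[symmetric] sum_subtractf[symmetric] sum_distrib_left
        case_prod_beta power2_eq_square algebra_simps)
  then have s: "(\<Sum>(x, y)\<in>?E. (f x - f y)\<^sup>2) = 2 * dirichlet B f"
    by (simp add: s1 s2 s3 dirichlet_def)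
  have "0 \<le> (\<Sum>(x, y)\<in>?E. (f x - f y)\<^sup>2)" by (intro sum_nonneg) auto
  then show nn: "0 \<le> dirichlet B f" using s by simp
  have "(\<Sum>\<^sub>\<infinity>(x, y)\<in>E. ennreal ((f x - f y)\<^sup>2)) = (\<Sum>\<^sub>\<infinity>(x, y)\<in>?E. ennreal ((f x - f y)\<^sup>2))"
  proof (rule infsum_cong_neutral)
    fix p assume "p \<in> E - ?E"
    moreover obtain a b where p: "p = (a, b)" by (cases p)
    ultimately have "(a, b) \<in> E" "a \<notin> B" "(b, a) \<notin> ?A" by auto
    then have "f a = 0" "f b = 0" using edge_sym[of a b] assms by (auto dest: suppD)
    then show "(case p of (x, y) \<Rightarrow> ennreal ((f x - f y)\<^sup>2)) = 0" by (simp add: p)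
  qed (use sub in auto)
  also have "\<dots> = (\<Sum>(x, y)\<in>?E. ennreal ((f x - f y)\<^sup>2))"
    using fin by simp
  also have "\<dots> = ennreal (\<Sum>(x, y)\<in>?E. (f x - f y)\<^sup>2)"
    by (subst sum_ennreal[symmetric]) (auto simp: case_prod_beta)
  finally have "energy E f = ennreal (2 * dirichlet B f) / ennreal 2"
    by (simp only: energy_def s ennreal_numeral)
  also have "\<dots> = ennreal (dirichlet B f)"
    using nn by (subst divide_ennreal) auto
  finally show "energy E f = ennreal (dirichlet B f)" .
qed

text \<open>The form \<open>ip B f f - ip B (killed B f) (killed B f)\<close> is the Dirichlet form of the two-step walk.\<close>

lemma two_step_variance:
  assumes f: "supp f" and x: "(z, x) \<in> E" and y: "(z, y) \<in> E" and z: "z \<in> B"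
  shows "(f x - f y)\<^sup>2 \<le> deg z * (ip B f f - ip B (killed B f) (killed B f))"
    and "ip B (killed B f) (killed B f) \<le> ip B f f"
proof -
  \<comment> \<open>\<open>v u\<close> is the degree of \<open>u\<close> times the variance of
    \<open>f\<close> at a uniformly chosen neighbour of \<open>u\<close>.\<close>
  define v where "v u = (\<Sum>w\<in>neighbours E u. (f w)\<^sup>2) - (\<Sum>w\<in>neighbours E u. f w)\<^sup>2 / deg u" for u
  have var: "(\<Sum>a\<in>neighbours E u. \<Sum>b\<in>neighbours E u. (f a - f b)\<^sup>2) = 2 * deg u * v u" if "u \<in> B" for u
  proof -
    have d: "deg u \<noteq> 0" using deg_pos[of u] that BV by auto
    have "(\<Sum>a\<in>neighbours E u. \<Sum>b\<in>neighbours E u. (f a - f b)\<^sup>2) =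
       (\<Sum>a\<in>neighbours E u. \<Sum>b\<in>neighbours E u. (f a)\<^sup>2 + (f b)\<^sup>2 - 2 * (f a * f b))"
      by (simp add: power2_eq_square algebra_simps)
    also have "\<dots> = 2 * deg u * (\<Sum>w\<in>neighbours E u. (f w)\<^sup>2) - 2 * (\<Sum>w\<in>neighbours E u. f w)\<^sup>2"
      by (simp add: sum.distrib sum_subtractf sum_distrib_left[symmetric] sum_distrib_right[symmetric]
          power2_eq_square[of "sum f _"] deg_def algebra_simps)
    also have "\<dots> = 2 * deg u * v u"
    proof -
      have "deg u * v u = deg u * (\<Sum>w\<in>neighbours E u. (f w)\<^sup>2) - (\<Sum>w\<in>neighbours E u. f w)\<^sup>2"
        using d by (simp add: v_def right_diff_distrib)
      then show ?thesis by (simp add: algebra_simps)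
    qed
    finally show ?thesis .
  qed
  have v0: "0 \<le> v u" if "u \<in> B" for u
  proof -
    have "0 \<le> 2 * deg u * v u" unfolding var[OF that, symmetric] by (intro sum_nonneg) auto
    then show ?thesis using deg_pos[of u] that BV by (auto simp: zero_le_mult_iff)
  qed
  have "(\<Sum>u\<in>B. \<Sum>w\<in>neighbours E u. (f w)\<^sup>2) = (\<Sum>u\<in>B. \<Sum>w\<in>B \<inter> neighbours E u. (f w)\<^sup>2)"
    by (rule sum.cong[OF refl], rule sum.mono_neutral_right) (auto dest: supp_in[OF f])
  also have "\<dots> = (\<Sum>u\<in>B. \<Sum>w\<in>B \<inter> neighbours E u. (f u)\<^sup>2)"
    by (rule sum_neighbours_swap)
  also have "\<dots> \<le> (\<Sum>u\<in>B. \<Sum>w\<in>neighbours E u. (f u)\<^sup>2)"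
    by (intro sum_mono sum_mono2) auto
  finally have 1: "(\<Sum>u\<in>B. \<Sum>w\<in>neighbours E u. (f w)\<^sup>2) \<le> ip B f f"
    by (simp add: ip_def deg_def power2_eq_square mult.assoc)
  have 2: "(\<Sum>u\<in>B. (\<Sum>w\<in>neighbours E u. f w)\<^sup>2 / deg u) = ip B (killed B f) (killed B f)"
    unfolding ip_def
  proof (intro sum.cong refl)
    fix u assume u: "u \<in> B"
    then have "deg u \<noteq> 0" using deg_pos[of u] BV by auto
    then show "(\<Sum>w\<in>neighbours E u. f w)\<^sup>2 / deg u = deg u * killed B f u * killed B f u"
      using u by (simp add: killed_def avg_def power2_eq_square)
  qed
  have 3: "(\<Sum>u\<in>B. v u) \<le> ip B f f - ip B (killed B f) (killed B f)"
    using 1 by (simp add: v_def sum_subtractf 2)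
  have "0 \<le> (\<Sum>u\<in>B. v u)" using v0 by (intro sum_nonneg)
  with 3 show "ip B (killed B f) (killed B f) \<le> ip B f f" by simp
  have "(f x - f y)\<^sup>2 \<le> deg z * v z"
  proof -
    have fin: "finite (neighbours E z)" by simp
    \<comment> \<open>\<open>(x, y)\<close> and \<open>(y, x)\<close> both occur in the double sum
      of \<open>var\<close>, which cancels its factor \<open>2\<close>.\<close>
    have "(f x - f y)\<^sup>2 + (f y - f x)\<^sup>2 \<le> 2 * deg z * v z"
    proof (cases "x = y")
      case True
      then show ?thesis using v0[OF z] by (simp add: deg_nonneg)
    next
      case False
      have "(f x - f y)\<^sup>2 + (f y - f x)\<^sup>2 \<le> (\<Sum>a\<in>{x, y}. \<Sum>b\<in>neighbours E z. (f a - f b)\<^sup>2)"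
        using False x y member_le_sum[of y "neighbours E z" "\<lambda>b. (f x - f b)\<^sup>2"]
          member_le_sum[of x "neighbours E z" "\<lambda>b. (f y - f b)\<^sup>2"] by auto
      also have "\<dots> \<le> (\<Sum>a\<in>neighbours E z. \<Sum>b\<in>neighbours E z. (f a - f b)\<^sup>2)"
        using x y by (intro sum_mono2 sum_nonneg) auto
      finally show ?thesis by (simp only: var[OF z])
    qed
    then show ?thesis by (simp add: power2_commute[of "f y"])
  qed
  also have "v z \<le> (\<Sum>u\<in>B. v u)" using z v0 finB by (intro member_le_sum) auto
  finally show "(f x - f y)\<^sup>2 \<le> deg z * (ip B f f - ip B (killed B f) (killed B f))"
    using 3 deg_nonneg[of z] by (meson mult_left_mono order_trans)
qed

lemma killed_contraction: "supp f \<Longrightarrow> ip B (killed B f) (killed B f) \<le> ip B f f"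
proof (cases "B = {}")
  case False
  then obtain z where z: "z \<in> B" by auto
  then obtain x where "(z, x) \<in> E" using no_isolated[of z] BV by auto
  then show "supp f \<Longrightarrow> ?thesis" using two_step_variance(2) z by blast
qed (simp add: ip_def)

text \<open>The two-step form is twice the Dirichlet form minus the squared norm of
  \<open>f - killed B f\<close>.\<close>

lemma dirichlet_two_step:
  assumes "supp f"
  shows "ip B f f - ip B (killed B f) (killed B f) \<le> 2 * dirichlet B f"
proof -
  have "0 \<le> ip B (\<lambda>x. f x - killed B f x) (\<lambda>x. f x - killed B f x)" by (rule ip_self_nonneg)
  then show ?thesis
    by (simp add: ip_diff ip_diff_right dirichlet_def ip_commute[of "killed B f" f])
qed

text \<open>Mass is lost only on leaving \<open>B\<close>: moved by self-adjointness onto the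
  indicator of \<open>B\<close>, the killed operator can only decrease it.\<close>

lemma kern_mass: "ip B (\<lambda>_. 1) (kern B t x) \<le> 1"
proof (induction t)
  case 0
  show ?case using ip_kern_0[of x "\<lambda>_. 1"] by (cases "x \<in> B") (auto simp: ip_def)
next
  case (Suc t)
  let ?one = "\<lambda>y. if y \<in> B then 1 else 0 :: real"
  have "ip B (\<lambda>_. 1) (kern B (Suc t) x) = ip B ?one (killed B (kern B t x))"
    unfolding kern_Suc_fun[OF BV] by (simp add: ip_def cong: sum.cong)
  also have "\<dots> = ip B (killed B ?one) (kern B t x)"
    by (intro killed_selfadjoint supp_kern suppI) auto
  also have "\<dots> \<le> ip B (\<lambda>_. 1) (kern B t x)"
    unfolding ip_def
  proof (intro sum_mono mult_right_mono mult_left_mono kern_nonneg deg_nonneg)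
    fix y assume "y \<in> B"
    then show "killed B ?one y \<le> 1"
      using avg_mono[of y ?one "\<lambda>_. 1"] BV avg_const[of y 1] by (auto simp: killed_def)
  qed
  finally show ?case using Suc by (simp del: kern.simps)
qed

lemma kern_diag_even_mono: "x \<in> B \<Longrightarrow> kern B (2 * Suc t) x x \<le> kern B (2 * t) x x"
  using killed_contraction[OF supp_kern, of t x] ip_kern_kern[of x t t] ip_kern_kern[of x "Suc t" "Suc t"]
  unfolding kern_Suc_fun[OF BV, symmetric] by (simp add: mult_2 del: kern.simps)

text \<open>The difference of the two sides is the Dirichlet form of
  \<open>kern B t x\<close>.\<close>

lemma kern_diag_odd: "x \<in> B \<Longrightarrow> kern B (2 * t + 1) x x \<le> kern B (2 * t) x x"
  using energy_supp(2)[OF supp_kern, of t x] ip_kern_kern[of x t t] ip_kern_kern[of x t "Suc t"]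
  unfolding dirichlet_def kern_Suc_fun[OF BV, symmetric] by (simp add: mult_2 del: kern.simps)

end

context killed_walk
begin

lemma killed_sum: "killed B (\<lambda>y. \<Sum>i\<in>I. f i y) = (\<lambda>y. \<Sum>i\<in>I. killed B (f i) y)"
  by (rule ext) (simp add: killed_def avg_sum)

text \<open>Let \<open>g\<close> be the partial Green function at \<open>z\<close>. By telescoping,
  its Dirichlet form is at most \<open>g z\<close>, so the hypothesis bounds the square of
  \<open>g z\<close> by \<open>m * g z\<close>. The best \<open>m\<close> is the effective
  resistance from \<open>z\<close> to the complement of \<open>B\<close>.\<close>

lemma green_partial_bound:
  assumes z: "z \<in> B" and m: "\<And>f. supp f \<Longrightarrow> (f z)\<^sup>2 \<le> m * dirichlet B f" and m0: "0 \<le> m"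
  shows "(\<Sum>t<N. kern B t z z) \<le> m"
proof -
  define g where "g y = (\<Sum>t<N. kern B t z y)" for y
  have sg: "supp g" unfolding g_def by (intro supp_sum supp_kern)
  have g0: "0 \<le> g y" for y unfolding g_def by (intro sum_nonneg kern_nonneg)
  have kg: "killed B g = (\<lambda>y. \<Sum>t<N. kern B (Suc t) z y)"
    unfolding g_def[abs_def] killed_sum kern_Suc_fun[OF BV] ..
  have "g y - killed B g y = kern B 0 z y - kern B N z y" for y
    unfolding kg using sum_lessThan_telescope'[of "\<lambda>t. kern B t z y" N]
    by (simp add: g_def sum_subtractf[symmetric] del: kern.simps)
  then have *: "(\<lambda>y. g y - killed B g y) = (\<lambda>y. kern B 0 z y - kern B N z y)" by auto
  have "dirichlet B g = ip B g (\<lambda>y. g y - killed B g y)"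
    by (simp add: dirichlet_def ip_diff_right)
  also have "\<dots> = g z - ip B g (kern B N z)"
    unfolding * ip_diff_right using ip_kern_0[OF z, of g] by (simp del: kern.simps)
  also have "\<dots> \<le> g z"
    using g0 by (simp add: ip_nonneg kern_nonneg)
  finally have "dirichlet B g \<le> g z" .
  then have "g z * g z \<le> m * g z"
    using m[OF sg] m0 by (metis mult_left_mono order_trans power2_eq_square)
  then have "g z \<le> m" using g0[of z] m0 by (cases "g z = 0") auto
  then show ?thesis by (simp add: g_def)
qed

end

section \<open>Pairs of walks: avoidance, hitting and weighted collisions\<close>

context lf_graph
begin

lemma sums_avg:
  assumes "\<And>y. (x, y) \<in> E \<Longrightarrow> (\<lambda>t. f t y) sums g y"
  shows "(\<lambda>t. avg x (f t)) sums avg x g"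
  unfolding avg_def using assms by (intro sums_divide sums_sum) auto

lemma sums_killed:
  assumes "\<And>y. (\<lambda>t. f t y) sums g y"
  shows "(\<lambda>t. killed B (f t) y) sums killed B g y"
  unfolding killed_def using assms by (auto intro!: sums_avg)

text \<open>The probability, for two independent walks from \<open>x\<close> and \<open>y\<close>, that the pair of their
  positions at time \<open>i\<close> belongs to \<open>A i\<close> for all \<open>i \<le> n\<close>.\<close>

fun stay :: "(nat \<Rightarrow> ('b \<times> 'b) set) \<Rightarrow> nat \<Rightarrow> 'b \<Rightarrow> 'b \<Rightarrow> real" where
  "stay A 0 x y = of_bool ((x, y) \<in> A 0)"
| "stay A (Suc n) x y = of_bool ((x, y) \<in> A 0) * pavg (stay (\<lambda>i. A (Suc i)) n) x y"

definition avoid :: "nat \<Rightarrow> 'b \<Rightarrow> 'b \<Rightarrow> real" where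
  "avoid n = stay (\<lambda>_. {(x, y). x \<noteq> y}) n"

lemma avoid_simps:
  "avoid 0 x y = of_bool (x \<noteq> y)"
  "avoid (Suc n) x y = of_bool (x \<noteq> y) * pavg (avoid n) x y"
  by (simp_all add: avoid_def)

lemma stay_nonneg: "0 \<le> stay A n x y"
  by (induction n arbitrary: A x y) (auto intro!: pavg_nonneg)

lemma stay_le_1: "x \<in> V \<Longrightarrow> y \<in> V \<Longrightarrow> stay A n x y \<le> 1"
proof (induction n arbitrary: A x y)
  case (Suc n)
  have "pavg (stay (\<lambda>i. A (Suc i)) n) x y \<le> pavg (\<lambda>_ _. 1) x y"
    using Suc edges by (intro pavg_mono) auto
  then show ?case using Suc.prems by (simp add: pavg_const)
qed simp

lemma stay_antimono: "x \<in> V \<Longrightarrow> y \<in> V \<Longrightarrow> stay A (Suc n) x y \<le> stay A n x y"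
proof (induction n arbitrary: A x y)
  case 0
  have "pavg (stay (\<lambda>i. A (Suc i)) 0) x y \<le> pavg (\<lambda>_ _. 1) x y"
    by (intro pavg_mono) auto
  then show ?case using 0 by (simp add: pavg_const)
next
  case (Suc n)
  have "pavg (stay (\<lambda>i. A (Suc i)) (Suc n)) x y \<le> pavg (stay (\<lambda>i. A (Suc i)) n) x y"
    using Suc edges by (intro pavg_mono Suc.IH) auto
  then show ?case by simp
qed

lemma avoid_limit:
  assumes "x \<in> V" "y \<in> V"
  shows "(\<lambda>n. avoid n x y) \<longlonglongrightarrow> lim (\<lambda>n. avoid n x y)"
proof -
  have "decseq (\<lambda>n. avoid n x y)"
    using assms by (intro decseq_SucI) (simp add: avoid_def stay_antimono del: stay.simps)
  moreover have "\<forall>n. 0 \<le> avoid n x y"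
    by (simp add: avoid_def stay_nonneg)
  ultimately obtain l where "(\<lambda>n. avoid n x y) \<longlonglongrightarrow> l"
    by (rule decseq_convergent)
  then show ?thesis by (simp add: limI)
qed

text \<open>Conditioning on the first \<open>n\<close> steps, a uniform bound \<open>1 - c\<close> on the probability \<open>L\<close> of never
  meeting improves to \<open>L \<le> (1 - c) * avoid n\<close>, hence to \<open>L \<le> (1 - c) * L\<close>.\<close>

lemma avoid_tendsto_0:
  assumes S: "S \<subseteq> V \<times> V"
    and step: "\<And>x y x' y'. (x, y) \<in> S \<Longrightarrow> (x, x') \<in> E \<Longrightarrow> (y, y') \<in> E \<Longrightarrow> (x', y') \<in> S"
    and c: "0 < c" and bound: "\<And>x y. (x, y) \<in> S \<Longrightarrow> lim (\<lambda>n. avoid n x y) \<le> 1 - c"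
    and xy: "(x, y) \<in> S"
  shows "(\<lambda>n. avoid n x y) \<longlonglongrightarrow> 0"
proof -
  define L where "L x y = lim (\<lambda>n. avoid n x y)" for x y
  have L: "(\<lambda>n. avoid n x y) \<longlonglongrightarrow> L x y" if "(x, y) \<in> S" for x y
    unfolding L_def using that S by (intro avoid_limit) auto
  have L0: "0 \<le> L x y" if "(x, y) \<in> S" for x y
    by (rule LIMSEQ_le_const[OF L[OF that]]) (auto simp: avoid_def stay_nonneg)
  have eq: "L x y = of_bool (x \<noteq> y) * pavg L x y" if "(x, y) \<in> S" for x y
  proof (rule LIMSEQ_unique)
    show "(\<lambda>n. avoid (Suc n) x y) \<longlonglongrightarrow> L x y" using L[OF that] by (rule LIMSEQ_Suc)
    show "(\<lambda>n. avoid (Suc n) x y) \<longlonglongrightarrow> of_bool (x \<noteq> y) * pavg L x y"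
      unfolding avoid_simps
      by (rule tendsto_mult[OF tendsto_const], rule tendsto_pavg, rule L, rule step[OF that])
  qed
  have *: "L x y \<le> (1 - c) * avoid n x y" if "(x, y) \<in> S" for n x y
    using that
  proof (induction n arbitrary: x y)
    case 0
    then show ?case using bound[OF 0] eq[OF 0] by (auto simp: avoid_simps L_def)
  next
    case (Suc n)
    have "pavg L x y \<le> pavg (\<lambda>x y. (1 - c) * avoid n x y) x y"
      by (rule pavg_mono, rule Suc.IH, rule step[OF Suc.prems])
    then show ?case using eq[OF Suc.prems] by (auto simp: avoid_simps pavg_cmult)
  qed
  have "(\<lambda>n. (1 - c) * avoid n x y) \<longlonglongrightarrow> (1 - c) * L x y"
    by (intro tendsto_mult tendsto_const L xy)
  then have "L x y \<le> (1 - c) * L x y"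
    by (rule LIMSEQ_le_const) (use *[OF xy] in blast)
  then have "c * L x y \<le> 0" by (simp add: algebra_simps)
  then have "L x y = 0" using c L0[OF xy] by (simp add: mult_le_0_iff)
  then show ?thesis using L[OF xy] by simp
qed

text \<open>The first \<open>k\<close> steps replace the starting pair by an average over pairs in
  \<open>S\<close>, and from each of these the walks meet almost surely.\<close>

lemma late_avoid_tendsto_0:
  assumes "\<And>x y. (x, y) \<in> S \<Longrightarrow> (\<lambda>n. avoid n x y) \<longlonglongrightarrow> 0"
    and step: "\<And>x y x' y'. (x, y) \<in> S \<Longrightarrow> (x, x') \<in> E \<Longrightarrow> (y, y') \<in> E \<Longrightarrow> (x', y') \<in> S"
    and "(x, y) \<in> S"
  shows "(\<lambda>n. stay (\<lambda>i. if i < k then UNIV else {(x, y). x \<noteq> y}) (k + n) x y) \<longlonglongrightarrow> 0"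
  using assms(3)
proof (induction k arbitrary: x y)
  case 0
  then show ?case using assms(1) by (simp add: avoid_def)
next
  case (Suc k)
  have "(\<lambda>n. pavg (stay (\<lambda>i. if i < k then UNIV else {(x, y). x \<noteq> y}) (k + n)) x y) \<longlonglongrightarrow>
      pavg (\<lambda>_ _. 0) x y"
    by (rule tendsto_pavg, rule Suc.IH, rule step[OF Suc.prems])
  then show ?case by simp
qed

fun transition :: "nat \<Rightarrow> 'b \<Rightarrow> 'b \<Rightarrow> real" where
  "transition 0 x z = of_bool (x = z)"
| "transition (Suc t) x z = avg x (\<lambda>x'. transition t x' z)"

text \<open>The expected sum of the weights \<open>w\<close> of the collision points up to time \<open>n\<close>.\<close>

fun wcoll :: "('b \<Rightarrow> real) \<Rightarrow> nat \<Rightarrow> 'b \<Rightarrow> 'b \<Rightarrow> real" where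
  "wcoll w 0 x y = (if x = y then w x else 0)"
| "wcoll w (Suc n) x y = (if x = y then w x else 0) + pavg (wcoll w n) x y"

lemma wcoll_nonneg: "(\<And>x. 0 \<le> w x) \<Longrightarrow> 0 \<le> wcoll w n x y"
  by (induction n arbitrary: x y) (auto intro!: add_nonneg_nonneg pavg_nonneg)

lemma wcoll_mono_time: 
  assumes "\<And>x. 0 \<le> w x" "n \<le> n'"
  shows "wcoll w n x y \<le> wcoll w n' x y"
proof -
  have "wcoll w n x y \<le> wcoll w (Suc n) x y" for n
  proof (induction n arbitrary: x y)
    case 0
    have "0 \<le> pavg (wcoll w 0) x y" using wcoll_nonneg[OF assms(1)] by (intro pavg_nonneg)
    then show ?case by simp
  next
    case (Suc n)
    then show ?case by (simp add: pavg_mono del: wcoll.simps(1))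
  qed
  then show ?thesis using assms(2) by (rule lift_Suc_mono_le[of "\<lambda>n. wcoll w n x y"])
qed

text \<open>Restart at the first meeting in \<open>S\<close>: the next \<open>M\<close> steps
  contribute at least \<open>1\<close> on average to the weighted sum, so the probability of such a
  meeting is at most the expected sum.\<close>

lemma hit_le_wcoll:
  assumes w: "\<And>x. 0 \<le> w x" and M: "\<And>z. z \<in> S \<Longrightarrow> 1 \<le> wcoll w M z z"
    and "x \<in> V" "y \<in> V"
  shows "1 - stay (\<lambda>_. {(x, y). \<not> (x = y \<and> x \<in> S)}) n x y \<le> wcoll w (n + M) x y"
  using assms(3,4)
proof (induction n arbitrary: x y)
  case 0
  then show ?case using M[of x] wcoll_nonneg[OF w] by auto
next
  case (Suc n)
  show ?case
  proof (cases "x = y \<and> x \<in> S")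
    case True
    then have "1 \<le> wcoll w (Suc n + M) x y"
      using M[of x] wcoll_mono_time[where w = w and n = M and n' = "Suc n + M" and x = x and y = x] w by auto
    moreover have "stay (\<lambda>_. {(x, y). \<not> (x = y \<and> x \<in> S)}) (Suc n) x y = 0"
      using conjunct1[OF True] conjunct2[OF True] by simp
    ultimately show ?thesis by linarith
  next
    case False
    have "pavg (\<lambda>x y. 1 - stay (\<lambda>_. {(x, y). \<not> (x = y \<and> x \<in> S)}) n x y) x y \<le> pavg (wcoll w (n + M)) x y"
      using Suc edges by (intro pavg_mono) auto
    then show ?thesis using False Suc.prems w[of x] by (auto simp: pavg_diff pavg_const)
  qed
qed

lemma pavg_transition:
  "pavg (\<lambda>x y. transition t x z * transition t y z) x y = transition (Suc t) x z * transition (Suc t) y z"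
  by (simp add: pavg_def avg_cmult) (simp add: mult.commute[of "transition t _ z"] avg_cmult)

lemma wcoll_eq:
  assumes "finite S" "\<And>z. z \<notin> S \<Longrightarrow> w z = 0"
  shows "wcoll w n x y = (\<Sum>t\<le>n. \<Sum>z\<in>S. w z * (transition t x z * transition t y z))"
proof -
  have *: "(if x = y then w x else 0) = (\<Sum>z\<in>S. w z * (transition 0 x z * transition 0 y z))" for x y
  proof -
    have "(\<Sum>z\<in>S. w z * (transition 0 x z * transition 0 y z)) =
        (\<Sum>z\<in>S. if z = x then (if x = y then w x else 0) else 0)"
      by (intro sum.cong) auto
    then show ?thesis using assms by auto
  qed
  show ?thesis
  proof (induction n arbitrary: x y)
    case 0
    then show ?case using *[of x y] by simp
  next
    case (Suc n)
    have "pavg (wcoll w n) x y = (\<Sum>t\<le>n. \<Sum>z\<in>S. w z * (transition (Suc t) x z * transition (Suc t) y z))"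
      using Suc by (simp add: pavg_sum pavg_cmult pavg_transition cong: pavg_cong del: transition.simps)
    then show ?case
      unfolding sum.atMost_Suc_shift wcoll.simps by (simp only: *)
  qed
qed

lemma stay_UNIV: "x \<in> V \<Longrightarrow> y \<in> V \<Longrightarrow> stay (\<lambda>_. UNIV) n x y = 1"
proof (induction n arbitrary: x y)
  case (Suc n)
  have "pavg (stay (\<lambda>_. UNIV) n) x y = pavg (\<lambda>_ _. 1) x y"
    using Suc edges by (intro pavg_cong) auto
  then show ?case using Suc.prems by (simp add: pavg_const)
qed simp

lemma stay_meet:
  "stay (\<lambda>i. if i = t then {(z, z)} else UNIV) t x y = transition t x z * transition t y z"
proof (induction t arbitrary: x y)
  case (Suc t)
  have "stay (\<lambda>i. if i = Suc t then {(z, z)} else UNIV) (Suc t) x y =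
      pavg (\<lambda>x y. transition t x z * transition t y z) x y"
    using Suc by (simp cong: pavg_cong)
  then show ?case unfolding pavg_transition .
qed auto

text \<open>The vertices within distance \<open>t\<close>, a finite set that the walk cannot leave
  by time \<open>t\<close>; killing outside it is not felt up to then.\<close>

fun reach :: "nat \<Rightarrow> 'b \<Rightarrow> 'b set" where
  "reach 0 x = {x}"
| "reach (Suc t) x = insert x (\<Union>x'\<in>neighbours E x. reach t x')"

lemma finite_reach: "finite (reach t x)"
  by (induction t arbitrary: x) auto

lemma reach_subset: "x \<in> V \<Longrightarrow> reach t x \<subseteq> V"
  using edges by (induction t arbitrary: x) auto

lemma reach_mono: "t \<le> t' \<Longrightarrow> reach t x \<subseteq> reach t' x"
proof (rule lift_Suc_mono_le[of "\<lambda>t. reach t x"])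
  show "reach n x \<subseteq> reach (Suc n) x" for n by (induction n arbitrary: x) auto
qed

lemma transition_kern:
  assumes "reach t x \<subseteq> B" "B \<subseteq> V"
  shows "transition t x z = deg z * kern B t x z"
  using assms(1)
proof (induction t arbitrary: x)
  case 0
  then show ?case using deg_pos[of x] assms(2) by auto
next
  case (Suc t)
  have "avg x (\<lambda>x'. transition t x' z) = avg x (\<lambda>x'. deg z * kern B t x' z)"
    using Suc by (intro avg_cong) auto
  then show ?case using Suc.prems by (simp add: killed_def avg_cmult)
qed

end

context killed_walk
begin

text \<open>The killed kernel ignores collisions after an exit from \<open>B\<close>, and its
  diagonal value at time \<open>0\<close> is the inverse degree; hence the condition on
  \<open>w\<close>. One step of the pair is two time units of the kernel.\<close>

lemma kern_le_wcoll:
  assumes "\<And>y. y \<in> B \<Longrightarrow> \<theta> / deg y \<le> w y" and "\<And>x. 0 \<le> w x" and "0 \<le> \<theta>"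
  shows "\<theta> * (\<Sum>t\<le>n. kern B (2 * t) x y) \<le> wcoll w n x y"
proof (induction n arbitrary: x y)
  case 0
  then show ?case using assms by auto
next
  case (Suc n)
  let ?s = "\<lambda>x y. \<Sum>t\<le>n. kern B (2 * t) x y"
  have "pavg (\<lambda>x y. \<theta> * ?s x y) x y \<le> pavg (wcoll w n) x y"
    using Suc by (intro pavg_mono)
  then have 1: "\<theta> * pavg ?s x y \<le> pavg (wcoll w n) x y" by (simp only: pavg_cmult)
  have 0: "0 \<le> pavg (wcoll w n) x y" using wcoll_nonneg[OF assms(2)] by (intro pavg_nonneg)
  have "(\<Sum>t\<le>n. kern B (2 * Suc t) x y) = (if x \<in> B \<and> y \<in> B then pavg ?s x y else 0)"
    by (auto simp: kern_Suc_Suc[OF BV] pavg_sum simp del: kern.simps)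
  then have "\<theta> * (\<Sum>t\<le>n. kern B (2 * Suc t) x y) \<le> pavg (wcoll w n) x y"
    using 0 1 by simp
  moreover have "\<theta> * kern B 0 x y \<le> (if x = y then w x else 0)"
    using assms by auto
  ultimately show ?case
    unfolding sum.atMost_Suc_shift wcoll.simps distrib_left by (simp del: kern.simps)
qed

end

text \<open>The assumption \<open>pointwise\<close> bounds by \<open>m\<close> the resistance from
  each point of \<open>B\<close> to the complement of \<open>B\<close>.\<close>

locale transient_walk = killed_walk V E B for V :: "'b set" and E :: "'b rel" and B +
  fixes m :: real
  assumes m_nonneg: "0 \<le> m"
    and pointwise: "\<And>f z. z \<in> B \<Longrightarrow> supp f \<Longrightarrow> (f z)\<^sup>2 \<le> m * dirichlet B f"
begin

text \<open>The Green function of the square of the killed walk.\<close>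

definition green2 :: "'b \<Rightarrow> 'b \<Rightarrow> real" where
  "green2 x y = (\<Sum>t. kern B (2 * t) x y)"

lemma diag_partial: "(\<Sum>t\<le>n. kern B (2 * t) z z) \<le> m"
proof (cases "z \<in> B")
  case True
  have "(\<Sum>t\<le>n. kern B (2 * t) z z) = (\<Sum>t\<in>(*) 2 ` {..n}. kern B t z z)"
    by (subst sum.reindex) (auto simp: inj_on_def)
  also have "\<dots> \<le> (\<Sum>t<Suc (2 * n). kern B t z z)"
    by (intro sum_mono2) (auto simp: kern_nonneg)
  also have "\<dots> \<le> m" using True pointwise m_nonneg by (intro green_partial_bound)
  finally show ?thesis .
qed (simp add: kern_outside m_nonneg)

text \<open>The squared norm of the difference of the two kernels at time \<open>t\<close> is
  nonnegative. This makes the off-diagonal series converge.\<close>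

lemma kern_offdiag: "2 * kern B (2 * t) x y \<le> kern B (2 * t) x x + kern B (2 * t) y y"
proof (cases "x \<in> B \<and> y \<in> B")
  case True
  have *: "ip B (kern B t x) (kern B t y) = kern B (2 * t) x y" if "x \<in> B" "y \<in> B" for x y
  proof -
    have "ip B (kern B s x) (kern B t y) = kern B (s + t) x y" for s t
    proof (induction s arbitrary: t)
      case 0
      then show ?case using ip_kern_0[OF that(1), of "kern B t y"] kern_sym[OF BV, of t x y]
        by (simp add: ip_commute[of "kern B 0 x"] del: kern.simps)
    next
      case (Suc s)
      have "ip B (kern B (Suc s) x) (kern B t y) = ip B (kern B s x) (kern B (Suc t) y)"
        unfolding kern_Suc_fun[OF BV] by (rule killed_selfadjoint[symmetric]) (rule supp_kern)+
      then show ?case using Suc[of "Suc t"] by (simp del: kern.simps)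
    qed
    then show ?thesis by (simp add: mult_2)
  qed
  have "0 \<le> ip B (\<lambda>z. kern B t x z - kern B t y z) (\<lambda>z. kern B t x z - kern B t y z)"
    by (rule ip_self_nonneg)
  then show ?thesis
    using True by (simp add: ip_diff ip_diff_right * kern_sym[OF BV, of _ y x])
qed (auto simp: kern_outside kern_nonneg intro!: add_nonneg_nonneg)

lemma green2_sums: "(\<lambda>t. kern B (2 * t) x y) sums green2 x y"
proof -
  have "summable (\<lambda>t. kern B (2 * t) z z)" for z
  proof (rule summableI_nonneg_bounded)
    show "(\<Sum>t<n. kern B (2 * t) z z) \<le> m" for n
      by (rule order_trans[OF sum_mono2 diag_partial[of z n]]) (auto simp: kern_nonneg)
  qed (rule kern_nonneg)
  then have "summable (\<lambda>t. (kern B (2 * t) x x + kern B (2 * t) y y) / 2)"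
    by (intro summable_divide summable_add)
  then have "summable (\<lambda>t. kern B (2 * t) x y)"
    by (rule summable_comparison_test'[where N = 0])
       (use kern_offdiag[of _ x y] in \<open>simp add: kern_nonneg field_simps\<close>)
  then show ?thesis unfolding green2_def by (rule summable_sums)
qed

lemma green2_nonneg: "0 \<le> green2 x y"
  unfolding green2_def by (rule suminf_nonneg[OF sums_summable[OF green2_sums]]) (rule kern_nonneg)

text \<open>Induction on the horizon. On the diagonal the partial sum is at most \<open>m\<close>
  and \<open>avoid\<close> vanishes; off the diagonal the term at time \<open>0\<close> vanishes and
  one step of the pair of walks remains.\<close>

lemma green2_avoid:
  assumes "x \<in> V" "y \<in> V"
  shows "green2 x y \<le> m * (1 - lim (\<lambda>n. avoid n x y))"
proof -
  have *: "(\<Sum>t\<le>n. kern B (2 * t) x y) \<le> m * (1 - avoid n x y)" if "x \<in> V" "y \<in> V" for n x y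
    using that
  proof (induction n arbitrary: x y)
    case 0
    then show ?case using diag_partial[of x 0] m_nonneg by (auto simp: avoid_simps)
  next
    case (Suc n)
    let ?s = "\<lambda>x y. \<Sum>t\<le>n. kern B (2 * t) x y"
    show ?case
    proof (cases "x = y")
      case True
      then show ?thesis using diag_partial[of x "Suc n"] by (simp add: avoid_simps)
    next
      case False
      have "(\<Sum>t\<le>Suc n. kern B (2 * t) x y) = (\<Sum>t\<le>n. kern B (2 * Suc t) x y)"
        unfolding sum.atMost_Suc_shift using False by simp
      also have "\<dots> = (if x \<in> B \<and> y \<in> B then pavg ?s x y else 0)"
        by (auto simp: kern_Suc_Suc[OF BV] pavg_sum simp del: kern.simps)
      also have "\<dots> \<le> pavg ?s x y"
        by (auto intro!: pavg_nonneg sum_nonneg kern_nonneg)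
      also have "\<dots> \<le> pavg (\<lambda>x y. m * (1 - avoid n x y)) x y"
        using Suc edges by (intro pavg_mono) auto
      also have "\<dots> = m * (1 - avoid (Suc n) x y)"
        using False Suc.prems by (simp add: avoid_simps pavg_cmult pavg_diff pavg_const)
      finally show ?thesis .
    qed
  qed
  show ?thesis
  proof (rule LIMSEQ_le)
    show "(\<lambda>n. \<Sum>t\<le>n. kern B (2 * t) x y) \<longlonglongrightarrow> green2 x y"
      using green2_sums by (simp add: sums_def_le)
    show "(\<lambda>n. m * (1 - avoid n x y)) \<longlonglongrightarrow> m * (1 - lim (\<lambda>n. avoid n x y))"
      by (intro tendsto_intros avoid_limit assms)
  qed (use *[OF assms] in auto)
qed

lemma supp_green2: "supp (green2 x)"
  by (rule suppI) (simp add: green2_def kern_outside)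

text \<open>Dropping the first term of the series shifts it by two steps, so \<open>green2 x\<close>
  is the image of the point density under the inverse of the identity minus the squared killed
  operator.\<close>

lemma green2_reproducing:
  assumes x: "x \<in> B" and f: "supp f"
  shows "ip B f (green2 x) - ip B (killed B f) (killed B (green2 x)) = f x"
proof -
  have "(\<lambda>t. killed B (kern B (2 * t) x) y) sums killed B (green2 x) y" for y
    by (intro sums_killed green2_sums)
  then have "(\<lambda>t. killed B (killed B (kern B (2 * t) x)) y) sums killed B (killed B (green2 x)) y" for y
    by (rule sums_killed)
  then have 1: "(\<lambda>t. kern B (2 * Suc t) x y) sums killed B (killed B (green2 x)) y" for y
    by (simp add: kern_Suc_fun[OF BV, symmetric] del: kern.simps)
  have 2: "(\<lambda>t. kern B (2 * Suc t) x y) sums (green2 x y - kern B 0 x y)" for y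
    using green2_sums[of x y] sums_Suc_iff[of "\<lambda>t. kern B (2 * t) x y" "green2 x y - kern B 0 x y"]
    by (simp del: kern.simps)
  have "killed B (killed B (green2 x)) = (\<lambda>y. green2 x y - kern B 0 x y)"
    using sums_unique2[OF 1 2] by auto
  then have "ip B f (killed B (killed B (green2 x))) = ip B f (green2 x) - f x"
    by (simp add: ip_diff_right ip_kern_0[OF x] del: kern.simps)
  then show ?thesis
    using killed_selfadjoint[OF f supp_killed, of "green2 x"] by simp
qed

text \<open>The Cauchy-Schwarz inequality for the two-step form of \<open>f\<close> and
  \<open>green2 x\<close>, the latter having form value \<open>green2 x x\<close>. A function of
  small energy with value \<open>1\<close> at \<open>x\<close> thus forces a large Green
  function.\<close>

lemma green2_lower:
  assumes x: "x \<in> B" and f: "supp f"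
  shows "(f x)\<^sup>2 \<le> 2 * dirichlet B f * green2 x x"
proof -
  let ?G = "green2 x" and ?e = "\<lambda>f g. ip B f g - ip B (killed B f) (killed B g)"
  have k: "killed B (\<lambda>y. f y - s * ?G y) = (\<lambda>y. killed B f y - s * killed B ?G y)" for s
    by (auto simp: killed_def avg_diff avg_cmult)
  have G: "?e ?G ?G = ?G x" "?e f ?G = f x"
    using green2_reproducing[OF x] supp_green2 f by auto
  have *: "0 \<le> ?e f f - 2 * s * f x + s\<^sup>2 * ?G x" for s
  proof -
    have "supp (\<lambda>y. f y - s * ?G y)"
      using f supp_green2[of x] by (simp add: supp_def)
    from killed_contraction[OF this]
    have "0 \<le> ?e (\<lambda>y. f y - s * ?G y) (\<lambda>y. f y - s * ?G y)" by simp
    also have "\<dots> = ?e f f - 2 * s * ?e f ?G + s\<^sup>2 * ?e ?G ?G"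
      unfolding k by (simp add: ip_diff ip_diff_right ip_cmult ip_cmult_right
          ip_commute[of "green2 x" f] ip_commute[of "killed B (green2 x)" "killed B f"]
          algebra_simps power2_eq_square)
    finally show ?thesis by (simp add: G)
  qed
  have d: "deg x > 0" using x BV by (auto intro: deg_pos)
  have "kern B (2 * 0) x x \<le> ?G x"
    using sum_le_suminf[OF sums_summable[OF green2_sums[of x x]], of "{0}"]
    by (simp add: green2_def kern_nonneg)
  then have pos: "0 < ?G x" using x d by (simp add: less_le_trans[of 0 "1 / deg x"])
  \<comment> \<open>\<open>f x / ?G x\<close> minimises the quadratic in \<open>s\<close>.\<close>
  have "0 \<le> ?G x * (?e f f - 2 * (f x / ?G x) * f x + (f x / ?G x)\<^sup>2 * ?G x)"
    using *[of "f x / ?G x"] pos by simp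
  also have "\<dots> = ?e f f * ?G x - (f x)\<^sup>2"
    using pos by (simp add: field_simps power2_eq_square)
  finally have "(f x)\<^sup>2 \<le> ?e f f * ?G x" by simp
  also have "\<dots> \<le> 2 * dirichlet B f * ?G x"
    using dirichlet_two_step[OF f] pos by (intro mult_right_mono) auto
  finally show ?thesis .
qed

end

context lf_graph
begin

text \<open>\<open>two_step_variance\<close> is chained along the even path, and \<open>Z\<close>
  collects the midpoints of its two-step pieces. \<open>C\<close> and \<open>Z\<close> depend on the
  path alone, so \<open>B\<close> can be enlarged afterwards.\<close>

lemma even_path_comparison:
  assumes "x \<in> V" and "(x, y) \<in> E ^^ (2 * n)"
  shows "\<exists>C Z. 0 \<le> C \<and> finite Z \<and> Z \<subseteq> V \<and> (\<forall>B f. killed_walk V E B \<longrightarrow> Z \<subseteq> B \<longrightarrow>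
    (\<forall>x. x \<notin> B \<longrightarrow> f x = 0) \<longrightarrow>
    (f x - f y)\<^sup>2 \<le> C * (ip B f f - ip B (killed B f) (killed B f)))"
  using assms(2)
proof (induction n arbitrary: y)
  case 0
  then have "y = x" by simp
  then show ?case by (intro exI[of _ 0] exI[of _ "{}"]) simp
next
  case (Suc n)
  then obtain u z where u: "(x, u) \<in> E ^^ (2 * n)" and uz: "(u, z) \<in> E" "(z, y) \<in> E"
    by (auto simp: relcomp_unfold)
  from Suc.IH[OF u] obtain C Z where C: "0 \<le> C" "finite Z" "Z \<subseteq> V" and
    *: "\<And>B f. killed_walk V E B \<Longrightarrow> Z \<subseteq> B \<Longrightarrow> (\<forall>x. x \<notin> B \<longrightarrow> f x = 0) \<Longrightarrow>
      (f x - f u)\<^sup>2 \<le> C * (ip B f f - ip B (killed B f) (killed B f))" by blast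
  show ?case
  proof (rule exI[of _ "2 * C + 2 * deg z"], rule exI[of _ "insert z Z"], intro conjI allI impI)
    fix B and f :: "'b \<Rightarrow> real" assume B: "killed_walk V E B" "insert z Z \<subseteq> B" and f: "\<forall>x. x \<notin> B \<longrightarrow> f x = 0"
    interpret K: killed_walk V E B by fact
    have "(f u - f y)\<^sup>2 \<le> deg z * (ip B f f - ip B (killed B f) (killed B f))"
      using B uz f edge_sym by (intro K.two_step_variance) (auto simp: K.supp_def)
    moreover have "(f x - f u)\<^sup>2 \<le> C * (ip B f f - ip B (killed B f) (killed B f))"
      using * B f by auto
    moreover have "(f x - f y)\<^sup>2 \<le> 2 * (f x - f u)\<^sup>2 + 2 * (f u - f y)\<^sup>2"
      using sum_squares_bound[of "f x - f u" "f u - f y"] by (simp add: power2_eq_square algebra_simps)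
    ultimately show "(f x - f y)\<^sup>2 \<le> (2 * C + 2 * deg z) * (ip B f f - ip B (killed B f) (killed B f))"
      by (simp add: distrib_right)
  qed (use C uz edges deg_nonneg in auto)
qed

end

section \<open>The law of two independent walks\<close>

lemma (in srw_graph) prob_space_srw_law: "prob_space (srw_law V E x)"
proof
  let ?M = "\<lambda>_::nat. count_space V"
  have X: "space (PiM {} ?M) \<in> sets (PiM {} ?M)" by simp
  have "srw.PF.emb UNIV {} (space (PiM {} ?M)) = space (srw_law V E x)"
    by (auto simp: prod_emb_def srw_law_eq space_PiM)
  then have "emeasure (srw_law V E x) (space (srw_law V E x)) =
      emeasure (srw.CI {}) (space (PiM {} ?M))"
    using srw.lim[OF _ X] by (simp add: srw_law_eq)
  also have "\<dots> = 1"
    using prob_space.emeasure_space_1[OF srw.PF.prob_space_P[of "{}"]] srw.PF.space_P[of "{}"] by simp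
  finally show "emeasure (srw_law V E x) (space (srw_law V E x)) = 1" .
qed

context lf_graph
begin

lemma srw_graph: "x \<in> V \<Longrightarrow> srw_graph V E x"
  using edges locally_finite no_isolated by (intro srw_graph.intro)

lemma space_srw_law: "x \<in> V \<Longrightarrow> space (srw_law V E x) = UNIV \<rightarrow>\<^sub>E V"
  and sets_srw_law: "x \<in> V \<Longrightarrow> sets (srw_law V E x) = sets (PiM UNIV (\<lambda>_. count_space V))"
proof -
  assume "x \<in> V"
  then interpret srw_graph V E x by (rule srw_graph)
  show "space (srw_law V E x) = UNIV \<rightarrow>\<^sub>E V" "sets (srw_law V E x) = sets (PiM UNIV (\<lambda>_. count_space V))"
    by (simp_all add: srw_law_eq space_PiM)
qed

lemma prob_space_srw_law: "x \<in> V \<Longrightarrow> prob_space (srw_law V E x)"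
  by (rule srw_graph.prob_space_srw_law[OF srw_graph])

text \<open>The starting vertex is omitted from these lists; the trajectory is
  \<open>x # ps\<close>.\<close>

fun walks :: "nat \<Rightarrow> 'b \<Rightarrow> 'b list set" where
  "walks 0 x = {[]}"
| "walks (Suc n) x = (\<Union>x'\<in>neighbours E x. (#) x' ` walks n x')"

fun weight :: "'b \<Rightarrow> 'b list \<Rightarrow> real" where
  "weight x [] = 1"
| "weight x (y # ps) = weight y ps / deg x"

definition cyl :: "'b \<Rightarrow> 'b list \<Rightarrow> (nat \<Rightarrow> 'b) set" where
  "cyl x ps = {\<omega> \<in> space (srw_law V E x). \<forall>i\<le>length ps. \<omega> i = (x # ps) ! i}"

lemma finite_walks: "finite (walks n x)"
  by (induction n arbitrary: x) auto

lemma length_walks: "ps \<in> walks n x \<Longrightarrow> length ps = n"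
  by (induction n arbitrary: x ps) auto

lemma weight_nonneg: "0 \<le> weight x ps"
  by (induction x ps rule: weight.induct) (auto simp: deg_nonneg)

lemma walks_subset: "x \<in> V \<Longrightarrow> ps \<in> walks n x \<Longrightarrow> i \<le> n \<Longrightarrow> (x # ps) ! i \<in> V"
proof (induction n arbitrary: x ps i)
  case (Suc n)
  then show ?case using edges by (cases i) auto
qed auto

lemma sum_walks_Suc:
  "(\<Sum>ps\<in>walks (Suc n) x. f ps) = (\<Sum>x'\<in>neighbours E x. \<Sum>ps\<in>walks n x'. f (x' # ps))"
  by (simp, subst sum.UNION_disjoint) (auto simp: finite_walks sum.reindex)

lemma measure_cyl:
  assumes x: "x \<in> V" and ps: "ps \<in> walks n x"
  shows "measure (srw_law V E x) (cyl x ps) = weight x ps"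
proof -
  interpret srw_graph V E x by (rule srw_graph[OF x])
  define step where "step u v = (if (u, v) \<in> E then ennreal (1 / real (card (neighbours E u))) else 0)" for u v
  have "(\<Prod>i<n. step ((x # ps) ! i) ((x # ps) ! Suc i)) = ennreal (weight x ps)"
    using x ps
  proof (induction n arbitrary: x ps)
    case (Suc n)
    then obtain x' qs where q: "ps = x' # qs" "(x, x') \<in> E" "qs \<in> walks n x'" by auto
    with Suc.IH[of x' qs] edges show ?case
      by (subst prod.lessThan_Suc_shift)
         (auto simp: deg_def ennreal_mult'[symmetric] weight_nonneg step_def)
  qed simp
  then have "emeasure (srw_law V E x) (cyl x ps) = ennreal (weight x ps)"
    unfolding cyl_def length_walks[OF ps] step_def
    using emeasure_srw_law_cylinder[of n "\<lambda>i. (x # ps) ! i"] walks_subset[OF x ps] by auto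
  then show ?thesis by (simp add: measure_def weight_nonneg)
qed

end

section \<open>Events for pairs of trajectories\<close>

locale countable_lf_graph = lf_graph V E for V :: "'b set" and E :: "'b rel" +
  assumes countable_V: "countable V"
begin

abbreviation "L x y \<equiv> collision_law V E x y"

lemma prob_space_L: "x \<in> V \<Longrightarrow> y \<in> V \<Longrightarrow> prob_space (L x y)"
  unfolding collision_law_def
  by (intro prob_space_pair prob_space_srw_law)

lemma space_L: "x \<in> V \<Longrightarrow> y \<in> V \<Longrightarrow> space (L x y) = (UNIV \<rightarrow>\<^sub>E V) \<times> (UNIV \<rightarrow>\<^sub>E V)"
  by (simp add: collision_law_def space_pair_measure space_srw_law)

lemma cyl_sets: "x \<in> V \<Longrightarrow> ps \<in> walks n x \<Longrightarrow> cyl x ps \<in> sets (srw_law V E x)"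
proof -
  assume x: "x \<in> V" and ps: "ps \<in> walks n x"
  have *: "{\<omega> \<in> space (srw_law V E x). \<omega> i = (x # ps) ! i} \<in> sets (srw_law V E x)" for i
  proof (cases "(x # ps) ! i \<in> V")
    case True
    have "(\<lambda>\<omega>. \<omega> i) \<in> measurable (srw_law V E x) (count_space V)"
      by (simp add: measurable_cong_sets[OF sets_srw_law[OF x] refl])
    from measurable_sets[OF this, of "{(x # ps) ! i}"] True show ?thesis
      by (auto simp: vimage_def Int_def conj_commute elim!: back_subst[where P = "\<lambda>A. A \<in> _"])
  next
    case False
    then have e: "{\<omega> \<in> space (srw_law V E x). \<omega> i = (x # ps) ! i} = {}"
      unfolding space_srw_law[OF x] using PiE_mem[of _ UNIV "\<lambda>_. V" i] by fastforce
    show ?thesis unfolding e by simp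
  qed
  have "cyl x ps = {\<omega> \<in> space (srw_law V E x). \<forall>i\<in>{..length ps}. \<omega> i = (x # ps) ! i}"
    by (auto simp: cyl_def)
  then show ?thesis using sets.sets_Collect_finite_All[OF *, of "{..length ps}"] by simp
qed

lemma sets_pair_position:
  assumes x: "x \<in> V" and y: "y \<in> V"
  shows "{\<omega> \<in> space (L x y). (fst \<omega> i, snd \<omega> i) \<in> A} \<in> sets (L x y)"
proof -
  have m: "(\<lambda>\<omega>. fst \<omega> i) \<in> measurable (L x y) (count_space V)"
    "(\<lambda>\<omega>. snd \<omega> i) \<in> measurable (L x y) (count_space V)"
    unfolding collision_law_def
    by (simp_all add: measurable_cong_sets[OF sets_pair_measure_cong[OF sets_srw_law[OF x] sets_srw_law[OF y]] refl])
  have "{\<omega> \<in> space (L x y). (fst \<omega> i, snd \<omega> i) \<in> A} =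
      (\<Union>(a, b)\<in>A \<inter> V \<times> V. ((\<lambda>\<omega>. fst \<omega> i) -` {a} \<inter> space (L x y)) \<inter> ((\<lambda>\<omega>. snd \<omega> i) -` {b} \<inter> space (L x y)))"
    by (auto simp: space_L[OF x y] PiE_iff)
  also have "\<dots> \<in> sets (L x y)"
    using countable_V by (intro sets.countable_UN' countable_Int2 countable_SIGMA)
      (auto intro!: sets.Int measurable_sets[OF m(1)] measurable_sets[OF m(2)])
  finally show ?thesis .
qed

definition staying :: "'b \<Rightarrow> 'b \<Rightarrow> (nat \<Rightarrow> ('b \<times> 'b) set) \<Rightarrow> nat \<Rightarrow> ((nat \<Rightarrow> 'b) \<times> (nat \<Rightarrow> 'b)) set" where
  "staying x y A n = {\<omega> \<in> space (L x y). \<forall>i\<le>n. (fst \<omega> i, snd \<omega> i) \<in> A i}"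

lemma staying_sets: "x \<in> V \<Longrightarrow> y \<in> V \<Longrightarrow> staying x y A n \<in> sets (L x y)"
proof -
  assume "x \<in> V" "y \<in> V"
  note * = sets_pair_position[OF this]
  have "staying x y A n = {\<omega> \<in> space (L x y). \<forall>i\<in>{..n}. (fst \<omega> i, snd \<omega> i) \<in> A i}"
    by (auto simp: staying_def)
  then show ?thesis using sets.sets_Collect_finite_All[OF *, of "{..n}" "\<lambda>i. i" A] by simp
qed

lemma sum_weight_stay:
  "(\<Sum>ps\<in>walks n x. \<Sum>qs\<in>walks n y.
     of_bool (\<forall>i\<le>n. ((x # ps) ! i, (y # qs) ! i) \<in> A i) * (weight x ps * weight y qs)) = stay A n x y"
proof (induction n arbitrary: x y A)
  case (Suc n)
  have all: "(\<forall>i\<le>Suc n. P i) \<longleftrightarrow> P 0 \<and> (\<forall>i\<le>n. P (Suc i))" for P :: "nat \<Rightarrow> bool"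
    using All_less_Suc2[of "Suc n" P] by (simp add: less_Suc_eq_le)
  let ?g = "\<lambda>x' y' ps qs. of_bool (\<forall>i\<le>n. ((x' # ps) ! i, (y' # qs) ! i) \<in> A (Suc i)) *
      (weight x' ps * weight y' qs)"
  have "(\<Sum>ps\<in>walks (Suc n) x. \<Sum>qs\<in>walks (Suc n) y.
     of_bool (\<forall>i\<le>Suc n. ((x # ps) ! i, (y # qs) ! i) \<in> A i) * (weight x ps * weight y qs)) =
     (\<Sum>x'\<in>neighbours E x. \<Sum>ps\<in>walks n x'. \<Sum>y'\<in>neighbours E y. \<Sum>qs\<in>walks n y'.
       of_bool ((x, y) \<in> A 0) / (deg x * deg y) * ?g x' y' ps qs)"
    unfolding sum_walks_Suc all by (intro sum.cong refl) auto
  also have "\<dots> = (\<Sum>x'\<in>neighbours E x. \<Sum>y'\<in>neighbours E y.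
      of_bool ((x, y) \<in> A 0) / (deg x * deg y) * (\<Sum>ps\<in>walks n x'. \<Sum>qs\<in>walks n y'. ?g x' y' ps qs))"
    unfolding sum_distrib_left by (intro sum.cong refl sum.swap)
  also have "\<dots> = of_bool ((x, y) \<in> A 0) / (deg x * deg y) *
      (\<Sum>x'\<in>neighbours E x. \<Sum>y'\<in>neighbours E y. stay (\<lambda>i. A (Suc i)) n x' y')"
    unfolding sum_distrib_left Suc.IH ..
  also have "\<dots> = stay A (Suc n) x y"
    by (simp add: pavg_def avg_def sum_divide_distrib[symmetric])
  finally show ?case .
qed simp

text \<open>Trajectories are arbitrary sequences in \<open>V\<close>, so the event is not a union of
  cylinders over walks. The case in which every \<open>A i\<close> is \<open>UNIV\<close> shows that
  these cylinders carry the full mass, and the event agrees almost everywhere with the cylinders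
  listed in \<open>G A\<close>.\<close>

lemma measure_staying:
  assumes x: "x \<in> V" and y: "y \<in> V"
  shows "measure (L x y) (staying x y A n) = stay A n x y"
proof -
  interpret L: prob_space "L x y" by (rule prob_space_L[OF x y])
  interpret X: prob_space "srw_law V E x" by (rule prob_space_srw_law[OF x])
  interpret Y: prob_space "srw_law V E y" by (rule prob_space_srw_law[OF y])
  interpret XY: pair_prob_space "srw_law V E x" "srw_law V E y" ..
  let ?I = "walks n x \<times> walks n y" and ?C = "\<lambda>(ps, qs). cyl x ps \<times> cyl y qs"
  have Cs: "?C p \<in> sets (L x y)" if "p \<in> ?I" for p
    using that cyl_sets[OF x] cyl_sets[OF y] by (auto simp: collision_law_def)
  have Cm: "measure (L x y) (?C (ps, qs)) = weight x ps * weight y qs"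
    if "ps \<in> walks n x" "qs \<in> walks n y" for ps qs
    using Y.emeasure_pair_measure_Times[OF cyl_sets[OF x that(1)] cyl_sets[OF y that(2)]]
      measure_cyl[OF x that(1)] measure_cyl[OF y that(2)]
    by (simp add: collision_law_def measure_def enn2real_mult)
  have len: "length ps = n" "length qs = n" if "(ps, qs) \<in> ?I" for ps qs
    using that length_walks by auto
  have C_iff: "\<omega> \<in> ?C (ps, qs) \<longleftrightarrow> \<omega> \<in> space (L x y) \<and> (\<forall>i\<le>n. fst \<omega> i = (x # ps) ! i) \<and> (\<forall>i\<le>n. snd \<omega> i = (y # qs) ! i)"
    if "(ps, qs) \<in> ?I" for ps qs \<omega>
    using len[OF that] by (cases \<omega>) (auto simp: cyl_def collision_law_def space_pair_measure)
  have inj: "ps = ps'" if "length ps = n" "length ps' = n" "\<forall>i\<le>n. (z # ps) ! i = (z # ps') ! i" for z :: 'b and ps ps'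
    using that by (intro nth_equalityI) (auto dest!: spec[of _ "Suc _"])
  have disj: "disjoint_family_on ?C ?I"
    unfolding disjoint_family_on_def
  proof (intro ballI impI)
    fix p p' assume p: "p \<in> ?I" "p' \<in> ?I" "p \<noteq> p'"
    obtain ps qs ps' qs' where [simp]: "p = (ps, qs)" "p' = (ps', qs')" by (cases p, cases p')
    show "?C p \<inter> ?C p' = {}"
    proof (rule ccontr)
      assume "?C p \<inter> ?C p' \<noteq> {}"
      then obtain \<omega> where "\<omega> \<in> ?C (ps, qs)" "\<omega> \<in> ?C (ps', qs')" by auto
      then have e: "\<forall>i\<le>n. (x # ps) ! i = (x # ps') ! i" "\<forall>i\<le>n. (y # qs) ! i = (y # qs') ! i"
        using iffD1[OF C_iff[of ps qs \<omega>]] iffD1[OF C_iff[of ps' qs' \<omega>]] p by simp_all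
      have "ps = ps'" using p len by (intro inj[OF _ _ e(1)]) auto
      moreover have "qs = qs'" using p len by (intro inj[OF _ _ e(2)]) auto
      ultimately show False using p by simp
    qed
  qed
  define G where "G A = {(ps, qs) \<in> ?I. \<forall>i\<le>n. ((x # ps) ! i, (y # qs) ! i) \<in> A i}" for A
  have GI: "G A \<subseteq> ?I" for A by (auto simp: G_def)
  have finI: "finite ?I" by (simp add: finite_walks)
  have mG: "measure (L x y) (\<Union>p\<in>G A. ?C p) = stay A n x y" for A
  proof -
    have "measure (L x y) (\<Union>p\<in>G A. ?C p) = (\<Sum>p\<in>G A. measure (L x y) (?C p))"
    proof (intro L.finite_measure_finite_Union)
      show "?C ` G A \<subseteq> L.events" using GI Cs by blast
    qed (use finite_subset[OF GI finI] disjoint_family_on_mono[OF GI disj] in auto)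
    also have "\<dots> = (\<Sum>(ps, qs)\<in>G A. weight x ps * weight y qs)"
      by (intro sum.cong) (auto simp: Cm[simplified] G_def)
    also have "\<dots> = (\<Sum>(ps, qs)\<in>?I. of_bool (\<forall>i\<le>n. ((x # ps) ! i, (y # qs) ! i) \<in> A i) * (weight x ps * weight y qs))"
      unfolding G_def using finI by (intro sum.mono_neutral_cong_left) auto
    also have "\<dots> = stay A n x y"
      unfolding sum_weight_stay[symmetric] by (simp add: sum.cartesian_product)
    finally show ?thesis .
  qed
  let ?U = "\<Union>p\<in>?I. ?C p"
  have GU: "G (\<lambda>_. UNIV) = ?I" by (auto simp: G_def)
  have U: "?U \<in> sets (L x y)" using finI Cs by (intro sets.finite_UN) auto
  have "measure (L x y) ?U = 1"
    using mG[of "\<lambda>_. UNIV"] unfolding GU by (simp add: stay_UNIV x y)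
  then have "AE \<omega> in L x y. \<omega> \<in> ?U" using L.prob_eq_1[OF U] by simp
  then have "measure (L x y) (staying x y A n) = measure (L x y) (\<Union>p\<in>G A. ?C p)"
  proof (intro L.finite_measure_eq_AE staying_sets x y)
    show "(\<Union>p\<in>G A. ?C p) \<in> sets (L x y)"
      using finite_subset[OF GI finI] GI Cs by (intro sets.finite_UN) blast+
    assume "AE \<omega> in L x y. \<omega> \<in> ?U"
    then show "AE \<omega> in L x y. (\<omega> \<in> staying x y A n) = (\<omega> \<in> (\<Union>p\<in>G A. ?C p))"
    proof (rule AE_mp, intro AE_I2 impI)
      fix \<omega> assume "\<omega> \<in> ?U"
      then obtain ps qs where pq: "(ps, qs) \<in> ?I" "\<omega> \<in> ?C (ps, qs)" by blast
      have "\<omega> \<in> staying x y A n \<longleftrightarrow> (ps, qs) \<in> G A"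
        using pq C_iff[OF pq(1), of \<omega>] by (auto simp: staying_def G_def)
      moreover have "(ps, qs) \<in> G A" if g: "p \<in> G A" "\<omega> \<in> ?C p" for p
      proof -
        have "p \<in> ?I" using g(1) GI by blast
        then have "p = (ps, qs)"
          using disjoint_family_onD[OF disj _ pq(1), of p] g(2) pq(2) by blast
        then show ?thesis using g(1) by simp
      qed
      ultimately show "(\<omega> \<in> staying x y A n) = (\<omega> \<in> (\<Union>p\<in>G A. ?C p))"
        using pq by blast
    qed
  qed
  then show ?thesis by (simp add: mG)
qed

lemma infinite_collisions_sets:
  assumes "x \<in> V" "y \<in> V"
  shows "{\<omega> \<in> space (L x y). finite (collision_times \<omega>)} \<in> sets (L x y)"
    "{\<omega> \<in> space (L x y). infinite (collision_times \<omega>)} \<in> sets (L x y)"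
proof -
  have "{\<omega> \<in> space (L x y). infinite (collision_times \<omega>)} =
    {\<omega> \<in> space (L x y). \<forall>m. \<exists>n. n \<ge> m \<and> (fst \<omega> n, snd \<omega> n) \<in> Id}"
    by (auto simp: collision_times_def infinite_nat_iff_unbounded_le case_prod_beta)
  also have "\<dots> \<in> sets (L x y)"
  proof (intro sets.sets_Collect_countable_All sets.sets_Collect_countable_Ex)
    show "{\<omega> \<in> space (L x y). n \<ge> m \<and> (fst \<omega> n, snd \<omega> n) \<in> Id} \<in> sets (L x y)" for m n
      using sets_pair_position[OF assms, of n Id] by (cases "n \<ge> m") auto
  qed
  finally show *: "{\<omega> \<in> space (L x y). infinite (collision_times \<omega>)} \<in> sets (L x y)" .
  have "{\<omega> \<in> space (L x y). finite (collision_times \<omega>)} =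
      space (L x y) - {\<omega> \<in> space (L x y). infinite (collision_times \<omega>)}" by auto
  then show "{\<omega> \<in> space (L x y). finite (collision_times \<omega>)} \<in> sets (L x y)" using * by simp
qed

text \<open>The complement is the countable union over \<open>k\<close> of the null events that no
  collision occurs from time \<open>k\<close> on.\<close>

lemma infinite_collision_propertyI:
  assumes "\<And>x k. x \<in> V \<Longrightarrow>
    (\<lambda>n. stay (\<lambda>i. if i < k then UNIV else {(x, y). x \<noteq> y}) (k + n) x x) \<longlonglongrightarrow> 0"
  shows "infinite_collision_property V E"
  unfolding infinite_collision_property_def
proof
  fix x assume x: "x \<in> V"
  interpret L: prob_space "L x x" by (rule prob_space_L[OF x x])
  let ?A = "\<lambda>k i. if i < k then UNIV else {(x, y). x \<noteq> y}"
  define N where "N k = {\<omega> \<in> space (L x x). \<forall>i\<ge>k. fst \<omega> i \<noteq> snd \<omega> i}" for k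
  have sub: "N k \<subseteq> staying x x (?A k) (k + n)" for k n
    by (auto simp: N_def staying_def)
  have N_sets: "N k \<in> sets (L x x)" for k
  proof -
    have "N k = (\<Inter>n. staying x x (?A k) (k + n))"
    proof
      show "(\<Inter>n. staying x x (?A k) (k + n)) \<subseteq> N k"
      proof
        fix \<omega> assume w: "\<omega> \<in> (\<Inter>n. staying x x (?A k) (k + n))"
        then have "fst \<omega> i \<noteq> snd \<omega> i" if "i \<ge> k" for i
          using INT_D[OF w, of "i - k"] that by (auto simp: staying_def dest!: spec[of _ i])
        then show "\<omega> \<in> N k" using w by (auto simp: N_def staying_def)
      qed
    qed (use sub in auto)
    then show ?thesis using staying_sets[OF x x] by auto
  qed
  have "measure (L x x) (N k) \<le> 0" for k
  proof (rule LIMSEQ_le_const[OF assms[OF x]], intro exI allI impI)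
    show "measure (L x x) (N k) \<le> stay (?A k) (k + n) x x" for n
      unfolding measure_staying[OF x x, symmetric]
      by (rule L.finite_measure_mono[OF sub staying_sets[OF x x]])
  qed
  then have "measure (L x x) (N k) = 0" for k
    using measure_nonneg[of "L x x" "N k"] by (simp add: antisym)
  then have "AE \<omega> in L x x. \<omega> \<notin> N k" for k
    using L.prob_eq_0[OF N_sets[of k]] by simp
  then have "AE \<omega> in L x x. \<forall>k. \<omega> \<notin> N k"
    by (simp add: AE_all_countable)
  then have "AE \<omega> in L x x. \<omega> \<in> {\<omega> \<in> space (L x x). infinite (collision_times \<omega>)}"
    by (rule AE_mp, intro AE_I2)
       (auto simp: N_def collision_times_def infinite_nat_iff_unbounded_le case_prod_beta)
  then show "measure (L x x) {\<omega> \<in> space (L x x). infinite (collision_times \<omega>)} = 1"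
    using L.prob_eq_1[OF infinite_collisions_sets(2)[OF x x]] by simp
qed

text \<open>Two uses of the Borel-Cantelli lemma: almost surely only finitely many
  \<open>S i\<close> contain a collision, and each single vertex carries only finitely many. The
  second is there because a finite set might be revisited for ever.\<close>

lemma finite_collision_propertyI:
  fixes S :: "nat \<Rightarrow> 'b set"
  assumes fin: "\<And>i. finite (S i)" and cover: "V \<subseteq> (\<Union>i. S i)"
    and b: "\<And>x. x \<in> V \<Longrightarrow> \<exists>b. summable b \<and>
      (\<forall>i n. 1 - stay (\<lambda>_. {(x, y). \<not> (x = y \<and> x \<in> S i)}) n x x \<le> b i)"
    and t: "\<And>x z. x \<in> V \<Longrightarrow> z \<in> V \<Longrightarrow> summable (\<lambda>t. transition t x z * transition t x z)"
  shows "finite_collision_property V E"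
  unfolding finite_collision_property_def
proof
  fix x assume x: "x \<in> V"
  interpret L: prob_space "L x x" by (rule prob_space_L[OF x x])
  obtain b where sb: "summable b" and
    b: "\<And>i n. 1 - stay (\<lambda>_. {(x, y). \<not> (x = y \<and> x \<in> S i)}) n x x \<le> b i"
    using b[OF x] by blast
  let ?D = "\<lambda>i. {(x, y). \<not> (x = y \<and> x \<in> S i)}"
  define H where "H i = {\<omega> \<in> space (L x x). \<exists>n. fst \<omega> n = snd \<omega> n \<and> fst \<omega> n \<in> S i}" for i
  have H: "H i = (\<Union>n. space (L x x) - staying x x (\<lambda>_. ?D i) n)" for i
    by (fastforce simp: H_def staying_def)
  have H_sets: "H i \<in> sets (L x x)" for i
    unfolding H using staying_sets[OF x x] by auto
  have H_le: "measure (L x x) (H i) \<le> b i" for i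
  proof (rule LIMSEQ_le_const2)
    show "(\<lambda>n. measure (L x x) (space (L x x) - staying x x (\<lambda>_. ?D i) n)) \<longlonglongrightarrow> measure (L x x) (H i)"
      unfolding H
    proof (rule L.finite_Lim_measure_incseq)
      show "range (\<lambda>n. space (L x x) - staying x x (\<lambda>_. ?D i) n) \<subseteq> L.events"
        using staying_sets[OF x x] by blast
      have "staying x x (\<lambda>_. ?D i) n' \<subseteq> staying x x (\<lambda>_. ?D i) n" if "n \<le> n'" for n n'
        using that unfolding staying_def by (auto dest: order_trans)
      then show "incseq (\<lambda>n. space (L x x) - staying x x (\<lambda>_. ?D i) n)"
        by (blast intro: incseq_def[THEN iffD2])
    qed
    show "\<exists>N. \<forall>n\<ge>N. measure (L x x) (space (L x x) - staying x x (\<lambda>_. ?D i) n) \<le> b i"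
      using b[of i] by (simp add: L.prob_compl staying_sets[OF x x] measure_staying[OF x x])
  qed
  have "summable (\<lambda>i. measure (L x x) (H i))"
    by (rule summable_comparison_test'[OF sb, of 0]) (simp add: H_le)
  then have 1: "AE \<omega> in L x x. eventually (\<lambda>i. \<omega> \<in> space (L x x) - H i) sequentially"
    using H_sets by (intro borel_cantelli_AE1) (auto simp: L.emeasure_eq_measure)
  have 2: "AE \<omega> in L x x. \<forall>z\<in>V. finite {n. fst \<omega> n = z \<and> snd \<omega> n = z}"
  proof (subst AE_ball_countable[OF countable_V], intro ballI)
    fix z assume z: "z \<in> V"
    let ?B = "\<lambda>n. {\<omega> \<in> space (L x x). (fst \<omega> n, snd \<omega> n) \<in> {(z, z)}}"
    have "?B n = staying x x (\<lambda>i. if i = n then {(z, z)} else UNIV) n" for n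
      by (auto simp: staying_def)
    then have "measure (L x x) (?B n) = transition n x z * transition n x z" for n
      by (simp only: measure_staying[OF x x] stay_meet)
    then have "summable (\<lambda>n. measure (L x x) (?B n))" using t[OF x z] by simp
    then have "AE \<omega> in L x x. eventually (\<lambda>n. \<omega> \<in> space (L x x) - ?B n) sequentially"
      by (intro borel_cantelli_AE1 sets_pair_position x) (auto simp: L.emeasure_eq_measure)
    then show "AE \<omega> in L x x. finite {n. fst \<omega> n = z \<and> snd \<omega> n = z}"
    proof (rule AE_mp, intro AE_I2 impI)
      fix \<omega> assume w: "\<omega> \<in> space (L x x)" "eventually (\<lambda>n. \<omega> \<in> space (L x x) - ?B n) sequentially"
      then obtain N where "\<And>n. n \<ge> N \<Longrightarrow> \<omega> \<notin> ?B n" by (auto simp: eventually_sequentially)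
      then have "{n. fst \<omega> n = z \<and> snd \<omega> n = z} \<subseteq> {..<N}" using w by (force simp: not_less[symmetric])
      then show "finite {n. fst \<omega> n = z \<and> snd \<omega> n = z}" by (rule finite_subset) simp
    qed
  qed
  from 1 2 have "AE \<omega> in L x x. \<omega> \<in> {\<omega> \<in> space (L x x). finite (collision_times \<omega>)}"
  proof eventually_elim
    case (elim \<omega>)
    then obtain N where N: "\<And>i. i \<ge> N \<Longrightarrow> \<omega> \<in> space (L x x) - H i"
      by (auto simp: eventually_sequentially)
    then have w: "\<omega> \<in> space (L x x)" by auto
    then have wV: "fst \<omega> n \<in> V" for n using space_L[OF x x] by auto
    let ?F = "(\<Union>i<N. S i) \<inter> V"
    have "collision_times \<omega> \<subseteq> (\<Union>z\<in>?F. {n. fst \<omega> n = z \<and> snd \<omega> n = z})"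
    proof
      fix n assume "n \<in> collision_times \<omega>"
      then have eq: "fst \<omega> n = snd \<omega> n" by (simp add: collision_times_def case_prod_beta)
      obtain i where i: "fst \<omega> n \<in> S i" using cover wV by blast
      have "i < N"
      proof (rule ccontr)
        assume "\<not> i < N"
        then show False using N[of i] w eq i by (auto simp: H_def)
      qed
      then show "n \<in> (\<Union>z\<in>?F. {n. fst \<omega> n = z \<and> snd \<omega> n = z})" using i eq wV[of n] by auto
    qed
    moreover have "finite (\<Union>z\<in>?F. {n. fst \<omega> n = z \<and> snd \<omega> n = z})"
      using fin elim(2) by auto
    ultimately show ?case using w by (auto intro: finite_subset)
  qed
  then show "measure (L x x) {\<omega> \<in> space (L x x). finite (collision_times \<omega>)} = 1"
    using L.prob_eq_1[OF infinite_collisions_sets(1)[OF x x]] by simp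
qed

end

section \<open>Graphs with polynomial volume and resistance growth\<close>

lemma ennreal_half_le_iff: "0 \<le> e \<Longrightarrow> x / 2 \<le> ennreal e \<longleftrightarrow> x \<le> ennreal (2 * e)" for x :: ennreal
  by (cases x) (auto simp: ennreal_divide_numeral ennreal_le_iff ennreal_top_divide top_unique)

lemma ennreal_inverse_antimono: "a \<le> b \<Longrightarrow> inverse b \<le> inverse a" for a b :: ennreal
proof (cases "a = 0 \<or> b = top")
  case False
  moreover assume "a \<le> b"
  ultimately obtain r s where "a = ennreal r" "b = ennreal s" "0 < r" "r \<le> s"
    by (cases a; cases b) (auto simp: ennreal_eq_0_iff top_unique)
  then show ?thesis by (simp add: inverse_ennreal le_imp_inverse_le)
qed auto

lemma ennreal_inverse_inverse: "inverse (inverse a) = a" for a :: ennreal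
proof (cases "a = 0 \<or> a = top")
  case False
  then obtain r where "a = ennreal r" "0 < r" by (cases a) (auto simp: ennreal_eq_0_iff)
  then show ?thesis by (simp add: inverse_ennreal)
qed auto

text \<open>Reduces an \<open>ennreal\<close> bound to real sums over finite sets of ordered edges;
  the \<open>2\<close> undoes the halving in \<open>energy\<close>.\<close>

lemma energy_le_iff:
  assumes "0 \<le> e"
  shows "energy E f \<le> ennreal e \<longleftrightarrow>
    (\<forall>F. finite F \<longrightarrow> F \<subseteq> E \<longrightarrow> (\<Sum>(x, y)\<in>F. (f x - f y)\<^sup>2) \<le> 2 * e)"
proof -
  have F: "(\<Sum>(x, y)\<in>F. ennreal ((f x - f y)\<^sup>2)) = ennreal (\<Sum>(x, y)\<in>F. (f x - f y)\<^sup>2)" for F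
    by (subst sum_ennreal[symmetric]) (auto simp: case_prod_beta)
  have "energy E f \<le> ennreal e \<longleftrightarrow> (\<Sum>\<^sub>\<infinity>(x, y)\<in>E. ennreal ((f x - f y)\<^sup>2)) \<le> ennreal (2 * e)"
    unfolding energy_def by (rule ennreal_half_le_iff[OF assms])
  also have "(\<Sum>\<^sub>\<infinity>(x, y)\<in>E. ennreal ((f x - f y)\<^sup>2)) \<le> ennreal (2 * e) \<longleftrightarrow>
      (\<forall>F. finite F \<longrightarrow> F \<subseteq> E \<longrightarrow> (\<Sum>(x, y)\<in>F. (f x - f y)\<^sup>2) \<le> 2 * e)"
    using assms by (subst nonneg_infsum_complete) (auto simp: SUP_le_iff F ennreal_le_iff)
  finally show ?thesis .
qed

lemma sym_relpow: "sym E \<Longrightarrow> (x, y) \<in> E ^^ n \<Longrightarrow> (y, x) \<in> E ^^ n"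
proof (induction n arbitrary: y)
  case (Suc n)
  then obtain z where "(x, z) \<in> E ^^ n" "(z, y) \<in> E" by auto
  then show ?case using Suc by (metis symD relpow_Suc_I2)
qed auto

lemma square_add_le: "(a + b)\<^sup>2 \<le> 2 * a\<^sup>2 + 2 * b\<^sup>2" for a b :: real
  using sum_squares_bound[of a b] by (simp add: power2_eq_square algebra_simps)

text \<open>The theorem instantiates \<kappa> with \<open>\<beta> - \<alpha>\<close>, so that
  \<open>\<alpha> + \<kappa>\<close> stands for \<beta>.\<close>

locale fractal_graph =
  fixes V :: "'a set" and E :: "'a rel" and \<alpha> \<kappa> c C :: real
  assumes simple: "simple_graph V E" and connected: "connected_graph V E"
    and infinite: "infinite V" and degree: "bounded_degree V E"
    and \<alpha>_pos: "0 < \<alpha>" and \<kappa>_pos: "0 < \<kappa>" and c_pos: "0 < c" and c_le_C: "c \<le> C"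
    and volume: "\<And>v k. v \<in> V \<Longrightarrow> 1 \<le> k \<Longrightarrow>
          c * real k powr \<alpha> \<le> real (card (graph_ball V E v k)) \<and>
          real (card (graph_ball V E v k)) \<le> C * real k powr \<alpha>"
    and resistance: "\<And>u v. u \<in> V \<Longrightarrow> v \<in> V \<Longrightarrow> u \<noteq> v \<Longrightarrow>
          ennreal (c * real (graph_dist E u v) powr \<kappa>) \<le> eff_resistance E {u} {v} \<and>
          eff_resistance E {u} {v} \<le> ennreal (C * real (graph_dist E u v) powr \<kappa>)"
begin

abbreviation "d \<equiv> graph_dist E"
abbreviation "gball v k \<equiv> graph_ball V E v k"

lemma C_pos: "0 < C" using c_pos c_le_C by simp

lemma sub_E: "E \<subseteq> V \<times> V" and sym_E: "sym E" and irrefl_E: "irrefl E"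
  using simple by (auto simp: simple_graph_def)

lemma V_nonempty: "V \<noteq> {}"
  using connected by (simp add: connected_graph_def)

sublocale lf_graph V E
proof
  show "E \<subseteq> V \<times> V" "sym E" by (rule sub_E sym_E)+
next
  fix v assume v: "v \<in> V"
  show "finite (neighbours E v)" using degree v by (auto simp: bounded_degree_def)
  obtain w where w: "w \<in> V" "w \<noteq> v" using infinite by (metis finite.simps insertCI subsetI finite_subset)
  then have "(v, w) \<in> E\<^sup>*" using connected v by (auto simp: connected_graph_def)
  then show "neighbours E v \<noteq> {}" using w by (auto elim: converse_rtranclE)
qed

lemma path_dist: "u \<in> V \<Longrightarrow> v \<in> V \<Longrightarrow> (u, v) \<in> E ^^ (d u v)"
  unfolding graph_dist_def
  by (rule LeastI_ex) (use connected in \<open>auto simp: connected_graph_def dest: rtrancl_imp_relpow\<close>)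

lemma dist_le: "(u, v) \<in> E ^^ n \<Longrightarrow> d u v \<le> n"
  unfolding graph_dist_def by (rule Least_le)

lemma dist_self [simp]: "d u u = 0"
  using dist_le[of u u 0] by simp

lemma dist_eq_0: "u \<in> V \<Longrightarrow> v \<in> V \<Longrightarrow> d u v = 0 \<longleftrightarrow> u = v"
  using path_dist[of u v] by auto

lemma dist_commute: "u \<in> V \<Longrightarrow> v \<in> V \<Longrightarrow> d u v = d v u"
  by (rule antisym; rule dist_le; rule sym_relpow[OF sym_E]; rule path_dist)

lemma dist_triangle: "u \<in> V \<Longrightarrow> v \<in> V \<Longrightarrow> w \<in> V \<Longrightarrow> d u w \<le> d u v + d v w"
  by (intro dist_le) (auto simp: relpow_add intro: path_dist)

lemma dist_edge: "v \<in> V \<Longrightarrow> (x, y) \<in> E \<Longrightarrow> d y v \<le> d x v + 1"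
proof -
  assume v: "v \<in> V" and e: "(x, y) \<in> E"
  then have "x \<in> V" "y \<in> V" using sub_E by auto
  moreover have "d y x \<le> 1" using dist_le[of y x 1] symD[OF sym_E e] by simp
  ultimately show ?thesis using dist_triangle[of y x v] v by simp
qed

lemma ball_subset: "gball v k \<subseteq> V"
  by (auto simp: graph_ball_def)

lemma ball_mono: "k \<le> k' \<Longrightarrow> gball v k \<subseteq> gball v k'"
  by (auto simp: graph_ball_def)

text \<open>The lower volume bound is positive, whereas \<open>card\<close> of an infinite set is
  \<open>0\<close>.\<close>

lemma finite_ball: "v \<in> V \<Longrightarrow> finite (gball v k)"
proof -
  assume v: "v \<in> V"
  have "0 < c * real (Suc k) powr \<alpha>" using c_pos by simp
  also have "\<dots> \<le> real (card (gball v (Suc k)))" using volume[OF v, of "Suc k"] by simp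
  finally have "finite (gball v (Suc k))" by (intro card_ge_0_finite) simp
  then show ?thesis by (rule finite_subset[rotated]) (rule ball_mono, simp)
qed

lemma countable_V: "countable V"
proof -
  obtain v where v: "v \<in> V" using V_nonempty by auto
  have "V \<subseteq> (\<Union>k. gball v k)" by (auto simp: graph_ball_def)
  moreover have "countable (\<Union>k. gball v k)"
    using finite_ball[OF v] by (intro countable_UN) (auto intro: countable_finite)
  ultimately show ?thesis by (rule countable_subset)
qed

lemma annulus:
  "\<exists>M\<ge>1. \<forall>v\<in>V. \<forall>k\<ge>1. real k powr \<alpha> \<le> real (card (gball v (M * k) - gball v k))"
proof -
  \<comment> \<open>\<open>M\<close> makes \<open>c * M powr \<alpha>\<close> at least
    \<open>C + 1\<close>, so the large ball exceeds the upper bound for the small one by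
    \<open>k powr \<alpha>\<close>.\<close>
  define M where "M = nat \<lceil>((C + 1) / c) powr (1 / \<alpha>)\<rceil> + 1"
  have "((C + 1) / c) powr (1 / \<alpha>) \<le> real M" unfolding M_def by linarith
  then have "(((C + 1) / c) powr (1 / \<alpha>)) powr \<alpha> \<le> real M powr \<alpha>"
    using \<alpha>_pos by (intro powr_mono2) auto
  then have "(C + 1) / c \<le> real M powr \<alpha>"
    using \<alpha>_pos c_pos C_pos by (simp add: powr_powr)
  then have M: "C + 1 \<le> c * real M powr \<alpha>" using c_pos by (simp add: field_simps)
  have "real k powr \<alpha> \<le> real (card (gball v (M * k) - gball v k))" if v: "v \<in> V" and k: "1 \<le> k" for v k
  proof -
    have "(C + 1) * real k powr \<alpha> \<le> c * real M powr \<alpha> * real k powr \<alpha>"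
      using M by (intro mult_right_mono) auto
    also have "\<dots> = c * real (M * k) powr \<alpha>" by (simp add: powr_mult)
    also have "\<dots> \<le> real (card (gball v (M * k)))"
      using volume[OF v, of "M * k"] k by (simp add: M_def)
    finally have "(C + 1) * real k powr \<alpha> \<le> real (card (gball v (M * k)))" .
    moreover have "real (card (gball v k)) \<le> C * real k powr \<alpha>" using volume[OF v k] by simp
    moreover have "card (gball v (M * k) - gball v k) = card (gball v (M * k)) - card (gball v k)"
      by (intro card_Diff_subset finite_ball v ball_mono) (simp add: M_def)
    moreover have "card (gball v k) \<le> card (gball v (M * k))"
      by (intro card_mono finite_ball v ball_mono) (simp add: M_def)
    ultimately show ?thesis by (simp add: algebra_simps)
  qed
  then show ?thesis by (intro exI[of _ M]) (auto simp: M_def)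
qed

text \<open>Rescaled to the values \<open>1\<close> at \<open>u\<close> and \<open>0\<close> at
  \<open>v\<close>, \<open>f\<close> competes in the variational problem that defines the
  resistance.\<close>

lemma oscillation:
  assumes u: "u \<in> V" and v: "v \<in> V" and e: "0 \<le> e" "energy E f \<le> ennreal e"
  shows "(f u - f v)\<^sup>2 \<le> C * real (d u v) powr \<kappa> * e"
proof (cases "f u = f v")
  case True
  then show ?thesis using C_pos e by simp
next
  case False
  define a where "a = f u - f v"
  define g where "g x = (f x - f v) / a" for x
  have a: "a \<noteq> 0" "u \<noteq> v" using False by (auto simp: a_def)
  have "energy E g \<le> ennreal (e / a\<^sup>2)"
  proof (subst energy_le_iff; (intro allI impI)?)
    fix F assume F: "finite F" "F \<subseteq> E"
    have "(\<Sum>(x, y)\<in>F. (g x - g y)\<^sup>2) = (\<Sum>(x, y)\<in>F. (f x - f y)\<^sup>2) / a\<^sup>2"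
      by (simp add: g_def diff_divide_distrib[symmetric] power_divide sum_divide_distrib case_prod_beta)
    also have "\<dots> \<le> 2 * e / a\<^sup>2"
      using e F by (intro divide_right_mono) (auto simp: energy_le_iff)
    finally show "(\<Sum>(x, y)\<in>F. (g x - g y)\<^sup>2) \<le> 2 * (e / a\<^sup>2)" by simp
  qed (use e in simp)
  moreover have "Inf {energy E f |f. (\<forall>x\<in>{u}. f x = 1) \<and> (\<forall>x\<in>{v}. f x = 0) \<and> energy E f < \<infinity>} \<le> energy E g"
  proof (rule Inf_lower)
    have "energy E g < \<infinity>" using calculation by (auto intro: le_less_trans)
    moreover have "g u = 1" "g v = 0" using a by (auto simp: g_def a_def)
    ultimately show "energy E g \<in> {energy E f |f. (\<forall>x\<in>{u}. f x = 1) \<and> (\<forall>x\<in>{v}. f x = 0) \<and> energy E f < \<infinity>}"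
      by auto
  qed
  ultimately have "inverse (ennreal (e / a\<^sup>2)) \<le> eff_resistance E {u} {v}"
    unfolding eff_resistance_def by (intro ennreal_inverse_antimono) (rule order_trans)
  also have "\<dots> \<le> ennreal (C * real (d u v) powr \<kappa>)" using resistance[OF u v a(2)] by simp
  finally have *: "inverse (ennreal (e / a\<^sup>2)) \<le> ennreal (C * real (d u v) powr \<kappa>)" .
  \<comment> \<open>Zero energy would make the left side infinite.\<close>
  then have "e \<noteq> 0" by (auto simp: top_unique)
  with e have "0 < e" by simp
  then have "a\<^sup>2 / e \<le> C * real (d u v) powr \<kappa>"
    using * a C_pos by (simp add: inverse_ennreal ennreal_le_iff)
  then show ?thesis using \<open>0 < e\<close> by (simp add: a_def field_simps)
qed

text \<open>The infimum may fail to be attained; the factor \<open>2\<close> leaves room for a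
  competitor.\<close>

lemma potential:
  assumes u: "u \<in> V" and v: "v \<in> V" and uv: "u \<noteq> v"
  obtains h where "h u = 1" "h v = 0" "energy E h \<le> ennreal (2 / (c * real (d u v) powr \<kappa>))"
proof -
  define q where "q = c * real (d u v) powr \<kappa>"
  let ?S = "{energy E f |f. (\<forall>x\<in>{u}. f x = 1) \<and> (\<forall>x\<in>{v}. f x = 0) \<and> energy E f < \<infinity>}"
  have q: "0 < q" using c_pos dist_eq_0[OF u v] uv by (simp add: q_def)
  have "ennreal q \<le> inverse (Inf ?S)"
    using resistance[OF u v uv] by (simp add: eff_resistance_def q_def)
  then have "inverse (inverse (Inf ?S)) \<le> inverse (ennreal q)" by (rule ennreal_inverse_antimono)
  then have "Inf ?S \<le> ennreal (1 / q)"
    using q by (simp add: inverse_ennreal inverse_eq_divide ennreal_inverse_inverse)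
  also have "\<dots> < ennreal (2 / q)" using q by (simp add: ennreal_less_iff divide_strict_right_mono)
  finally obtain f where "f u = 1" "f v = 0" "energy E f < ennreal (2 / q)"
    by (auto simp: Inf_less_iff)
  then show ?thesis using that[of f] by (simp add: q_def less_imp_le)
qed

text \<open>Take a maximal separated subset: any uncovered point could be added to it.\<close>

lemma separated_net:
  assumes "finite S" "S \<subseteq> V"
  obtains Y where "Y \<subseteq> S" "\<And>y y'. y \<in> Y \<Longrightarrow> y' \<in> Y \<Longrightarrow> y \<noteq> y' \<Longrightarrow> p < d y y'"
    "\<And>x. x \<in> S \<Longrightarrow> \<exists>y\<in>Y. d x y \<le> p"
proof -
  let ?A = "{Y. Y \<subseteq> S \<and> (\<forall>y\<in>Y. \<forall>y'\<in>Y. y \<noteq> y' \<longrightarrow> p < d y y')}"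
  have "finite ?A" using assms by (intro finite_subset[of ?A "Pow S"]) auto
  moreover have "{} \<in> ?A" by simp
  ultimately obtain Y where Y: "Y \<in> ?A" "\<And>Z. Z \<in> ?A \<Longrightarrow> Y \<subseteq> Z \<Longrightarrow> Y = Z"
    using finite_has_maximal[of ?A] by (metis (no_types, lifting) empty_iff)
  have "\<exists>y\<in>Y. d x y \<le> p" if x: "x \<in> S" for x
  proof (rule ccontr)
    assume "\<not> ?thesis"
    then have far: "\<forall>y\<in>Y. p < d x y" by auto
    have "\<forall>y\<in>Y. p < d y x"
    proof
      fix y assume y: "y \<in> Y"
      then have "d y x = d x y" using Y(1) x assms(2) by (intro dist_commute) auto
      then show "p < d y x" using far y by simp
    qed
    with far have "insert x Y \<in> ?A" using Y(1) x by auto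
    then have "x \<in> Y" using Y(2)[of "insert x Y"] by auto
    then show False using far by auto
  qed
  then show ?thesis using that[of Y] Y(1) by blast
qed

text \<open>Packing: the balls of radius \<open>p\<close> about the points of \<open>Y\<close> are
  disjoint and lie in the ball of radius \<open>2 * r\<close>.\<close>

lemma separated_card:
  assumes v: "v \<in> V" and Y: "Y \<subseteq> gball v r" and p: "1 \<le> p" "p \<le> r"
    and sep: "\<And>y y'. y \<in> Y \<Longrightarrow> y' \<in> Y \<Longrightarrow> y \<noteq> y' \<Longrightarrow> 2 * p < d y y'"
  shows "real (card Y) * (c * real p powr \<alpha>) \<le> C * (2 * real r) powr \<alpha>"
proof -
  have YV: "Y \<subseteq> V" using Y ball_subset by blast
  have finY: "finite Y" using Y finite_ball[OF v] by (rule finite_subset)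
  have "real (card Y) * (c * real p powr \<alpha>) = (\<Sum>y\<in>Y. c * real p powr \<alpha>)" by simp
  also have "\<dots> \<le> (\<Sum>y\<in>Y. real (card (gball y p)))"
    using volume p YV by (intro sum_mono) auto
  also have "\<dots> = real (card (\<Union>y\<in>Y. gball y p))"
  proof -
    have "gball y p \<inter> gball y' p = {}" if "y \<in> Y" "y' \<in> Y" "y \<noteq> y'" for y y'
    proof (rule ccontr)
      assume "gball y p \<inter> gball y' p \<noteq> {}"
      then obtain z where "z \<in> V" "d z y \<le> p" "d z y' \<le> p" by (auto simp: graph_ball_def)
      then show False using sep[OF that] dist_triangle[of y z y'] dist_commute[of y z] that YV by auto
    qed
    then show ?thesis
      using finY YV finite_ball by (subst card_UN_disjoint) auto
  qed
  also have "\<dots> \<le> real (card (gball v (2 * r)))"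
  proof -
    have "(\<Union>y\<in>Y. gball y p) \<subseteq> gball v (2 * r)"
    proof (rule UN_least, rule subsetI)
      fix y z assume "y \<in> Y" "z \<in> gball y p"
      then show "z \<in> gball v (2 * r)"
        using dist_triangle[of z y v] v Y p by (force simp: graph_ball_def)
    qed
    then show ?thesis using finite_ball[OF v] by (simp add: card_mono)
  qed
  also have "\<dots> \<le> C * (2 * real r) powr \<alpha>" using volume[OF v, of "2 * r"] p by simp
  finally show ?thesis .
qed

text \<open>A lower bound of order \<open>r powr \<kappa>\<close> for the resistance from \<open>v\<close> to the complement of
  \<open>gball v r\<close>. The sphere is covered by boundedly many balls of radius \<open>\<epsilon> * r\<close>; a potential with
  \<open>h v = 0\<close> and value \<open>1\<close> at the centre of such a gball stays above \<open>1/2\<close> on it.\<close>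

lemma cutoff:
  "\<exists>K>0. \<exists>r\<^sub>0. \<forall>v\<in>V. \<forall>r\<ge>r\<^sub>0. \<exists>F. F v = (1 :: real) \<and> (\<forall>x. x \<notin> gball v r \<longrightarrow> F x = 0) \<and>
     energy E F \<le> ennreal (K / real r powr \<kappa>)"
proof -
  \<comment> \<open>Chosen so that a potential of energy at most \<open>q\<close>, defined below,
    changes by at most \<open>1 / 2\<close> over distance \<open>2 * \<epsilon> * r\<close>.\<close>
  define \<epsilon> where "\<epsilon> = (c / (8 * C)) powr (1 / \<kappa>) / 2"
  have \<epsilon>0: "0 < \<epsilon>" using c_pos C_pos by (simp add: \<epsilon>_def)
  have "(c / (8 * C)) powr (1 / \<kappa>) \<le> 1"
    using c_pos c_le_C \<kappa>_pos C_pos by (intro powr_le1) (auto simp: divide_simps)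
  then have \<epsilon>1: "\<epsilon> \<le> 1" by (simp add: \<epsilon>_def)
  have \<epsilon>\<kappa>: "(2 * \<epsilon>) powr \<kappa> = c / (8 * C)"
    using c_pos C_pos \<kappa>_pos by (simp add: \<epsilon>_def powr_powr)
  \<comment> \<open>\<open>N\<close> is the packing bound for the number of balls covering the
    sphere. One factor \<open>N\<close> of \<open>K\<close> comes from Cauchy-Schwarz, the other
    from the number of potentials.\<close>
  define N where "N = C / c * (4 / \<epsilon>) powr \<alpha>"
  define K where "K = 8 * N\<^sup>2 / c"
  have N0: "0 < N" using c_pos C_pos \<epsilon>0 by (simp add: N_def)
  define r\<^sub>0 where "r\<^sub>0 = nat \<lceil>1 / \<epsilon>\<rceil>"
  have "\<exists>F. F v = (1 :: real) \<and> (\<forall>x. x \<notin> gball v r \<longrightarrow> F x = 0) \<and> energy E F \<le> ennreal (K / real r powr \<kappa>)"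
    if v: "v \<in> V" and r: "r \<ge> r\<^sub>0" for v r
  proof -
    have "1 / \<epsilon> \<le> real r" using r unfolding r\<^sub>0_def by linarith
    then have \<epsilon>r: "1 \<le> \<epsilon> * real r" using \<epsilon>0 by (simp add: field_simps)
    define p where "p = nat \<lfloor>\<epsilon> * real r\<rfloor>"
    have p: "1 \<le> p" "real p \<le> \<epsilon> * real r" "\<epsilon> * real r / 2 \<le> real p"
    proof -
      have "real p = of_int \<lfloor>\<epsilon> * real r\<rfloor>" "1 \<le> \<lfloor>\<epsilon> * real r\<rfloor>" using \<epsilon>r by (simp_all add: p_def)
      then show "1 \<le> p" "real p \<le> \<epsilon> * real r" "\<epsilon> * real r / 2 \<le> real p" by linarith+
    qed
    have "\<epsilon> * real r \<le> real r" using \<epsilon>1 by (simp add: mult_left_le_one_le \<epsilon>0 less_imp_le)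
    then have pr: "p \<le> r" using p by linarith
    have r1: "1 \<le> r" using p pr by simp
    define S where "S = {x \<in> V. d x v = r}"
    have S: "finite S" "S \<subseteq> V" "S \<subseteq> gball v r"
      using finite_ball[OF v, of r] by (auto simp: S_def graph_ball_def elim: rev_finite_subset)
    obtain Y where YS: "Y \<subseteq> S" and sep: "\<And>y y'. y \<in> Y \<Longrightarrow> y' \<in> Y \<Longrightarrow> y \<noteq> y' \<Longrightarrow> 2 * p < d y y'"
      and net: "\<And>x. x \<in> S \<Longrightarrow> \<exists>y\<in>Y. d x y \<le> 2 * p"
      using separated_net[OF S(1,2)] by blast
    have finY: "finite Y" using YS S by (meson finite_subset)
    have YN: "real (card Y) \<le> N"
    proof -
      have "real (card Y) * (c * real p powr \<alpha>) \<le> C * (2 * real r) powr \<alpha>"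
        using separated_card[OF v _ p(1) pr sep] YS S by blast
      also have "\<dots> \<le> C * (4 / \<epsilon> * real p) powr \<alpha>"
        using p \<epsilon>0 C_pos \<alpha>_pos by (intro mult_left_mono powr_mono2) (auto simp: field_simps)
      also have "\<dots> = N * (c * real p powr \<alpha>)"
        using \<epsilon>0 c_pos powr_mult[of "4 / \<epsilon>" "real p" \<alpha>] by (simp add: N_def)
      finally show ?thesis using p c_pos by (simp add: mult_le_cancel_right)
    qed
    define q where "q = 2 / (c * real r powr \<kappa>)"
    have q0: "0 < q" using c_pos r1 by (simp add: q_def)
    have "\<forall>y\<in>Y. \<exists>h. h y = (1 :: real) \<and> h v = 0 \<and> energy E h \<le> ennreal q"
    proof
      fix y assume "y \<in> Y"
      then have y: "y \<in> V" "d y v = r" using YS by (auto simp: S_def)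
      then have "y \<noteq> v" using r1 by auto
      then show "\<exists>h. h y = (1 :: real) \<and> h v = 0 \<and> energy E h \<le> ennreal q"
        using potential[OF y(1) v] y(2) unfolding q_def by metis
    qed
    then obtain h where h: "\<And>y. y \<in> Y \<Longrightarrow> h y y = (1 :: real)" "\<And>y. y \<in> Y \<Longrightarrow> h y v = 0"
      "\<And>y. y \<in> Y \<Longrightarrow> energy E (h y) \<le> ennreal q"
      by metis
    have near: "1 / 2 \<le> \<bar>h y x\<bar>" if y: "y \<in> Y" and x: "x \<in> V" "d x y \<le> 2 * p" for x y
    proof -
      have yV: "y \<in> V" using y YS S by auto
      have "(h y x - h y y)\<^sup>2 \<le> C * real (d x y) powr \<kappa> * q"
        using oscillation[OF x(1) yV _ h(3)[OF y]] q0 by simp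
      also have "\<dots> \<le> C * (2 * \<epsilon> * real r) powr \<kappa> * q"
        using x p C_pos q0 \<kappa>_pos by (intro mult_right_mono mult_left_mono powr_mono2) auto
      also have "\<dots> = C * (c / (8 * C)) * real r powr \<kappa> * q"
        using \<epsilon>0 by (simp add: powr_mult \<epsilon>\<kappa>[symmetric] mult.assoc)
      also have "\<dots> = (1 / 2)\<^sup>2"
        using c_pos C_pos r1 by (simp add: q_def power2_eq_square)
      finally have "\<bar>h y x - 1\<bar> \<le> 1 / 2" using h(1)[OF y] by (simp add: abs_le_square_iff[symmetric])
      then show ?thesis by linarith
    qed
    define s where "s x = (\<Sum>y\<in>Y. \<bar>h y x\<bar>)" for x
    \<comment> \<open>On the sphere \<open>s\<close> is at least \<open>1 / 2\<close>, so
      \<open>F\<close> vanishes there and the extension by zero creates no jump. At \<open>v\<close>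
      all potentials vanish, whence \<open>F v = 1\<close>.\<close>
    define F where "F x = (if x \<in> gball v r then max 0 (1 - 2 * s x) else 0)" for x
    have sphere: "F x = 0" if xS: "x \<in> S" for x
    proof -
      obtain y where y: "y \<in> Y" "d x y \<le> 2 * p" using net[OF xS] by auto
      have "1 / 2 \<le> \<bar>h y x\<bar>" using near y xS S by auto
      also have "\<dots> \<le> s x" unfolding s_def using finY y by (intro member_le_sum) auto
      finally show ?thesis by (simp add: F_def)
    qed
    have lip: "\<bar>F x - F x'\<bar> \<le> 2 * (\<Sum>y\<in>Y. \<bar>h y x - h y x'\<bar>)" if e: "(x, x') \<in> E" for x x'
    proof -
      let ?R = "2 * (\<Sum>y\<in>Y. \<bar>h y x - h y x'\<bar>)"
      have R0: "0 \<le> ?R" by (intro mult_nonneg_nonneg sum_nonneg) auto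
      have xV: "x \<in> V" "x' \<in> V" using e sub_E by auto
      have dd: "d x' v \<le> d x v + 1" "d x v \<le> d x' v + 1"
        using dist_edge[OF v e] dist_edge[OF v symD[OF sym_E e]] by auto
      consider "x \<in> gball v r" "x' \<in> gball v r" | "x \<notin> gball v r" "x' \<notin> gball v r"
        | "x \<in> S" "x' \<notin> gball v r" | "x \<notin> gball v r" "x' \<in> S"
        using xV dd by (auto simp: graph_ball_def S_def) linarith+
      then show ?thesis
      proof cases
        case 1
        have "\<bar>s x - s x'\<bar> \<le> (\<Sum>y\<in>Y. \<bar>h y x - h y x'\<bar>)"
          unfolding s_def sum_subtractf[symmetric]
          by (rule order_trans[OF sum_abs]) (intro sum_mono, linarith)
        then show ?thesis using 1 by (simp add: F_def)
      next
        case 2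
        then have "F x = 0" "F x' = 0" by (auto simp: F_def)
        then show ?thesis using R0 by simp
      next
        case 3
        then have "F x = 0" "F x' = 0" using sphere by (auto simp: F_def)
        then show ?thesis using R0 by simp
      next
        case 4
        then have "F x = 0" "F x' = 0" using sphere by (auto simp: F_def)
        then show ?thesis using R0 by simp
      qed
    qed
    have "energy E F \<le> ennreal (K / real r powr \<kappa>)"
    proof (subst energy_le_iff; (intro allI impI)?)
      show "0 \<le> K / real r powr \<kappa>" using c_pos by (simp add: K_def)
      fix A assume A: "finite A" "A \<subseteq> E"
      have "(\<Sum>(x, x')\<in>A. (F x - F x')\<^sup>2) \<le> (\<Sum>(x, x')\<in>A. 4 * N * (\<Sum>y\<in>Y. (h y x - h y x')\<^sup>2))"
      proof (intro sum_mono, clarify)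
        fix x x' assume "(x, x') \<in> A"
        then have "\<bar>F x - F x'\<bar>\<^sup>2 \<le> (2 * (\<Sum>y\<in>Y. \<bar>h y x - h y x'\<bar>))\<^sup>2"
          using A lip by (intro power_mono) auto
        also have "\<dots> = 4 * (\<Sum>y\<in>Y. \<bar>h y x - h y x'\<bar>)\<^sup>2" by (simp add: power_mult_distrib)
        also have "\<dots> \<le> 4 * ((\<Sum>y\<in>Y. \<bar>h y x - h y x'\<bar>\<^sup>2) * card Y)"
          by (intro mult_left_mono sum_squared_le_sum_of_squares) auto
        also have "\<dots> \<le> 4 * ((\<Sum>y\<in>Y. \<bar>h y x - h y x'\<bar>\<^sup>2) * N)"
          using YN by (intro mult_left_mono) (auto intro!: sum_nonneg)
        finally show "(F x - F x')\<^sup>2 \<le> 4 * N * (\<Sum>y\<in>Y. (h y x - h y x')\<^sup>2)"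
          by (simp add: mult_ac)
      qed
      also have "\<dots> = 4 * N * (\<Sum>y\<in>Y. \<Sum>(x, x')\<in>A. (h y x - h y x')\<^sup>2)"
        by (subst sum.swap) (simp add: sum_distrib_left case_prod_beta)
      also have "\<dots> \<le> 4 * N * (\<Sum>y\<in>Y. 2 * q)"
        using h(3) A q0 N0 by (intro mult_left_mono sum_mono) (auto simp: energy_le_iff)
      also have "\<dots> \<le> 4 * N * (N * (2 * q))"
        using YN N0 q0 by (simp add: mult_left_mono mult_right_mono)
      also have "\<dots> = 2 * (K / real r powr \<kappa>)"
        by (simp add: K_def q_def power2_eq_square)
      finally show "(\<Sum>(x, x')\<in>A. (F x - F x')\<^sup>2) \<le> 2 * (K / real r powr \<kappa>)" .
    qed
    moreover have "s v = 0" using h(2) by (simp add: s_def)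
    then have "F v = 1" using v by (simp add: F_def graph_ball_def)
    moreover have "\<forall>x. x \<notin> gball v r \<longrightarrow> F x = 0" by (simp add: F_def)
    ultimately show ?thesis by blast
  qed
  moreover have "0 < K" using N0 c_pos by (simp add: K_def)
  ultimately show ?thesis by blast
qed

end

lemma energy_leD:
  "energy E f \<le> ennreal e \<Longrightarrow> 0 \<le> e \<Longrightarrow> finite F \<Longrightarrow> F \<subseteq> E \<Longrightarrow> (\<Sum>(x, y)\<in>F. (f x - f y)\<^sup>2) \<le> 2 * e"
  by (simp add: energy_le_iff)

section \<open>Combs over fractal graphs\<close>

locale comb_graph = fractal_graph V E \<alpha> \<kappa> c C
  for V :: "'a set" and E :: "'a rel" and \<alpha> \<kappa> c C :: real +
  fixes rt :: 'a and \<gamma> :: real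
  assumes root: "rt \<in> V" and \<gamma>_pos: "0 < \<gamma>"
begin

definition height :: "'a \<Rightarrow> nat" where
  "height v = nat \<lfloor>real (d rt v) powr \<gamma>\<rfloor>"

abbreviation "VG \<equiv> comb_verts V (power_profile E rt \<gamma>)"
abbreviation "EG \<equiv> comb_edges V E (power_profile E rt \<gamma>)"

lemma VG_iff: "(v, n) \<in> VG \<longleftrightarrow> v \<in> V \<and> n \<le> height v"
  by (auto simp: comb_verts_def power_profile_def height_def)

lemma EG_iff: "((u, m), (v, n)) \<in> EG \<longleftrightarrow>
    (u, v) \<in> E \<and> m = 0 \<and> n = 0 \<or> u = v \<and> u \<in> V \<and> m \<le> height u \<and> n \<le> height u \<and> (m = Suc n \<or> n = Suc m)"
  by (auto simp: comb_edges_def VG_iff)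

lemma height_le: "real (height v) \<le> real (d rt v) powr \<gamma>"
  unfolding height_def by (simp add: of_nat_nat)

lemma le_height: "real n \<le> real (d rt v) powr \<gamma> \<Longrightarrow> n \<le> height v"
  unfolding height_def by (simp add: le_nat_floor)

lemma neighbours_EG: "neighbours EG (v, n) \<subseteq> (\<lambda>u. (u, 0)) ` neighbours E v \<union> {(v, Suc n), (v, n - 1)}"
  by (auto simp: EG_iff)

sublocale G: countable_lf_graph VG EG
proof
  show "EG \<subseteq> VG \<times> VG"
  proof
    fix e assume "e \<in> EG"
    moreover obtain u m v n where "e = ((u, m), (v, n))" by (metis surj_pair)
    ultimately show "e \<in> VG \<times> VG" using edges by (auto simp: EG_iff VG_iff)
  qed
  show "sym EG"
    using sym_E by (auto simp: sym_def EG_iff)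
next
  fix x assume x: "x \<in> VG"
  obtain v n where vn: "x = (v, n)" by (cases x)
  show "finite (neighbours EG x)"
    unfolding vn using neighbours_EG by (rule finite_subset) simp
  show "neighbours EG x \<noteq> {}"
  proof (cases n)
    case 0
    obtain w where "(v, w) \<in> E" using no_isolated[of v] x vn by (auto simp: VG_iff)
    then have "(w, 0) \<in> neighbours EG x" using vn 0 by (auto simp: EG_iff)
    then show ?thesis by blast
  next
    case (Suc m)
    then have "(v, m) \<in> neighbours EG x" using x vn by (auto simp: EG_iff VG_iff)
    then show ?thesis by blast
  qed
next
  have "VG \<subseteq> V \<times> UNIV" by (auto simp: VG_iff)
  then show "countable VG" using countable_V by (rule countable_subset[OF _ countable_SIGMA]) auto
qed

lemma degree_bound: "\<exists>D\<ge>1. \<forall>x. G.deg x \<le> D"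
proof -
  obtain D where D: "\<And>v. v \<in> V \<Longrightarrow> card (neighbours E v) \<le> D"
    using degree unfolding bounded_degree_def by auto
  have "G.deg x \<le> real (D + 2)" for x
  proof -
    obtain v n where vn: "x = (v, n)" by (cases x)
    have "card (neighbours EG x) \<le> card ((\<lambda>u. (u, 0 :: nat)) ` neighbours E v \<union> {(v, Suc n), (v, n - 1)})"
      unfolding vn using neighbours_EG by (rule card_mono[rotated]) simp
    also have "\<dots> \<le> card ((\<lambda>u. (u, 0 :: nat)) ` neighbours E v) + card {(v, Suc n), (v, n - 1)}"
      by (rule card_Un_le)
    also have "\<dots> \<le> D + 2"
    proof (rule add_mono)
      have "neighbours E v = {}" if "v \<notin> V" using that edges by auto
      then have "card (neighbours E v) \<le> D" using D[of v] by (cases "v \<in> V") auto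
      then show "card ((\<lambda>u. (u, 0 :: nat)) ` neighbours E v) \<le> D"
        using card_image_le[OF finite_neighbours, of "\<lambda>u. (u, 0 :: nat)" v] by (rule order_trans[rotated])
      show "card {(v, Suc n), (v, n - 1)} \<le> 2" by (simp add: card_insert_if)
    qed
    finally show ?thesis by (simp add: G.deg_def)
  qed
  then show ?thesis by (intro exI[of _ "real (D + 2)"]) auto
qed

section \<open>Energy on the base and on the teeth\<close>

definition tooth :: "('a \<times> nat \<Rightarrow> real) \<Rightarrow> 'a \<Rightarrow> real" where
  "tooth f v = (\<Sum>l<height v. (f (v, Suc l) - f (v, l))\<^sup>2)"

lemma tooth_nonneg: "0 \<le> tooth f v"
  unfolding tooth_def by (intro sum_nonneg) auto

text \<open>Cauchy-Schwarz along a segment: its resistance is its length.\<close>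

lemma tooth_oscillation:
  assumes "j \<le> height v" "l \<le> height v"
  shows "(f (v, j) - f (v, l))\<^sup>2 \<le> \<bar>real j - real l\<bar> * tooth f v"
proof -
  have *: "(f (v, j) - f (v, l))\<^sup>2 \<le> (real j - real l) * tooth f v" if "l \<le> j" "j \<le> height v" for j l
  proof -
    have "f (v, j) - f (v, l) = (\<Sum>i\<in>{l..<j}. f (v, Suc i) - f (v, i))"
      using sum_Suc_diff'[of l j "\<lambda>i. f (v, i)"] that by simp
    then have "(f (v, j) - f (v, l))\<^sup>2 \<le> (\<Sum>i\<in>{l..<j}. (f (v, Suc i) - f (v, i))\<^sup>2) * card {l..<j}"
      using sum_squared_le_sum_of_squares[of "\<lambda>i. f (v, Suc i) - f (v, i)" "{l..<j}"] by simp
    also have "\<dots> \<le> tooth f v * card {l..<j}"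
      unfolding tooth_def using that by (intro mult_right_mono sum_mono2) auto
    finally show ?thesis using that by (simp add: of_nat_diff mult.commute)
  qed
  show ?thesis
  proof (cases "l \<le> j")
    case True
    then show ?thesis using *[of l j] assms by simp
  next
    case False
    then show ?thesis using *[of j l] assms by (simp add: power2_commute)
  qed
qed

lemma energy_base:
  assumes "energy EG f \<le> ennreal e" "0 \<le> e"
  shows "energy E (\<lambda>v. f (v, 0)) \<le> ennreal e"
  unfolding energy_le_iff[OF assms(2)]
proof (intro allI impI)
  fix F assume F: "finite F" "F \<subseteq> E"
  let ?i = "\<lambda>(u, v). ((u, 0 :: nat), (v, 0 :: nat))"
  have "(\<Sum>(u, v)\<in>F. (f (u, 0) - f (v, 0))\<^sup>2) = (\<Sum>(x, y)\<in>?i ` F. (f x - f y)\<^sup>2)"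
    by (subst sum.reindex) (auto simp: inj_on_def case_prod_beta)
  also have "\<dots> \<le> 2 * e"
  proof -
    have "?i ` F \<subseteq> EG" using F by (auto simp: EG_iff)
    moreover have "finite (?i ` F)" using F by simp
    ultimately show ?thesis using energy_leD[OF assms] by blast
  qed
  finally show "(\<Sum>(u, v)\<in>F. (f (u, 0) - f (v, 0))\<^sup>2) \<le> 2 * e" .
qed

text \<open>Each tooth edge enters with both orientations, \<open>?u\<close> and \<open>?w\<close>,
  which cancels the halving in the energy.\<close>

lemma energy_teeth:
  assumes "energy EG f \<le> ennreal e" "0 \<le> e" and A: "finite A" "A \<subseteq> V"
  shows "(\<Sum>v\<in>A. tooth f v) \<le> e"
proof -
  let ?I = "Sigma A (\<lambda>v. {..<height v})"
  let ?u = "\<lambda>(v, l). ((v, Suc l), (v, l))" and ?w = "\<lambda>(v, l). ((v, l), (v, Suc l))"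
  have fin: "finite ?I" using A by auto
  have t: "(\<Sum>v\<in>A. tooth f v) = (\<Sum>(v, l)\<in>?I. (f (v, Suc l) - f (v, l))\<^sup>2)"
    unfolding tooth_def using A by (subst sum.Sigma) auto
  have "(\<Sum>(x, y)\<in>?u ` ?I \<union> ?w ` ?I. (f x - f y)\<^sup>2) =
      (\<Sum>(x, y)\<in>?u ` ?I. (f x - f y)\<^sup>2) + (\<Sum>(x, y)\<in>?w ` ?I. (f x - f y)\<^sup>2)"
    using fin by (intro sum.union_disjoint) auto
  also have "(\<Sum>(x, y)\<in>?u ` ?I. (f x - f y)\<^sup>2) = (\<Sum>v\<in>A. tooth f v)"
    unfolding t by (subst sum.reindex) (auto simp: inj_on_def case_prod_beta)
  also have "(\<Sum>(x, y)\<in>?w ` ?I. (f x - f y)\<^sup>2) = (\<Sum>v\<in>A. tooth f v)"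
  proof -
    have "inj_on ?w ?I" by (auto simp: inj_on_def)
    then have "(\<Sum>(x, y)\<in>?w ` ?I. (f x - f y)\<^sup>2) = (\<Sum>(v, l)\<in>?I. (f (v, l) - f (v, Suc l))\<^sup>2)"
      by (subst sum.reindex) (auto simp: case_prod_beta)
    also have "\<dots> = (\<Sum>(v, l)\<in>?I. (f (v, Suc l) - f (v, l))\<^sup>2)"
      by (rule sum.cong[OF refl]) (simp add: case_prod_beta, rule power2_commute)
    finally show ?thesis unfolding t .
  qed
  finally have "2 * (\<Sum>v\<in>A. tooth f v) = (\<Sum>(x, y)\<in>?u ` ?I \<union> ?w ` ?I. (f x - f y)\<^sup>2)"
    by (simp only: mult_2)
  also have "\<dots> \<le> 2 * e"
  proof -
    have "?u ` ?I \<union> ?w ` ?I \<subseteq> EG" using A by (auto simp: EG_iff)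
    then show ?thesis by (rule energy_leD[OF assms(1,2), rotated]) (use fin in simp)
  qed
  finally show ?thesis by simp
qed

lemma energy_tooth_le:
  assumes "energy EG f \<le> ennreal e" "0 \<le> e" "v \<in> V"
  shows "tooth f v \<le> e"
  using energy_teeth[OF assms(1,2), of "{v}"] assms(3) by simp

text \<open>Since \<open>f\<close> is constant along each tooth, only the base edges
  contribute.\<close>

lemma energy_lift:
  assumes F: "energy E F \<le> ennreal e" "0 \<le> e" and f: "\<And>v n. (v, n) \<in> VG \<Longrightarrow> f (v, n) = F v"
  shows "energy EG f \<le> ennreal e"
  unfolding energy_le_iff[OF assms(2)]
proof (intro allI impI)
  fix A assume A: "finite A" "A \<subseteq> EG"
  let ?A = "{((u, m), (v, n)) \<in> A. u \<noteq> v}" and ?p = "\<lambda>((u, m :: nat), (v, n :: nat)). (u, v)"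
  have VG: "x \<in> VG \<and> y \<in> VG" if "(x, y) \<in> A" for x y using that A G.edges by auto
  have "(\<Sum>(x, y)\<in>A. (f x - f y)\<^sup>2) = (\<Sum>((u, m), (v, n))\<in>?A. (F u - F v)\<^sup>2)"
  proof (rule sum.mono_neutral_cong_right)
    show "\<forall>i\<in>A - ?A. (case i of (x, y) \<Rightarrow> (f x - f y)\<^sup>2) = 0"
    proof
      fix i assume i: "i \<in> A - ?A"
      obtain u m v n where [simp]: "i = ((u, m), (v, n))" by (metis surj_pair)
      have "u = v" using i by simp
      then show "(case i of (x, y) \<Rightarrow> (f x - f y)\<^sup>2) = 0" using VG[of "(u, m)" "(v, n)"] i f by auto
    qed
  qed (use A VG f in auto)
  also have "\<dots> = (\<Sum>(u, v)\<in>?p ` ?A. (F u - F v)\<^sup>2)"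
  proof (subst sum.reindex)
    have z: "m = 0 \<and> n = 0" if "((u, m), (v, n)) \<in> ?A" for u m v n
      using that A by (auto simp: EG_iff dest!: subsetD)
    show "inj_on ?p ?A"
    proof (rule inj_onI)
      fix x y assume "x \<in> ?A" "y \<in> ?A" "?p x = ?p y"
      moreover obtain u m v n u' m' v' n' where "x = ((u, m), (v, n))" "y = ((u', m'), (v', n'))"
        by (metis surj_pair)
      ultimately show "x = y" using z[of u m v n] z[of u' m' v' n'] by simp
    qed
  qed (auto intro!: sum.cong)
  also have "\<dots> \<le> 2 * e"
  proof -
    have "finite (?p ` ?A)" using A by (auto intro: finite_subset[of _ A])
    moreover have "?p ` ?A \<subseteq> E" using A by (auto simp: EG_iff dest!: subsetD)
    ultimately show ?thesis by (rule energy_leD[OF F])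
  qed
  finally show "(\<Sum>(x, y)\<in>A. (f x - f y)\<^sup>2) \<le> 2 * e" .
qed

section \<open>Short teeth: a uniform lower bound for the probability of meeting\<close>

definition box :: "nat \<Rightarrow> ('a \<times> nat) set" where
  "box r = {(v, n) \<in> VG. v \<in> gball rt r}"

lemma killed_walk_box: "killed_walk VG EG (box r)"
proof
  have "box r \<subseteq> (SIGMA v:gball rt r. {..height v})" by (auto simp: box_def VG_iff)
  then show "finite (box r)" by (rule finite_subset) (simp add: finite_ball root)
qed (auto simp: box_def)

lemma dist_root_comm: "v \<in> V \<Longrightarrow> d rt v = d v rt"
  by (rule dist_commute[OF root])

text \<open>To leave the box, go down the tooth, of length at most \<open>r powr \<gamma>\<close>,
  then along the base to a vertex \<open>w\<close> outside the ball but within \<open>M * r\<close>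
  of the root. For \<gamma> \<le> \<kappa> both parts have resistance at most of order
  \<open>r powr \<kappa>\<close>.\<close>

lemma transient_box:
  assumes "\<gamma> \<le> \<kappa>"
  shows "\<exists>K>0. \<forall>r\<ge>1. transient_walk VG EG (box r) (K * real r powr \<kappa>)"
proof -
  obtain M where M: "M \<ge> 1" "\<And>v k. v \<in> V \<Longrightarrow> k \<ge> 1 \<Longrightarrow> real k powr \<alpha> \<le> real (card (gball v (M * k) - gball v k))"
    using annulus by blast
  define K where "K = 2 + 2 * (C * real (M + 1) powr \<kappa>)"
  have K: "0 < K" using C_pos by (simp add: K_def add_pos_nonneg)
  have "transient_walk VG EG (box r) (K * real r powr \<kappa>)" if r: "r \<ge> 1" for r
  proof -
    interpret K: killed_walk VG EG "box r" by (rule killed_walk_box)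
    show ?thesis
    proof
      show "0 \<le> K * real r powr \<kappa>" using K by simp
      fix f :: "'a \<times> nat \<Rightarrow> real" and z assume z: "z \<in> box r" and f: "K.supp f"
      define e where "e = G.dirichlet (box r) f"
      have e: "energy EG f \<le> ennreal e" "0 \<le> e"
        using K.energy_supp[OF f] by (simp_all add: e_def)
      obtain v l where vl: "z = (v, l)" by (cases z)
      have v: "v \<in> V" "l \<le> height v" "d v rt \<le> r"
        using z by (auto simp: vl box_def VG_iff graph_ball_def)
      have "0 < real r powr \<alpha>" using r by simp
      then have "gball rt (M * r) - gball rt r \<noteq> {}"
        using M(2)[OF root r] by (metis card.empty leD of_nat_0)
      then obtain w where w: "w \<in> V" "w \<notin> gball rt r" "d w rt \<le> M * r" by (auto simp: graph_ball_def)
      have "f (w, 0) = 0" using w by (intro K.suppD[OF f]) (simp add: box_def)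
      have "d v w \<le> (M + 1) * r"
        using dist_triangle[OF v(1) root w(1)] v w dist_root_comm[OF w(1)] by simp
      then have "real (d v w) \<le> real (M + 1) * real r"
        by (metis of_nat_mult of_nat_le_iff)
      then have "real (d v w) powr \<kappa> \<le> (real (M + 1) * real r) powr \<kappa>"
        using \<kappa>_pos by (intro powr_mono2) simp_all
      also have "\<dots> = real (M + 1) powr \<kappa> * real r powr \<kappa>" by (simp add: powr_mult)
      finally have "C * real (d v w) powr \<kappa> * e \<le> C * (real (M + 1) powr \<kappa> * real r powr \<kappa>) * e"
        using C_pos e by (intro mult_right_mono mult_left_mono) auto
      then have 1: "(f (v, 0) - f (w, 0))\<^sup>2 \<le> C * (real (M + 1) powr \<kappa> * real r powr \<kappa>) * e"
        using oscillation[OF v(1) w(1) e(2) energy_base[OF e]] by simp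
      have "real l \<le> real (d rt v) powr \<gamma>" using v height_le[of v] by linarith
      also have "\<dots> \<le> real r powr \<gamma>"
        using v dist_root_comm[OF v(1)] \<gamma>_pos by (intro powr_mono2) auto
      also have "\<dots> \<le> real r powr \<kappa>" using r assms by (intro powr_mono) auto
      finally have l: "real l \<le> real r powr \<kappa>" .
      have "(f (v, l) - f (v, 0))\<^sup>2 \<le> real l * tooth f v"
        using tooth_oscillation[of l v 0 f] v by simp
      also have "\<dots> \<le> real r powr \<kappa> * e"
        using l energy_tooth_le[OF e v(1)] tooth_nonneg by (intro mult_mono) auto
      finally have 2: "(f (v, l) - f (v, 0))\<^sup>2 \<le> real r powr \<kappa> * e" .
      have "(f z)\<^sup>2 = ((f (v, l) - f (v, 0)) + (f (v, 0) - f (w, 0)))\<^sup>2"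
        using \<open>f (w, 0) = 0\<close> by (simp add: vl)
      also have "\<dots> \<le> 2 * (f (v, l) - f (v, 0))\<^sup>2 + 2 * (f (v, 0) - f (w, 0))\<^sup>2"
        by (rule square_add_le)
      also have "\<dots> \<le> 2 * (real r powr \<kappa> * e) + 2 * (C * (real (M + 1) powr \<kappa> * real r powr \<kappa>) * e)"
        using 1 2 by linarith
      also have "\<dots> = K * real r powr \<kappa> * e" by (simp add: K_def algebra_simps)
      finally show "(f z)\<^sup>2 \<le> K * real r powr \<kappa> * G.dirichlet (box r) f" by (simp add: e_def)
    qed
  qed
  then show ?thesis using K by blast
qed

lemma infinite_collisions:
  assumes \<gamma>: "\<gamma> \<le> \<kappa>"
  shows "infinite_collision_property VG EG"
proof -
  obtain K1 where K1: "K1 > 0" and tw: "\<And>r. r \<ge> 1 \<Longrightarrow> transient_walk VG EG (box r) (K1 * real r powr \<kappa>)"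
    using transient_box[OF \<gamma>] by blast
  obtain K R where K: "K > 0" and cut: "\<And>v r. v \<in> V \<Longrightarrow> r \<ge> R \<Longrightarrow> \<exists>F. F v = (1 :: real) \<and>
      (\<forall>x. x \<notin> gball v r \<longrightarrow> F x = 0) \<and> energy E F \<le> ennreal (K / real r powr \<kappa>)"
    using cutoff by blast
  \<comment> \<open>Pairs that parity does not keep apart; a step of both walks preserves this
    set.\<close>
  define S where "S = {(x, y). x \<in> VG \<and> y \<in> VG \<and> (\<exists>n. (x, y) \<in> EG ^^ (2 * n))}"
  \<comment> \<open>The quotient of the lower bound \<open>r powr \<kappa> / (4 * K)\<close> for
    \<open>green2 x y\<close> and the diagonal bound \<open>K1 * (2 * r) powr \<kappa>\<close>; the
    radius cancels.\<close>
  define \<theta> where "\<theta> = 1 / (4 * K * K1 * 2 powr \<kappa>)"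
  have \<theta>: "0 < \<theta>" using K K1 by (simp add: \<theta>_def)
  have step: "(x', y') \<in> S" if xyS: "(x, y) \<in> S" and e: "(x, x') \<in> EG" "(y, y') \<in> EG" for x y x' y'
  proof -
    obtain n where n: "(x, y) \<in> EG ^^ (2 * n)" using xyS unfolding S_def by blast
    have "(x', x) \<in> EG" using e(1) G.edge_sym by blast
    then have "(x', y') \<in> EG ^^ Suc (Suc (2 * n))"
      using relpow_Suc_I2[OF _ n] e(2) by (blast intro: relpow_Suc_I)
    then have "(x', y') \<in> EG ^^ (2 * Suc n)" by simp
    then show ?thesis using e G.edges unfolding S_def by blast
  qed
  have bound: "lim (\<lambda>n. G.avoid n x y) \<le> 1 - \<theta>" if xyS: "(x, y) \<in> S" for x y
  proof -
    obtain n where n: "(x, y) \<in> EG ^^ (2 * n)" and xy: "x \<in> VG" "y \<in> VG" using xyS unfolding S_def by blast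
    obtain C' Z where C': "0 \<le> C'" and Z: "finite Z" "Z \<subseteq> VG" and
      path: "\<And>B f. killed_walk VG EG B \<Longrightarrow> Z \<subseteq> B \<Longrightarrow> (\<And>x. x \<notin> B \<Longrightarrow> f x = 0) \<Longrightarrow>
        (f x - f y)\<^sup>2 \<le> C' * (G.ip B f f - G.ip B (G.killed B f) (G.killed B f))"
      using G.even_path_comparison[OF xy(1) n] by metis
    obtain v l where vl: "x = (v, l)" by (cases x)
    have v: "v \<in> V" using xy vl by (simp add: VG_iff)
    \<comment> \<open>The radius may depend on the pair. It ensures that the ball of radius
      \<open>r\<close> about \<open>v\<close> lies in that of radius \<open>2 * r\<close> about the
      root, that the box contains \<open>Z\<close>, and that \<open>8 * K * C'\<close> is at most
      \<open>r powr \<kappa>\<close>.\<close>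
    define r where "r = R + d v rt + (\<Sum>p\<in>Z. d (fst p) rt) + nat \<lceil>(8 * K * C') powr (1 / \<kappa>)\<rceil> + 1"
    have r: "R \<le> r" "d v rt \<le> r" "1 \<le> r" by (auto simp: r_def)
    have r1: "1 \<le> 2 * r" using r by simp
    have ZB: "Z \<subseteq> box (2 * r)"
    proof
      fix p assume p: "p \<in> Z"
      have "d (fst p) rt \<le> (\<Sum>p\<in>Z. d (fst p) rt)" using p Z by (intro member_le_sum) auto
      then show "p \<in> box (2 * r)" using p Z by (cases p) (auto simp: box_def graph_ball_def VG_iff r_def)
    qed
    have "(8 * K * C') powr (1 / \<kappa>) \<le> real r" unfolding r_def by linarith
    then have "((8 * K * C') powr (1 / \<kappa>)) powr \<kappa> \<le> real r powr \<kappa>"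
      using \<kappa>_pos by (intro powr_mono2) auto
    then have rC: "8 * K * C' \<le> real r powr \<kappa>" using K C' \<kappa>_pos by (simp add: powr_powr)
    interpret T: transient_walk VG EG "box (2 * r)" "K1 * real (2 * r) powr \<kappa>" by (rule tw[OF r1])
    have xB: "x \<in> box (2 * r)" using xy r v by (auto simp: vl box_def graph_ball_def)
    obtain F where F: "F v = (1 :: real)" "\<And>x. x \<notin> gball v r \<Longrightarrow> F x = 0" "energy E F \<le> ennreal (K / real r powr \<kappa>)"
      using cut[OF v r(1)] by blast
    define f where "f p = (if p \<in> box (2 * r) then F (fst p) else 0)" for p
    have f: "T.supp f" by (rule T.suppI) (simp add: f_def)
    have "f (u, m) = F u" if "(u, m) \<in> VG" for u m
    proof (cases "(u, m) \<in> box (2 * r)")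
      case False
      have u: "u \<in> V" using that by (simp add: VG_iff)
      have "2 * r < d u rt" using False that u by (auto simp: box_def graph_ball_def)
      then have "u \<notin> gball v r" using dist_triangle[OF u v root] r by (auto simp: graph_ball_def)
      then show ?thesis using F False by (simp add: f_def)
    qed (simp add: f_def)
    then have "energy EG f \<le> ennreal (K / real r powr \<kappa>)"
      using F(3) K by (intro energy_lift) auto
    then have dir: "G.dirichlet (box (2 * r)) f \<le> K / real r powr \<kappa>"
      using T.energy_supp[OF f] K by (simp add: ennreal_le_iff)
    let ?g = "T.green2 x x"
    have "1 \<le> 2 * G.dirichlet (box (2 * r)) f * ?g"
      using T.green2_lower[OF xB f] xB F(1) by (simp add: f_def vl)
    moreover have "0 \<le> ?g" by (rule T.green2_nonneg)
    then have "2 * G.dirichlet (box (2 * r)) f * ?g \<le> 2 * (K / real r powr \<kappa>) * ?g"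
      using dir by (intro mult_right_mono) auto
    ultimately have "1 \<le> 2 * (K / real r powr \<kappa>) * ?g" by linarith
    then have g: "real r powr \<kappa> \<le> 2 * K * ?g" using r by (simp add: field_simps)
    have "4 * C' * (2 * K) \<le> ?g * (2 * K)" using g rC by (simp add: mult_ac)
    then have gC: "4 * C' \<le> ?g" using K by simp
    have "G.ip (box (2 * r)) (T.green2 x) (T.green2 x) -
        G.ip (box (2 * r)) (G.killed (box (2 * r)) (T.green2 x)) (G.killed (box (2 * r)) (T.green2 x)) = ?g"
      by (rule T.green2_reproducing[OF xB T.supp_green2])
    \<comment> \<open>The two-step form of \<open>green2 x\<close> has value \<open>?g\<close>, so
      between \<open>x\<close> and \<open>y\<close> this function varies by at most the square root
      of \<open>C' * ?g\<close>, which is at most \<open>?g / 2\<close>.\<close>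
    then have "(?g - T.green2 x y)\<^sup>2 \<le> C' * ?g"
      using path[OF T.killed_walk_axioms ZB, of "T.green2 x"] T.suppD[OF T.supp_green2] by simp
    also have "\<dots> \<le> (?g / 2)\<^sup>2"
      using mult_right_mono[OF gC \<open>0 \<le> ?g\<close>] by (simp add: power2_eq_square)
    finally have "\<bar>?g - T.green2 x y\<bar> \<le> \<bar>?g / 2\<bar>" by (subst abs_le_square_iff)
    then have "?g / 2 \<le> T.green2 x y" using \<open>0 \<le> ?g\<close> by linarith
    also have "\<dots> \<le> K1 * real (2 * r) powr \<kappa> * (1 - lim (\<lambda>n. G.avoid n x y))"
      by (rule T.green2_avoid[OF xy])
    finally have "?g / 2 \<le> K1 * (2 powr \<kappa> * real r powr \<kappa>) * (1 - lim (\<lambda>n. G.avoid n x y))"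
      by (simp add: powr_mult)
    moreover have "real r powr \<kappa> / (4 * K) \<le> ?g / 2"
      using g K by (simp add: field_simps)
    ultimately have "real r powr \<kappa> / (4 * K) \<le> K1 * (2 powr \<kappa> * real r powr \<kappa>) * (1 - lim (\<lambda>n. G.avoid n x y))"
      by linarith
    then have "real r powr \<kappa> * 1 \<le> real r powr \<kappa> * (4 * K * K1 * 2 powr \<kappa> * (1 - lim (\<lambda>n. G.avoid n x y)))"
      using K by (simp add: field_simps)
    then have "1 \<le> 4 * K * K1 * 2 powr \<kappa> * (1 - lim (\<lambda>n. G.avoid n x y))"
      by (subst (asm) mult_le_cancel_left_pos) (use r in auto)
    then show ?thesis using K K1 by (simp add: \<theta>_def field_simps)
  qed
  show ?thesis
  proof (rule G.infinite_collision_propertyI)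
    fix x k assume x: "x \<in> VG"
    have "(x, x) \<in> EG ^^ (2 * 0)" by simp
    then have xS: "(x, x) \<in> S" using x unfolding S_def by blast
    have "S \<subseteq> VG \<times> VG" by (auto simp: S_def)
    note 0 = G.avoid_tendsto_0[OF this step \<theta> bound]
    show "(\<lambda>n. G.stay (\<lambda>i. if i < k then UNIV else {(x, y). x \<noteq> y}) (k + n) x x) \<longlonglongrightarrow> 0"
      by (rule G.late_avoid_tendsto_0[OF 0 step xS])
  qed
qed

end

section \<open>On-diagonal decay of the heat kernel\<close>

locale heat_kernel = killed_walk V E B for V :: "'b set" and E :: "'b rel" and B +
  fixes x :: 'b
  assumes x_in: "x \<in> B"
begin

text \<open>Averaging over two consecutive times removes the oscillation of the kernel on bipartite
  graphs, where the energy of \<open>kern B t x\<close> itself need not be small.\<close>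

definition u :: "nat \<Rightarrow> 'b \<Rightarrow> real" where
  "u t y = kern B t x y + kern B (Suc t) x y"

definition w :: "nat \<Rightarrow> real" where
  "w t = u (2 * t) x"

lemma kern_le_u: "kern B t x y \<le> u t y"
  by (simp add: u_def kern_nonneg del: kern.simps)

lemma u_nonneg: "0 \<le> u t y"
  by (simp add: u_def kern_nonneg del: kern.simps)

lemma supp_u: "supp (u t)"
  unfolding u_def[abs_def] by (intro supp_add supp_kern)

lemma w_nonneg: "0 \<le> w t"
  by (simp add: w_def u_nonneg)

lemma ip_kern:
  "ip B (kern B t x) (kern B t x) = kern B (2 * t) x x"
  "ip B (kern B t x) (kern B (Suc t) x) = kern B (2 * t + 1) x x"
  "ip B (kern B (Suc t) x) (kern B t x) = kern B (2 * t + 1) x x"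
  using ip_kern_kern[OF x_in, of t t] ip_kern_kern[OF x_in, of t "Suc t"] ip_kern_kern[OF x_in, of "Suc t" t]
  by (simp_all del: kern.simps flip: mult_2)

text \<open>\<open>u t\<close> minus its image under the killed operator is
  \<open>kern B t x\<close> minus \<open>kern B (Suc (Suc t)) x\<close>, and pairing with
  \<open>u t\<close> gives the decrement of \<open>w\<close>. Thus energies summed over time
  telescope.\<close>

lemma dirichlet_u: "dirichlet B (u t) = w t - w (Suc t)"
proof -
  have k: "killed B (u t) = (\<lambda>y. kern B (Suc t) x y + kern B (Suc (Suc t)) x y)"
  proof -
    have "killed B (\<lambda>y. f y + g y) = (\<lambda>y. killed B f y + killed B g y)" for f g
      by (auto simp: killed_def avg_add)
    then show ?thesis unfolding u_def[abs_def] kern_Suc_fun[OF BV] .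
  qed
  have "ip B (kern B t x) (kern B (Suc (Suc t)) x) = kern B (2 * Suc t) x x"
    using ip_kern_kern[OF x_in, of t "Suc (Suc t)"] by (simp del: kern.simps flip: mult_2)
  then show ?thesis
    unfolding dirichlet_def k
    by (simp add: u_def[abs_def] w_def ip_add ip_add_right ip_kern del: kern.simps)
qed

lemma w_decseq: "w (Suc t) \<le> w t"
  using energy_supp(2)[OF supp_u, of t] by (simp add: dirichlet_u)

lemma w_antimono: "s \<le> t \<Longrightarrow> w t \<le> w s"
  by (rule lift_Suc_antimono_le[of w]) (rule w_decseq)

lemma w_le_2: "w t \<le> 2"
proof -
  have "1 / deg x \<le> 1" using deg_ge_1[of x] x_in BV by (auto simp: divide_le_eq_1)
  then have "kern B 0 x x \<le> 1" by simp
  moreover have "kern B 1 x x \<le> kern B 0 x x" using kern_diag_odd[OF x_in, of 0] by simp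
  ultimately have "w 0 \<le> 2" by (simp add: w_def u_def del: kern.simps)
  then show ?thesis using w_antimono[of 0 t] by simp
qed

lemma sum_B_le_ip:
  assumes "\<And>y. y \<in> B \<Longrightarrow> 0 \<le> f y * g y"
  shows "(\<Sum>y\<in>B. f y * g y) \<le> ip B f g"
  unfolding ip_def
proof (rule sum_mono)
  fix y assume y: "y \<in> B"
  then have "1 \<le> deg y" using deg_ge_1 BV by auto
  then show "f y * g y \<le> deg y * f y * g y"
    using mult_right_mono[of 1 "deg y" "f y * g y"] assms[OF y] by (simp add: mult.assoc)
qed

lemma sum_u:
  assumes "finite A"
  shows "(\<Sum>y\<in>A. u t y) \<le> 2"
proof -
  have "(\<Sum>y\<in>A. u t y) \<le> (\<Sum>y\<in>A \<union> B. u t y)"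
    using assms finB u_nonneg by (intro sum_mono2) auto
  also have "\<dots> = (\<Sum>y\<in>B. u t y)"
    using assms finB suppD[OF supp_u] by (intro sum.mono_neutral_right) auto
  also have "\<dots> \<le> ip B (\<lambda>_. 1) (u t)"
    using sum_B_le_ip[of "\<lambda>_. 1" "u t"] u_nonneg by simp
  also have "\<dots> \<le> 2"
    using kern_mass[of t x] kern_mass[of "Suc t" x]
    by (simp add: u_def[abs_def] ip_add_right del: kern.simps)
  finally show ?thesis .
qed

lemma sum_u_square:
  assumes "finite A"
  shows "(\<Sum>y\<in>A. (u t y)\<^sup>2) \<le> 2 * w t"
proof -
  have "(\<Sum>y\<in>A. (u t y)\<^sup>2) \<le> (\<Sum>y\<in>A \<union> B. (u t y)\<^sup>2)"
    using assms finB by (intro sum_mono2) auto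
  also have "\<dots> = (\<Sum>y\<in>B. (u t y)\<^sup>2)"
    using assms finB suppD[OF supp_u] by (intro sum.mono_neutral_right) auto
  also have "\<dots> \<le> ip B (u t) (u t)"
    using sum_B_le_ip[of "u t" "u t"] by (simp add: power2_eq_square)
  also have "\<dots> = kern B (2 * t) x x + 2 * kern B (2 * t + 1) x x + kern B (2 * Suc t) x x"
    by (simp add: u_def[abs_def] ip_add ip_add_right ip_kern del: kern.simps)
  also have "\<dots> \<le> 2 * w t"
    using kern_diag_even_mono[OF x_in, of t] by (simp add: w_def u_def del: kern.simps)
  finally show ?thesis .
qed

lemma u_diag: "u t x \<le> w (t div 2)"
proof (cases "even t")
  case True
  then show ?thesis by (simp add: w_def)
next
  case False
  then obtain s where s: "t = 2 * s + 1" by (elim oddE)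
  then show ?thesis
    using kern_diag_even_mono[OF x_in, of s] by (simp add: w_def u_def del: kern.simps)
qed

lemma w_telescope: "s \<le> t \<Longrightarrow> (\<Sum>i\<in>{s..<t}. w i - w (Suc i)) = w s - w t"
  using sum_Suc_diff'[of s t "\<lambda>i. - w i"] by (simp add: algebra_simps)

text \<open>A discrete form of the differential inequality \<open>w\<^sup>2 \<le> A * w - R * w'\<close>.\<close>

lemma w_decay:
  assumes t: "1 \<le> t" and R: "0 \<le> R"
    and ineq: "\<And>s. t \<le> s \<Longrightarrow> (w s)\<^sup>2 \<le> A * w s + R * (w (2 * s) - w (2 * s + 1))"
  shows "w (2 * t) \<le> max (2 * A) (2 * R / real t)"
proof (rule ccontr)
  assume "\<not> ?thesis"
  then have big: "2 * A < w (2 * t)" "2 * R / real t < w (2 * t)" by auto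
  then have wpos: "0 < w (2 * t)" using R t by (meson divide_nonneg_nonneg le_less_trans mult_nonneg_nonneg of_nat_0_le_iff zero_le_numeral)
  \<comment> \<open>While \<open>w s\<close> exceeds \<open>2 * A\<close>, the linear term is at
    most half of the square; what remains is summed over \<open>t <= s < 2 * t\<close>.\<close>
  have "real t * ((w (2 * t))\<^sup>2 / 2) = (\<Sum>s\<in>{t..<2 * t}. (w (2 * t))\<^sup>2 / 2)" by simp
  also have "\<dots> \<le> (\<Sum>s\<in>{t..<2 * t}. R * (w (2 * s) - w (2 * Suc s)))"
  proof (rule sum_mono)
    fix s assume s: "s \<in> {t..<2 * t}"
    have ws: "w (2 * t) \<le> w s" using s by (intro w_antimono) auto
    then have "(2 * A) * w s \<le> w s * w s" using big wpos by (intro mult_right_mono) auto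
    moreover have "(w s)\<^sup>2 \<le> A * w s + R * (w (2 * s) - w (2 * s + 1))" using s by (intro ineq) auto
    \<comment> \<open>The decrement is enlarged from one time step to two so that the sum over
      \<open>s\<close> telescopes.\<close>
    moreover have "R * (w (2 * s) - w (2 * s + 1)) \<le> R * (w (2 * s) - w (2 * Suc s))"
      using R w_decseq[of "2 * s + 1"] by (intro mult_left_mono) auto
    moreover have "(w (2 * t))\<^sup>2 \<le> (w s)\<^sup>2" using ws wpos by (intro power_mono) auto
    ultimately show "(w (2 * t))\<^sup>2 / 2 \<le> R * (w (2 * s) - w (2 * Suc s))"
      by (simp add: power2_eq_square)
  qed
  also have "\<dots> = R * (w (2 * t) - w (2 * (2 * t)))"
  proof -
    have "(\<Sum>s\<in>{t..<2 * t}. w (2 * s) - w (2 * Suc s)) = w (2 * t) - w (2 * (2 * t))"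
      using sum_Suc_diff'[of t "2 * t" "\<lambda>s. - w (2 * s)"] by (simp add: algebra_simps)
    then show ?thesis by (simp only: sum_distrib_left[symmetric])
  qed
  also have "\<dots> \<le> R * w (2 * t)" using R w_nonneg by (intro mult_left_mono) auto
  finally have "w (2 * t) * (real t * w (2 * t)) \<le> w (2 * t) * (2 * R)"
    by (simp add: power2_eq_square algebra_simps)
  then have "real t * w (2 * t) \<le> 2 * R" using wpos by simp
  then show False using big(2) t by (simp add: field_simps)
qed

end

section \<open>Few collisions on tall teeth\<close>

context comb_graph
begin

text \<open>Go down the tooth of \<open>x\<close>, then along the base. As \<open>x\<close> is
  fixed, its level may enter \<open>K\<close> and its distance from the root may enter
  \<open>k0\<close>; the estimate is uniform in \<open>f\<close>, which will be a kernel killed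
  outside an arbitrary \<open>B\<close>.\<close>

lemma base_oscillation:
  assumes x: "x \<in> VG" and M: "M \<ge> 1"
  shows "\<exists>K>0. \<exists>k0\<ge>1. \<forall>k\<ge>k0. \<forall>v\<in>gball rt (M * k). \<forall>f e. 0 \<le> e \<longrightarrow> energy EG f \<le> ennreal e \<longrightarrow>
    (f x - f (v, 0))\<^sup>2 \<le> K * real k powr \<kappa> * e"
proof -
  obtain v0 n where vn: "x = (v0, n)" by (cases x)
  have v0: "v0 \<in> V" "n \<le> height v0" using x by (auto simp: vn VG_iff)
  define K where "K = 2 * real n + 2 * (C * real (M + 1) powr \<kappa>)"
  have K: "0 < K" using C_pos by (simp add: K_def add_nonneg_pos)
  have "(f x - f (v, 0))\<^sup>2 \<le> K * real k powr \<kappa> * e"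
    if k: "k \<ge> Suc (d v0 rt)" and v: "v \<in> gball rt (M * k)" and e: "0 \<le> e" "energy EG f \<le> ennreal e" for k v f e
  proof -
    have vV: "v \<in> V" and dv: "d v rt \<le> M * k" using v by (auto simp: graph_ball_def)
    have k1: "1 \<le> real k powr \<kappa>" using k \<kappa>_pos by (intro ge_one_powr_ge_zero) auto
    have "d v0 v \<le> (M + 1) * k"
      using dist_triangle[OF v0(1) root vV] dist_root_comm[OF vV] dv k by simp
    then have "real (d v0 v) \<le> real (M + 1) * real k" by (metis of_nat_mult of_nat_le_iff)
    then have "real (d v0 v) powr \<kappa> \<le> (real (M + 1) * real k) powr \<kappa>"
      using \<kappa>_pos by (intro powr_mono2) simp_all
    also have "\<dots> = real (M + 1) powr \<kappa> * real k powr \<kappa>" by (simp add: powr_mult)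
    finally have "C * real (d v0 v) powr \<kappa> * e \<le> C * (real (M + 1) powr \<kappa> * real k powr \<kappa>) * e"
      using C_pos e by (intro mult_right_mono mult_left_mono) auto
    then have 1: "(f (v0, 0) - f (v, 0))\<^sup>2 \<le> C * (real (M + 1) powr \<kappa> * real k powr \<kappa>) * e"
      using oscillation[OF v0(1) vV e(1) energy_base[OF e(2,1)]] by simp
    have "(f (v0, n) - f (v0, 0))\<^sup>2 \<le> real n * tooth f v0"
      using tooth_oscillation[of n v0 0 f] v0 by simp
    also have "\<dots> \<le> real n * e"
      using energy_tooth_le[OF e(2,1) v0(1)] by (intro mult_left_mono) auto
    also have "\<dots> \<le> real n * real k powr \<kappa> * e"
      using k1 e mult_right_mono[OF k1, of "real n * e"] by (simp add: mult_ac)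
    finally have 2: "(f (v0, n) - f (v0, 0))\<^sup>2 \<le> real n * real k powr \<kappa> * e" .
    have "(f x - f (v, 0))\<^sup>2 = ((f (v0, n) - f (v0, 0)) + (f (v0, 0) - f (v, 0)))\<^sup>2" by (simp add: vn)
    also have "\<dots> \<le> 2 * (f (v0, n) - f (v0, 0))\<^sup>2 + 2 * (f (v0, 0) - f (v, 0))\<^sup>2" by (rule square_add_le)
    also have "\<dots> \<le> 2 * (real n * real k powr \<kappa> * e) + 2 * (C * (real (M + 1) powr \<kappa> * real k powr \<kappa>) * e)"
      using 1 2 by linarith
    also have "\<dots> = K * real k powr \<kappa> * e" by (simp add: K_def algebra_simps)
    finally show ?thesis .
  qed
  then show ?thesis using K by (intro exI[of _ K] conjI exI[of _ "Suc (d v0 rt)"]) auto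
qed

text \<open>A Nash-type inequality: \<open>f x\<close> is compared with \<open>f (v, l)\<close>
  through the foot of the tooth. The product \<open>w * f (v, l)\<close>, rather than a square, is
  bounded below, so that its sum can be compared with the mass.\<close>

lemma average_over_teeth:
  assumes A: "finite A" "A \<subseteq> V" and H: "\<And>v. v \<in> A \<Longrightarrow> H \<le> height v"
    and e: "0 \<le> e" "energy EG f \<le> ennreal e" and w: "w = f x" "0 \<le> w"
    and R: "\<And>v. v \<in> A \<Longrightarrow> (f x - f (v, 0))\<^sup>2 \<le> R * e"
    and mass: "(\<Sum>v\<in>A. \<Sum>l<H. f (v, l)) \<le> 2"
  shows "real (card A) * real H * w\<^sup>2 \<le> 4 * w + 2 * (real (card A) * real H * R + (real H)\<^sup>2) * e"
proof -
  have pt: "w\<^sup>2 / 2 - R * e - real H * tooth f v \<le> w * f (v, l)" if v: "v \<in> A" and l: "l < H" for v l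
  proof -
    have "(f (v, l) - f (v, 0))\<^sup>2 \<le> real l * tooth f v"
      using tooth_oscillation[of l v 0 f] H[OF v] l by simp
    also have "\<dots> \<le> real H * tooth f v"
      using l tooth_nonneg by (intro mult_right_mono) auto
    finally have 1: "(f (v, 0) - f (v, l))\<^sup>2 \<le> real H * tooth f v" by (simp add: power2_commute)
    have 2: "(w - f (v, 0))\<^sup>2 \<le> R * e" using R[OF v] w by simp
    have "w * (w - f (v, 0)) \<le> w\<^sup>2 / 4 + (w - f (v, 0))\<^sup>2"
      using sum_squares_bound[of "w / 2" "w - f (v, 0)"] by (simp add: power2_eq_square field_simps)
    moreover have "w * (f (v, 0) - f (v, l)) \<le> w\<^sup>2 / 4 + (f (v, 0) - f (v, l))\<^sup>2"
      using sum_squares_bound[of "w / 2" "f (v, 0) - f (v, l)"] by (simp add: power2_eq_square field_simps)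
    moreover have "w * f (v, l) = w\<^sup>2 - w * (w - f (v, 0)) - w * (f (v, 0) - f (v, l))"
      by (simp add: power2_eq_square algebra_simps)
    ultimately show ?thesis using 1 2 by linarith
  qed
  have "(\<Sum>v\<in>A. \<Sum>l<H. w\<^sup>2 / 2 - R * e - real H * tooth f v) \<le> (\<Sum>v\<in>A. \<Sum>l<H. w * f (v, l))"
    by (intro sum_mono pt) auto
  also have "\<dots> \<le> w * 2"
    unfolding sum_distrib_left[symmetric] using w mass by (intro mult_left_mono) auto
  finally have "(\<Sum>v\<in>A. real H * (w\<^sup>2 / 2 - R * e) - (real H)\<^sup>2 * tooth f v) \<le> w * 2"
    by (simp add: right_diff_distrib power2_eq_square mult.assoc)
  then have "real (card A) * (real H * (w\<^sup>2 / 2 - R * e)) - (real H)\<^sup>2 * (\<Sum>v\<in>A. tooth f v) \<le> w * 2"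
    by (simp add: sum_subtractf sum_distrib_left)
  moreover have "(real H)\<^sup>2 * (\<Sum>v\<in>A. tooth f v) \<le> (real H)\<^sup>2 * e"
    using energy_teeth[OF e(2,1) A] by (intro mult_left_mono) auto
  ultimately show ?thesis by (simp add: algebra_simps)
qed

text \<open>On a tooth of height at least \<open>H\<close>, the value at level \<open>l\<close> is
  compared with the mean square over \<open>H\<close> nearby levels. The shorter teeth belong to
  \<open>U\<close>; there the comparison goes through the foot of the tooth to
  \<open>x\<close>.\<close>

lemma level_sum:
  assumes A: "finite A" "A \<subseteq> V" "\<And>v. v \<in> A \<Longrightarrow> l \<le> height v" and H: "0 < H"
    and e: "0 \<le> e" "energy EG f \<le> ennreal e"
    and U: "finite U" "\<And>v. v \<in> A - U \<Longrightarrow> H \<le> height v"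
    and R: "\<And>v. v \<in> U \<Longrightarrow> (f x - f (v, 0))\<^sup>2 \<le> R * e" "0 \<le> R"
    and N: "\<And>I. finite I \<Longrightarrow> (\<Sum>y\<in>I. (f y)\<^sup>2) \<le> N"
  shows "(\<Sum>v\<in>A. (f (v, l))\<^sup>2) \<le> 2 / real H * N + 2 * real H * e + real (card U) * (4 * (f x)\<^sup>2 + 4 * R * e)"
proof -
  let ?s = "\<lambda>v. \<Sum>j\<le>height v. (f (v, j))\<^sup>2"
  let ?b = "\<lambda>v. of_bool (v \<in> U) * (4 * (f x)\<^sup>2 + 4 * R * e)"
  have b0: "0 \<le> ?b v" for v using R e by simp
  have pt: "(f (v, l))\<^sup>2 \<le> 2 / real H * ?s v + 2 * real H * tooth f v + ?b v" if v: "v \<in> A" for v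
  proof (cases "H \<le> height v")
    case True
    \<comment> \<open>The window \<open>?J\<close> has \<open>H\<close> levels, all within distance
      \<open>H\<close> of \<open>l\<close> and inside the tooth: below \<open>l\<close> if there is
      room, otherwise from the bottom.\<close>
    define j0 where "j0 = (if l < H then 0 else l - H)"
    let ?J = "{j0..<j0 + H}"
    have J: "\<bar>real j - real l\<bar> \<le> real H" "j \<le> height v" if "j \<in> ?J" for j
      using that True A(3)[OF v] unfolding j0_def by (auto split: if_splits)
    have "real H * (f (v, l))\<^sup>2 = (\<Sum>j\<in>?J. (f (v, l))\<^sup>2)" by simp
    also have "\<dots> \<le> (\<Sum>j\<in>?J. 2 * (f (v, j))\<^sup>2 + 2 * (real H * tooth f v))"
    proof (rule sum_mono)
      fix j assume j: "j \<in> ?J"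
      have "(f (v, l) - f (v, j))\<^sup>2 \<le> \<bar>real l - real j\<bar> * tooth f v"
        using J[OF j] A(3)[OF v] by (intro tooth_oscillation) auto
      also have "\<dots> \<le> real H * tooth f v"
        using J[OF j] tooth_nonneg by (intro mult_right_mono) auto
      finally show "(f (v, l))\<^sup>2 \<le> 2 * (f (v, j))\<^sup>2 + 2 * (real H * tooth f v)"
        using square_add_le[of "f (v, j)" "f (v, l) - f (v, j)"] by simp
    qed
    also have "\<dots> = 2 * (\<Sum>j\<in>?J. (f (v, j))\<^sup>2) + real H * (2 * (real H * tooth f v))"
      by (simp add: sum.distrib sum_distrib_left)
    also have "(\<Sum>j\<in>?J. (f (v, j))\<^sup>2) \<le> ?s v"
      using J by (intro sum_mono2) auto
    finally have "real H * (f (v, l))\<^sup>2 \<le> real H * (2 / real H * ?s v + 2 * real H * tooth f v)"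
      using H by (simp add: algebra_simps)
    then have "(f (v, l))\<^sup>2 \<le> 2 / real H * ?s v + 2 * real H * tooth f v"
      using H by (subst (asm) mult_le_cancel_left_pos) auto
    then show ?thesis using b0[of v] by linarith
  next
    case False
    then have vU: "v \<in> U" using U(2) v by auto
    have "(f (v, l) - f (v, 0))\<^sup>2 \<le> real l * tooth f v"
      using tooth_oscillation[of l v 0 f] A(3)[OF v] by simp
    also have "\<dots> \<le> real H * tooth f v"
      using False A(3)[OF v] tooth_nonneg by (intro mult_right_mono) auto
    finally have "(f (v, l))\<^sup>2 \<le> 2 * (f (v, 0))\<^sup>2 + 2 * (real H * tooth f v)"
      using square_add_le[of "f (v, 0)" "f (v, l) - f (v, 0)"] by simp
    moreover have "(f (v, 0))\<^sup>2 \<le> 2 * (f x)\<^sup>2 + 2 * (R * e)"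
      using square_add_le[of "f x" "f (v, 0) - f x"] R(1)[OF vU] by (simp add: power2_commute)
    moreover have "0 \<le> 2 / real H * ?s v" by (intro mult_nonneg_nonneg sum_nonneg) auto
    ultimately show ?thesis using vU by simp
  qed
  have "(\<Sum>v\<in>A. (f (v, l))\<^sup>2) \<le> (\<Sum>v\<in>A. 2 / real H * ?s v + 2 * real H * tooth f v + ?b v)"
    by (intro sum_mono pt)
  also have "\<dots> = 2 / real H * (\<Sum>v\<in>A. ?s v) + 2 * real H * (\<Sum>v\<in>A. tooth f v) + (\<Sum>v\<in>A. ?b v)"
    by (simp add: sum.distrib sum_distrib_left)
  also have "\<dots> \<le> 2 / real H * N + 2 * real H * e + real (card U) * (4 * (f x)\<^sup>2 + 4 * R * e)"
  proof (intro add_mono mult_left_mono)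
    have "(\<Sum>v\<in>A. ?s v) = (\<Sum>y\<in>Sigma A (\<lambda>v. {..height v}). (f y)\<^sup>2)"
      using A by (subst sum.Sigma) auto
    then show "(\<Sum>v\<in>A. ?s v) \<le> N" using N A by simp
    show "(\<Sum>v\<in>A. tooth f v) \<le> e" by (rule energy_teeth[OF e(2,1) A(1,2)])
    have "(\<Sum>v\<in>A. ?b v) \<le> (\<Sum>v\<in>A \<union> U. ?b v)" using A U b0 by (intro sum_mono2) auto
    also have "\<dots> = (\<Sum>v\<in>U. ?b v)" using A U by (intro sum.mono_neutral_right) auto
    also have "\<dots> = real (card U) * (4 * (f x)\<^sup>2 + 4 * R * e)" by simp
    finally show "(\<Sum>v\<in>A. ?b v) \<le> real (card U) * (4 * (f x)\<^sup>2 + 4 * R * e)" .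
  qed auto
  finally show ?thesis .
qed

end

text \<open>Each dyadic block contributes at most \<open>1\<close>.\<close>

lemma sum_reciprocal_dyadic: "(\<Sum>l<2 ^ m. 1 / (real l + 1)) \<le> real m + 1"
proof (induction m)
  case (Suc m)
  have "(\<Sum>l<2 ^ Suc m. 1 / (real l + 1)) =
      (\<Sum>l<2 ^ m. 1 / (real l + 1)) + (\<Sum>l\<in>{2 ^ m..<2 ^ Suc m}. 1 / (real l + 1))"
    by (subst sum.union_disjoint[symmetric]) (auto intro!: sum.cong)
  also have "(\<Sum>l\<in>{2 ^ m..<2 ^ Suc m}. 1 / (real l + 1)) \<le> (\<Sum>l\<in>{2 ^ m..<2 ^ Suc m :: nat}. 1 / 2 ^ m)"
  proof (rule sum_mono)
    fix l :: nat assume "l \<in> {2 ^ m..<2 ^ Suc m}"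
    then have "real (2 ^ m) \<le> real l" unfolding of_nat_le_iff by simp
    then have "2 ^ m \<le> real l + 1" by (simp only: of_nat_power of_nat_numeral)
    then show "1 / (real l + 1) \<le> 1 / 2 ^ m" by (intro divide_left_mono) auto
  qed
  also have "\<dots> = 1" by simp
  finally show ?case using Suc by simp
qed simp

section \<open>Heat kernel estimates on the comb\<close>

context comb_graph
begin

lemma tooth_height:
  assumes "1 \<le> k" "k \<le> d rt v" "0 < g" "g \<le> \<gamma>"
  shows "nat \<lfloor>real k powr g\<rfloor> \<le> height v"
proof (rule le_height)
  have "real (nat \<lfloor>real k powr g\<rfloor>) \<le> real k powr g" by (simp add: of_nat_nat)
  also have "\<dots> \<le> real k powr \<gamma>" using assms by (intro powr_mono) auto
  also have "\<dots> \<le> real (d rt v) powr \<gamma>" using assms by (intro powr_mono2) auto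
  finally show "real (nat \<lfloor>real k powr g\<rfloor>) \<le> real (d rt v) powr \<gamma>" .
qed

lemma floor_powr_bounds:
  assumes "1 \<le> k" "0 < g"
  shows "1 \<le> nat \<lfloor>real k powr g\<rfloor>" "real (nat \<lfloor>real k powr g\<rfloor>) \<le> real k powr g"
    "real k powr g \<le> 2 * real (nat \<lfloor>real k powr g\<rfloor>)"
proof -
  have "1 \<le> real k powr g" using assms by (intro ge_one_powr_ge_zero) auto
  then have "1 \<le> \<lfloor>real k powr g\<rfloor>" by simp
  moreover have "real (nat \<lfloor>real k powr g\<rfloor>) = of_int \<lfloor>real k powr g\<rfloor>" by simp
  ultimately show "1 \<le> nat \<lfloor>real k powr g\<rfloor>" "real (nat \<lfloor>real k powr g\<rfloor>) \<le> real k powr g"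
    "real k powr g \<le> 2 * real (nat \<lfloor>real k powr g\<rfloor>)" by linarith+
qed

text \<open>In the notation of the proof, averaging over an annulus gives the inequality of
  \<open>w_decay\<close> with linear coefficient of order \<open>1 / (X * Z)\<close> and
  \<open>R\<close> of order \<open>Y\<close>. The two resulting bounds balance at time
  \<open>X * Y * Z\<close>.\<close>

lemma heat_decay:
  assumes x: "x \<in> VG" and g: "0 < g" "g \<le> \<gamma>" "g \<le> \<alpha> + \<kappa>"
  shows "\<exists>K>0. \<exists>k0\<ge>1. \<forall>k\<ge>k0. \<forall>B t. heat_kernel VG EG B x \<longrightarrow> real k powr (\<alpha> + \<kappa> + g) \<le> real t \<longrightarrow>
    heat_kernel.w EG B x (2 * t) \<le> K * real k powr - (\<alpha> + g)"
proof -
  obtain M where M: "M \<ge> 1" "\<And>v k. v \<in> V \<Longrightarrow> k \<ge> 1 \<Longrightarrow> real k powr \<alpha> \<le> real (card (gball v (M * k) - gball v k))"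
    using annulus by blast
  obtain K2 k0 where K2: "K2 > 0" and k0: "k0 \<ge> 1" and
    osc: "\<And>k v f e. k \<ge> k0 \<Longrightarrow> v \<in> gball rt (M * k) \<Longrightarrow> 0 \<le> e \<Longrightarrow> energy EG f \<le> ennreal e \<Longrightarrow>
      (f x - f (v, 0))\<^sup>2 \<le> K2 * real k powr \<kappa> * e"
    using base_oscillation[OF x M(1)] by blast
  define K where "K = 16 + 4 * (K2 + 1)"
  have K: "0 < K" using K2 by (simp add: K_def)
  have "heat_kernel.w EG B x (2 * t) \<le> K * real k powr - (\<alpha> + g)"
    if k: "k \<ge> k0" and B: "heat_kernel VG EG B x" and t: "real k powr (\<alpha> + \<kappa> + g) \<le> real t" for k B t
  proof -
    interpret HK: heat_kernel VG EG B x by (rule B)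
    have k1: "1 \<le> k" using k k0 by simp
    define H where "H = nat \<lfloor>real k powr g\<rfloor>"
    note H = floor_powr_bounds[OF k1 g(1), folded H_def]
    define A where "A = gball rt (M * k) - gball rt k"
    have A: "finite A" "A \<subseteq> V" using finite_ball[OF root] ball_subset by (auto simp: A_def)
    define X Y Z where "X = real k powr \<alpha>" and "Y = real k powr \<kappa>" and "Z = real k powr g"
    have pos: "0 < X" "0 < Y" "0 < Z" using k1 by (auto simp: X_def Y_def Z_def)
    have N: "X \<le> real (card A)" using M(2)[OF root k1] by (simp add: A_def X_def)
    have hA: "H \<le> height v" if "v \<in> A" for v
      unfolding H_def using that dist_root_comm[of v]
      by (intro tooth_height k1 g) (auto simp: A_def graph_ball_def)
    have ZXY: "Z \<le> X * Y"
      unfolding X_def Y_def Z_def powr_add[symmetric] using g k1 by (intro powr_mono) auto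
    have XYZ: "real k powr (\<alpha> + \<kappa> + g) = X * Y * Z" "real k powr - (\<alpha> + g) = 1 / (X * Z)"
      unfolding powr_minus_divide powr_add X_def Y_def Z_def by simp_all
    \<comment> \<open>\<open>8\<close> instead of \<open>4\<close> because \<open>H\<close> may be
      as small as \<open>Z / 2\<close>.\<close>
    define a R where "a = 8 / (X * Z)" and "R = 2 * (K2 + 1) * Y"
    have "HK.w (2 * t) \<le> max (2 * a) (2 * R / real t)"
    proof (rule HK.w_decay)
      have "0 < real k powr (\<alpha> + \<kappa> + g)" using k1 by simp
      with t have "0 < real t" by linarith
      then show "1 \<le> t" by simp
      show "0 \<le> R" using K2 pos by (simp add: R_def)
      fix s assume "t \<le> s"
      define e where "e = HK.w (2 * s) - HK.w (2 * s + 1)"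
      have e: "0 \<le> e" "energy EG (HK.u (2 * s)) \<le> ennreal e"
        using HK.energy_supp[OF HK.supp_u, of "2 * s"] by (simp_all add: e_def HK.dirichlet_u)
      have "real (card A) * real H * (HK.w s)\<^sup>2 \<le>
          4 * HK.w s + 2 * (real (card A) * real H * (K2 * Y) + (real H)\<^sup>2) * e"
      proof (rule average_over_teeth[OF A hA e, where x = x])
        show "HK.w s = HK.u (2 * s) x" by (simp add: HK.w_def)
        show "(HK.u (2 * s) x - HK.u (2 * s) (v, 0))\<^sup>2 \<le> K2 * Y * e" if "v \<in> A" for v
          using osc[OF k _ e, of v] that by (simp add: A_def Y_def)
        have "(\<Sum>v\<in>A. \<Sum>l<H. HK.u (2 * s) (v, l)) = (\<Sum>y\<in>A \<times> {..<H}. HK.u (2 * s) y)"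
          by (simp add: sum.cartesian_product)
        also have "\<dots> \<le> 2" using A by (intro HK.sum_u) auto
        finally show "(\<Sum>v\<in>A. \<Sum>l<H. HK.u (2 * s) (v, l)) \<le> 2" .
      qed (use HK.w_nonneg in auto)
      moreover define n where "n = real (card A)"
      moreover define h where "h = real H"
      ultimately have "n * h * (HK.w s)\<^sup>2 \<le> 4 * HK.w s + 2 * (n * h * (K2 * Y) + h\<^sup>2) * e" by simp
      moreover have n: "X \<le> n" "0 < n" and h: "0 < h" "h \<le> Z" "Z \<le> 2 * h"
        using N H pos by (auto simp: n_def h_def Z_def)
      ultimately have "(HK.w s)\<^sup>2 \<le> 4 / (n * h) * HK.w s + 2 * (K2 * Y + h / n) * e"
        by (simp add: field_simps power2_eq_square)
      moreover have "4 / (n * h) * HK.w s \<le> a * HK.w s"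
      proof (rule mult_right_mono)
        have "X * Z \<le> n * (2 * h)" using n h pos by (intro mult_mono) auto
        then show "4 / (n * h) \<le> a" using n h pos by (simp add: a_def field_simps)
      qed (rule HK.w_nonneg)
      moreover have "2 * (K2 * Y + h / n) * e \<le> R * e"
      proof (rule mult_right_mono)
        have "h / n \<le> Z / X" using n h pos by (intro frac_le) auto
        also have "\<dots> \<le> Y" using ZXY pos by (simp add: field_simps)
        finally have "K2 * Y + h / n \<le> (K2 + 1) * Y" by (simp add: distrib_right)
        then show "2 * (K2 * Y + h / n) \<le> R"
          unfolding R_def mult.assoc by (rule mult_left_mono) simp
      qed (rule e)
      ultimately show "(HK.w s)\<^sup>2 \<le> a * HK.w s + R * (HK.w (2 * s) - HK.w (2 * s + 1))"
        by (simp add: e_def)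
    qed
    also have "\<dots> \<le> K * (1 / (X * Z))"
    proof (rule max.boundedI)
      show "2 * a \<le> K * (1 / (X * Z))" using K2 pos by (simp add: a_def K_def field_simps)
      have "2 * R / real t \<le> 2 * R / (X * Y * Z)"
      proof (rule divide_left_mono)
        have "0 < X * Y * Z" using pos by simp
        moreover from this have "0 < real t" using t XYZ by linarith
        ultimately show "0 < real t * (X * Y * Z)" by (rule mult_pos_pos[rotated])
      qed (use t K2 pos in \<open>auto simp: XYZ R_def\<close>)
      also have "\<dots> = 4 * (K2 + 1) * (1 / (X * Z))" using pos by (simp add: R_def)
      also have "\<dots> \<le> K * (1 / (X * Z))" using pos by (intro mult_right_mono) (auto simp: K_def)
      finally show "2 * R / real t \<le> K * (1 / (X * Z))" .
    qed
    finally show ?thesis unfolding XYZ .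
  qed
  then show ?thesis using K k0 by blast
qed

text \<open>\<open>level_sum\<close> is summed over the block: it has at most order
  \<open>X * Y * Z\<close> times, \<open>w\<close> is at most of order \<open>1 / (X * Z)\<close>,
  and the energies telescope. Every term is then at most of order \<open>Y / Z\<close>. The times
  start at \<open>4 * T\<close> since \<open>u_diag\<close> halves the time and the decay is
  available from \<open>2 * T\<close> on.\<close>

lemma block_sum:
  assumes x: "x \<in> VG" and g: "0 < g" "g \<le> \<gamma>" "g \<le> \<alpha> + \<kappa>" and \<Lambda>: "0 < \<Lambda>"
  shows "\<exists>K>0. \<exists>k0\<ge>1. \<forall>k\<ge>k0. \<forall>B T T' A l. heat_kernel VG EG B x \<longrightarrow>
    real k powr (\<alpha> + \<kappa> + g) \<le> real T \<longrightarrow> T \<le> T' \<longrightarrow> real T' \<le> \<Lambda> * real k powr (\<alpha> + \<kappa> + g) \<longrightarrow>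
    finite A \<longrightarrow> A \<subseteq> V \<longrightarrow> (\<forall>v\<in>A. l \<le> height v) \<longrightarrow>
    (\<Sum>t\<in>{4 * T..<4 * T'}. \<Sum>v\<in>A. (heat_kernel.u EG B x t (v, l))\<^sup>2) \<le> K * real k powr (\<kappa> - g)"
proof -
  obtain K2 k2 where K2: "K2 > 0" and k2: "k2 \<ge> 1" and
    osc: "\<And>k v f e. k \<ge> k2 \<Longrightarrow> v \<in> gball rt k \<Longrightarrow> 0 \<le> e \<Longrightarrow> energy EG f \<le> ennreal e \<Longrightarrow>
      (f x - f (v, 0))\<^sup>2 \<le> K2 * real k powr \<kappa> * e"
    using base_oscillation[OF x order_refl] by (metis mult_1)
  obtain K3 k3 where K3: "K3 > 0" and k3: "k3 \<ge> 1" and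
    decay: "\<And>k B t. k \<ge> k3 \<Longrightarrow> heat_kernel VG EG B x \<Longrightarrow> real k powr (\<alpha> + \<kappa> + g) \<le> real t \<Longrightarrow>
      heat_kernel.w EG B x (2 * t) \<le> K3 * real k powr - (\<alpha> + g)"
    using heat_decay[OF x g] by blast
  define K where "K = 4 * \<Lambda> * (8 * K3 + 4 * C * K3\<^sup>2) + 2 * K3 + 4 * C * K2 * K3"
  have K: "0 < K" unfolding K_def using \<Lambda> K2 K3 C_pos by (intro add_pos_pos mult_pos_pos) auto
  have "(\<Sum>t\<in>{4 * T..<4 * T'}. \<Sum>v\<in>A. (heat_kernel.u EG B x t (v, l))\<^sup>2) \<le> K * real k powr (\<kappa> - g)"
    if k: "k \<ge> max k2 k3" and B: "heat_kernel VG EG B x"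
      and T: "real k powr (\<alpha> + \<kappa> + g) \<le> real T" "T \<le> T'" "real T' \<le> \<Lambda> * real k powr (\<alpha> + \<kappa> + g)"
      and A: "finite A" "A \<subseteq> V" "\<forall>v\<in>A. l \<le> height v" for k B T T' A l
  proof -
    interpret HK: heat_kernel VG EG B x by (rule B)
    have k1: "1 \<le> k" and k23: "k \<ge> k2" "k \<ge> k3" using k k2 by auto
    define H where "H = nat \<lfloor>real k powr g\<rfloor>"
    note H = floor_powr_bounds[OF k1 g(1), folded H_def]
    define X Y Z where "X = real k powr \<alpha>" and "Y = real k powr \<kappa>" and "Z = real k powr g"
    have pos: "0 < X" "0 < Y" "0 < Z" using k1 by (auto simp: X_def Y_def Z_def)
    have ZXY: "Z \<le> X * Y"
      unfolding X_def Y_def Z_def powr_add[symmetric] using g k1 by (intro powr_mono) auto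
    have XYZ: "real k powr (\<alpha> + \<kappa> + g) = X * Y * Z" "real k powr - (\<alpha> + g) = 1 / (X * Z)"
      "real k powr (\<kappa> - g) = Y / Z"
      unfolding powr_minus_divide powr_add powr_diff X_def Y_def Z_def by simp_all
    \<comment> \<open>The teeth rooted in this ball may be shorter than \<open>H\<close>; there are
      at most \<open>C * X\<close> of them.\<close>
    let ?U = "gball rt k"
    have U: "finite ?U" "real (card ?U) \<le> C * X"
      using finite_ball[OF root] volume[OF root k1] by (auto simp: X_def)
    define W where "W = K3 / (X * Z)"
    have W0: "0 < W" using K3 pos by (simp add: W_def)
    have w2T: "HK.w (2 * T) \<le> W" using decay[OF k23(2) B T(1)] unfolding XYZ by (simp add: W_def)
    have wt: "HK.w t \<le> W" if "2 * T \<le> t" for t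
      using HK.w_antimono[OF that] w2T by linarith
    define q where "q = real (card ?U)"
    have q: "0 \<le> q" "q \<le> C * X" using U by (auto simp: q_def)
    have "(\<Sum>t\<in>{4 * T..<4 * T'}. \<Sum>v\<in>A. (HK.u t (v, l))\<^sup>2) \<le>
      (\<Sum>t\<in>{4 * T..<4 * T'}. (8 / Z * W + q * (4 * W\<^sup>2)) + (2 * Z + q * (4 * (K2 * Y))) * (HK.w t - HK.w (Suc t)))"
    proof (rule sum_mono)
      fix t assume t: "t \<in> {4 * T..<4 * T'}"
      define e where "e = HK.w t - HK.w (Suc t)"
      have e: "0 \<le> e" "energy EG (HK.u t) \<le> ennreal e"
        using HK.energy_supp[OF HK.supp_u, of t] by (simp_all add: e_def HK.dirichlet_u)
      have "2 * T \<le> t div 2" using t by auto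
      then have ux: "(HK.u t x)\<^sup>2 \<le> W\<^sup>2"
        using HK.u_diag[of t] wt[of "t div 2"] HK.u_nonneg[of t x] by (intro power_mono) auto
      have "(\<Sum>v\<in>A. (HK.u t (v, l))\<^sup>2) \<le>
        2 / real H * (2 * HK.w t) + 2 * real H * e + real (card ?U) * (4 * (HK.u t x)\<^sup>2 + 4 * (K2 * Y) * e)"
      proof (rule level_sum[OF A(1,2) _ _ e U(1)])
        show "H \<le> height v" if "v \<in> A - ?U" for v
          unfolding H_def using that dist_root_comm[of v] A(2)
          by (intro tooth_height k1 g) (auto simp: graph_ball_def)
        show "(HK.u t x - HK.u t (v, 0))\<^sup>2 \<le> K2 * Y * e" if "v \<in> ?U" for v
          using osc[OF k23(1) that e] by (simp add: Y_def)
      qed (use A H pos K2 HK.sum_u_square in auto)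
      also have "\<dots> \<le> 8 / Z * W + 2 * Z * e + q * (4 * W\<^sup>2 + 4 * (K2 * Y) * e)"
        unfolding q_def[symmetric]
      proof (intro add_mono mult_left_mono mult_right_mono)
        have "2 / real H \<le> 4 / Z" using H pos by (simp add: field_simps Z_def)
        then have "2 / real H * (2 * HK.w t) \<le> 4 / Z * (2 * W)"
          using t wt[of t] HK.w_nonneg pos by (intro mult_mono) auto
        then show "2 / real H * (2 * HK.w t) \<le> 8 / Z * W" by simp
      qed (use H e ux q pos K2 in \<open>auto simp: Z_def\<close>)
      finally show "(\<Sum>v\<in>A. (HK.u t (v, l))\<^sup>2) \<le>
          (8 / Z * W + q * (4 * W\<^sup>2)) + (2 * Z + q * (4 * (K2 * Y))) * (HK.w t - HK.w (Suc t))"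
        by (simp add: e_def algebra_simps)
    qed
    also have "\<dots> = real (4 * T' - 4 * T) * (8 / Z * W + q * (4 * W\<^sup>2)) +
        (2 * Z + q * (4 * (K2 * Y))) * (HK.w (4 * T) - HK.w (4 * T'))"
      using T(2) HK.w_telescope[of "4 * T" "4 * T'"] by (simp add: sum.distrib sum_distrib_left[symmetric])
    also have "\<dots> \<le> 4 * \<Lambda> * (X * Y * Z) * (8 / Z * W + C * X * (4 * W\<^sup>2)) +
        (2 * Z + C * X * (4 * (K2 * Y))) * W"
    proof (intro add_mono mult_mono)
      show "real (4 * T' - 4 * T) \<le> 4 * \<Lambda> * (X * Y * Z)" using T XYZ by (simp add: of_nat_diff)
      show "HK.w (4 * T) - HK.w (4 * T') \<le> W" using wt[of "4 * T"] HK.w_nonneg[of "4 * T'"] by simp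
      show "0 \<le> HK.w (4 * T) - HK.w (4 * T')" using HK.w_antimono[of "4 * T" "4 * T'"] T(2) by simp
    qed (use q W0 pos K2 \<Lambda> C_pos in auto)
    also have "\<dots> = (4 * \<Lambda> * (8 * K3 + 4 * C * K3\<^sup>2) + 4 * C * K2 * K3) * (Y / Z) + 2 * K3 * (1 / X)"
      using pos by (simp add: W_def field_simps power2_eq_square)
    also have "2 * K3 * (1 / X) \<le> 2 * K3 * (Y / Z)"
      using ZXY pos K3 by (intro mult_left_mono) (auto simp: field_simps)
    finally show ?thesis by (simp add: XYZ K_def algebra_simps)
  qed
  then show ?thesis using K k2 k3 by (intro exI[of _ K] conjI exI[of _ "max k2 k3"]) auto
qed

text \<open>Block \<open>i\<close> belongs to the scale \<open>2 ^ i\<close>. The levels reached by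
  its end number at most \<open>2 ^ (a + p * i)\<close>, so their harmonic sum grows linearly in
  \<open>i\<close>, while each level contributes at most order \<open>z ^ i\<close> with
  \<open>z < 1\<close>.\<close>

lemma total_sum:
  assumes x: "x \<in> VG" and \<gamma>: "\<kappa> < \<gamma>"
  shows "\<exists>K. \<forall>B A n. heat_kernel VG EG B x \<longrightarrow> finite A \<longrightarrow> A \<subseteq> V \<longrightarrow>
    (\<Sum>t<n. \<Sum>l\<le>snd x + t. 1 / (real l + 1) *
      (\<Sum>v\<in>{v \<in> A. l \<le> height v}. (heat_kernel.u EG B x t (v, l))\<^sup>2)) \<le> K"
proof -
  define g where "g = min \<gamma> (\<alpha> + \<kappa>)"
  define \<rho> where "\<rho> = \<alpha> + \<kappa> + g"
  have g: "0 < g" "g \<le> \<gamma>" "g \<le> \<alpha> + \<kappa>" "\<kappa> < g"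
    using \<gamma> \<gamma>_pos \<alpha>_pos \<kappa>_pos by (auto simp: g_def)
  have \<rho>: "0 < \<rho>" using g \<alpha>_pos \<kappa>_pos by (simp add: \<rho>_def)
  \<comment> \<open>The factor \<open>2 powr \<rho>\<close> pays for the passage to the next scale,
    the other \<open>2\<close> for rounding in \<open>T\<close>.\<close>
  define \<Lambda> where "\<Lambda> = 2 * 2 powr \<rho>"
  have \<Lambda>: "0 < \<Lambda>" by (simp add: \<Lambda>_def)
  obtain K1 k0 where K1: "K1 > 0" and k0: "k0 \<ge> 1" and
    block: "\<And>k B T T' A l. k \<ge> k0 \<Longrightarrow> heat_kernel VG EG B x \<Longrightarrow>
      real k powr \<rho> \<le> real T \<Longrightarrow> T \<le> T' \<Longrightarrow> real T' \<le> \<Lambda> * real k powr \<rho> \<Longrightarrow>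
      finite A \<Longrightarrow> A \<subseteq> V \<Longrightarrow> \<forall>v\<in>A. l \<le> height v \<Longrightarrow>
      (\<Sum>t\<in>{4 * T..<4 * T'}. \<Sum>v\<in>A. (heat_kernel.u EG B x t (v, l))\<^sup>2) \<le> K1 * real k powr (\<kappa> - g)"
    using block_sum[OF x g(1-3) \<Lambda>] unfolding \<rho>_def by blast
  define T where "T i = nat \<lceil>real (2 ^ i) powr \<rho>\<rceil>" for i
  have T_ge: "real (2 ^ i) powr \<rho> \<le> real (T i)" for i unfolding T_def by linarith
  have T_mono: "T i \<le> T j" if "i \<le> j" for i j
    unfolding T_def using that \<rho> by (intro nat_mono ceiling_mono powr_mono2) (auto intro: power_increasing)
  have T_le: "real (T (Suc i)) \<le> \<Lambda> * real (2 ^ i) powr \<rho>" for i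
  proof -
    have "(1 :: real) \<le> 2 ^ Suc i" by (rule one_le_power) simp
    then have "1 \<le> real (2 ^ Suc i) powr \<rho>" using \<rho> by (intro ge_one_powr_ge_zero) auto
    moreover have "real (T (Suc i)) \<le> real (2 ^ Suc i) powr \<rho> + 1"
      unfolding T_def by (simp add: of_nat_nat)
    moreover have "real (2 ^ Suc i) powr \<rho> = 2 powr \<rho> * real (2 ^ i) powr \<rho>" by (simp add: powr_mult)
    ultimately show ?thesis by (simp add: \<Lambda>_def)
  qed
  \<comment> \<open>\<open>p\<close> rounds \<rho> up so that levels can be counted by powers of
    two; \<open>a\<close> absorbs the constants.\<close>
  define p where "p = nat \<lceil>\<rho>\<rceil>"
  define a where "a = nat \<lceil>real (snd x) + 1 + 4 * \<Lambda>\<rceil>"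
  have levels: "snd x + 4 * T (Suc i) + 1 \<le> 2 ^ (a + p * i)" for i
  proof -
    define P where "P = real (2 ^ i) powr real p"
    have 1: "1 \<le> P" unfolding P_def by (intro ge_one_powr_ge_zero) (auto intro: one_le_power)
    have "real (T (Suc i)) \<le> \<Lambda> * real (2 ^ i) powr \<rho>" by (rule T_le)
    also have "\<dots> \<le> \<Lambda> * P" unfolding P_def
    proof (intro mult_left_mono powr_mono)
      show "\<rho> \<le> real p" unfolding p_def by linarith
    qed (use \<Lambda> in auto)
    finally have 2: "real (T (Suc i)) \<le> \<Lambda> * P" .
    have "(real (snd x) + 1) * 1 + 4 * real (T (Suc i)) \<le> (real (snd x) + 1) * P + 4 * (\<Lambda> * P)"
      using 2 by (intro add_mono mult_left_mono 1) auto
    then have "real (snd x + 4 * T (Suc i) + 1) \<le> (real (snd x) + 1) * P + 4 * (\<Lambda> * P)"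
      by (simp only: of_nat_add of_nat_mult of_nat_numeral of_nat_1 mult_1_right add_ac)
    also have "\<dots> = (real (snd x) + 1 + 4 * \<Lambda>) * P" by (simp add: algebra_simps)
    also have "\<dots> \<le> real a * P"
      unfolding a_def using 1 by (intro mult_right_mono) linarith+
    also have "\<dots> \<le> 2 ^ a * P"
      using 1 by (intro mult_right_mono of_nat_less_two_power[THEN less_imp_le]) auto
    also have "P = 2 ^ (p * i)"
      unfolding P_def by (subst powr_realpow) (auto simp: power_mult[symmetric] mult.commute)
    finally have "real (snd x + 4 * T (Suc i) + 1) \<le> real (2 ^ (a + p * i))"
      by (simp add: power_add)
    then show ?thesis unfolding of_nat_le_iff .
  qed
  define z where "z = (2 :: real) powr (\<kappa> - g)"
  have z: "0 < z" "z < 1" using g by (auto simp: z_def powr_less_one)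
  have zi: "real (2 ^ i) powr (\<kappa> - g) = z ^ i" for i
    unfolding z_def by (simp add: powr_realpow[symmetric] powr_powr mult.commute)
  define b where "b i = K1 * (real a + real p + 1) * (real (Suc i) * z ^ i)" for i
  have "summable (\<lambda>i. real (Suc i) * z ^ i)"
    using geometric_deriv_sums[of z] z by (auto simp: sums_iff)
  then have sb: "summable b" unfolding b_def[abs_def] by (intro summable_mult)
  have b0: "0 \<le> b i" for i using K1 z by (simp add: b_def)
  \<comment> \<open>The times before \<open>4 * T k0\<close>, which precede the blocks used below,
    are bounded crudely by \<open>4\<close> per level.\<close>
  define K where "K = real (4 * T k0) * (real (snd x + 4 * T k0 + 1) * 4) + suminf b"
  have "(\<Sum>t<n. \<Sum>l\<le>snd x + t. 1 / (real l + 1) *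
      (\<Sum>v\<in>{v \<in> A. l \<le> height v}. (heat_kernel.u EG B x t (v, l))\<^sup>2)) \<le> K"
    if B: "heat_kernel VG EG B x" and A: "finite A" "A \<subseteq> V" for B A n
  proof -
    interpret HK: heat_kernel VG EG B x by (rule B)
    let ?A = "\<lambda>l. {v \<in> A. l \<le> height v}"
    define G where "G t l = (\<Sum>v\<in>?A l. (HK.u t (v, l))\<^sup>2)" for t l
    define s where "s t = (\<Sum>l\<le>snd x + t. 1 / (real l + 1) * G t l)" for t
    have G0: "0 \<le> G t l" for t l unfolding G_def by (intro sum_nonneg) auto
    have s0: "0 \<le> s t" for t unfolding s_def using G0 by (intro sum_nonneg) auto
    have G4: "G t l \<le> 4" for t l
    proof -
      have "G t l = (\<Sum>y\<in>?A l \<times> {l}. (HK.u t y)\<^sup>2)"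
        unfolding G_def by (rule sum.reindex_bij_witness[of _ fst "\<lambda>v. (v, l)"]) auto
      also have "\<dots> \<le> 2 * HK.w t" using A by (intro HK.sum_u_square) auto
      finally show ?thesis using HK.w_le_2[of t] by simp
    qed
    have init: "(\<Sum>t<4 * T k0. s t) \<le> real (4 * T k0) * (real (snd x + 4 * T k0 + 1) * 4)"
    proof -
      have "s t \<le> real (snd x + 4 * T k0 + 1) * 4" if "t < 4 * T k0" for t
      proof -
        have "s t \<le> (\<Sum>l\<le>snd x + t. 1 * 4)"
          unfolding s_def using G4 G0 by (intro sum_mono mult_mono) auto
        also have "\<dots> \<le> real (snd x + 4 * T k0 + 1) * 4" using that by simp
        finally show ?thesis .
      qed
      then show ?thesis using sum_bounded_above[of "{..<4 * T k0}" s "real (snd x + 4 * T k0 + 1) * 4"] by simp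
    qed
    have blk: "(\<Sum>t\<in>{4 * T i..<4 * T (Suc i)}. s t) \<le> b i" if i: "k0 \<le> i" for i
    proof -
      let ?I = "{4 * T i..<4 * T (Suc i)}" let ?L = "2 ^ (a + p * i) :: nat"
      \<comment> \<open>The threshold for the scale also serves as a threshold for the index, since
        \<open>2 ^ i\<close> exceeds \<open>i\<close>.\<close>
      have "(2::nat) ^ i \<ge> k0" using i less_exp[of i] by linarith
      then have Gb: "(\<Sum>t\<in>?I. G t l) \<le> K1 * z ^ i" for l
        unfolding G_def zi[symmetric] using A T_mono[of i "Suc i"]
        by (intro block[OF _ B T_ge _ T_le]) auto
      have "(\<Sum>t\<in>?I. s t) \<le> (\<Sum>t\<in>?I. \<Sum>l<?L. 1 / (real l + 1) * G t l)"
        unfolding s_def using levels[of i] G0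
        by (intro sum_mono sum_mono2) auto
      also have "\<dots> = (\<Sum>l<?L. 1 / (real l + 1) * (\<Sum>t\<in>?I. G t l))"
        by (subst sum.swap) (simp add: sum_distrib_left)
      also have "\<dots> \<le> (\<Sum>l<?L. 1 / (real l + 1) * (K1 * z ^ i))"
        using Gb by (intro sum_mono mult_left_mono) auto
      also have "\<dots> = (\<Sum>l<?L. 1 / (real l + 1)) * (K1 * z ^ i)" by (rule sum_distrib_right[symmetric])
      also have "\<dots> \<le> (real (a + p * i) + 1) * (K1 * z ^ i)"
        using K1 z by (intro mult_right_mono sum_reciprocal_dyadic) auto
      also have "\<dots> \<le> ((real a + real p + 1) * real (Suc i)) * (K1 * z ^ i)"
        using K1 z by (intro mult_right_mono) (auto simp: algebra_simps)
      also have "\<dots> = b i" by (simp add: b_def algebra_simps)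
      finally show ?thesis .
    qed
    have *: "(\<Sum>t<4 * T (k0 + j). s t) \<le> real (4 * T k0) * (real (snd x + 4 * T k0 + 1) * 4) + (\<Sum>i<k0 + j. b i)" for j
    proof (induction j)
      case 0
      then show ?case using init sum_nonneg[of "{..<k0}" b] b0 by auto
    next
      case (Suc j)
      have "(\<Sum>t<4 * T (k0 + Suc j). s t) = (\<Sum>t<4 * T (k0 + j). s t) + (\<Sum>t\<in>{4 * T (k0 + j)..<4 * T (Suc (k0 + j))}. s t)"
        using T_mono[of "k0 + j" "Suc (k0 + j)"]
        by (subst sum.union_disjoint[symmetric]) (auto intro!: sum.cong)
      then show ?case using Suc blk[of "k0 + j"] by simp
    qed
    have fin: "(\<Sum>t<4 * T (k0 + j). s t) \<le> K" for j
      unfolding K_def using sb b0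
      by (intro order_trans[OF * add_left_mono] sum_le_suminf) auto
    \<comment> \<open>Large enough for \<open>T (k0 + j)\<close> to be at least
      \<open>2 ^ n\<close>, hence beyond \<open>n\<close>.\<close>
    define j where "j = nat \<lceil>real n / \<rho>\<rceil>"
    have "real n / \<rho> \<le> real (k0 + j)" unfolding j_def by linarith
    then have "real n \<le> real (k0 + j) * \<rho>" using \<rho> by (simp add: pos_divide_le_eq)
    then have "2 powr real n \<le> 2 powr (real (k0 + j) * \<rho>)" by (intro powr_mono) auto
    also have "\<dots> = real (2 ^ (k0 + j)) powr \<rho>"
      unfolding powr_powr[symmetric] by (subst powr_realpow) auto
    also have "\<dots> \<le> real (T (k0 + j))" by (rule T_ge)
    finally have "2 ^ n \<le> real (T (k0 + j))" by (simp add: powr_realpow)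
    then have "n \<le> 4 * T (k0 + j)" using of_nat_less_two_power[of n, where ?'a = real] by linarith
    then have "(\<Sum>t<n. s t) \<le> (\<Sum>t<4 * T (k0 + j). s t)" using s0 by (intro sum_mono2) auto
    then show ?thesis using fin[of j] by (simp add: s_def G_def)
  qed
  then show ?thesis by blast
qed


text \<open>For \<open>l > 0\<close>, \<open>return_to_tooth\<close> obtains a Green function above
  \<open>l / 8\<close> for the levels below \<open>2 * l\<close>, so a weight of at least
  \<open>8 / l\<close> on these levels makes the expected sum reach \<open>1\<close>. At such a
  level \<open>j\<close> the weight \<open>16 / (j + 1)\<close> suffices, as
  \<open>j + 1 <= 2 * l\<close>.\<close>

definition tooth_weight :: "'a \<Rightarrow> 'a \<times> nat \<Rightarrow> real" where
  "tooth_weight v p = (if fst p = v \<and> snd p \<le> height v then 16 / (real (snd p) + 1) else 0)"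

lemma tooth_weight_nonneg: "0 \<le> tooth_weight v p"
  by (simp add: tooth_weight_def)

text \<open>Two walks meeting at level \<open>l\<close> are expected to meet of order \<open>l\<close> times below level \<open>2 * l\<close>
  of the same tooth: the resistance from level \<open>l\<close> to levels \<open>0\<close> and \<open>2 * l\<close> is of order \<open>l\<close>.\<close>

lemma return_to_tooth:
  assumes v: "v \<in> V" and l: "l \<le> height v"
  shows "\<exists>n. 1 \<le> G.wcoll (tooth_weight v) n (v, l) (v, l)"
proof (cases "l = 0")
  case True
  then show ?thesis by (intro exI[of _ 0]) (simp add: tooth_weight_def)
next
  case False
  define B where "B = {(v, j) | j. 1 \<le> j \<and> j < 2 * l \<and> j \<le> height v}"
  have "B \<subseteq> Pair v ` {..height v}" by (auto simp: B_def)
  then have finB: "finite B" by (rule finite_subset) simp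
  have BV: "B \<subseteq> VG" using v by (auto simp: B_def VG_iff)
  interpret K: killed_walk VG EG B by standard (rule finB BV)+
  \<comment> \<open>The crude bound by the height makes the Green series converge; the quantitative
    estimate comes from \<open>green2_lower\<close>.\<close>
  interpret T: transient_walk VG EG B "real (height v)"
  proof
    fix f :: "'a \<times> nat \<Rightarrow> real" and z assume z: "z \<in> B" and f: "K.supp f"
    obtain j where j: "z = (v, j)" "1 \<le> j" "j \<le> height v" using z by (auto simp: B_def)
    have e: "energy EG f \<le> ennreal (G.dirichlet B f)" "0 \<le> G.dirichlet B f"
      using K.energy_supp[OF f] by simp_all
    have "f (v, 0) = 0" by (rule K.suppD[OF f]) (simp add: B_def)
    then have "(f z)\<^sup>2 \<le> real j * tooth f v"
      using tooth_oscillation[of j v 0 f] j by simp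
    also have "\<dots> \<le> real (height v) * G.dirichlet B f"
      using j energy_tooth_le[OF e v] tooth_nonneg by (intro mult_mono) auto
    finally show "(f z)\<^sup>2 \<le> real (height v) * G.dirichlet B f" .
  qed simp
  \<comment> \<open>A tent with peak \<open>1\<close> at level \<open>l\<close> and zeros at
    \<open>0\<close> and \<open>2 * l\<close>, of energy at most \<open>2 / l\<close>. If the tooth
    ends below \<open>2 * l\<close>, the tent is cut at the tip, which costs no energy.\<close>
  define h where "h j = max 0 (1 - \<bar>real j - real l\<bar> / real l)" for j
  define F where "F p = (if p \<in> B then h (snd p) else 0)" for p
  have lpos: "0 < real l" using False by simp
  have hl: "h l = 1" by (simp add: h_def)
  have h0: "h j = 0" if "j = 0 \<or> 2 * l \<le> j" for j
  proof -
    have "real l \<le> \<bar>real j - real l\<bar>" using that by auto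
    then show ?thesis using lpos by (simp add: h_def field_simps)
  qed
  have hlip: "(h (Suc j) - h j)\<^sup>2 \<le> 1 / (real l)\<^sup>2" for j
  proof -
    have "\<bar>max 0 (1 - p) - max 0 (1 - q)\<bar> \<le> \<bar>q - p\<bar>" for p q :: real by linarith
    then have "\<bar>h (Suc j) - h j\<bar> \<le> \<bar>\<bar>real j - real l\<bar> / real l - \<bar>real (Suc j) - real l\<bar> / real l\<bar>"
      unfolding h_def .
    also have "\<dots> = \<bar>\<bar>real j - real l\<bar> - \<bar>real (Suc j) - real l\<bar>\<bar> / real l"
      by (simp add: diff_divide_distrib[symmetric])
    also have "\<dots> \<le> 1 / real l" by (intro divide_right_mono) auto
    finally have "\<bar>h (Suc j) - h j\<bar>\<^sup>2 \<le> (1 / real l)\<^sup>2" by (intro power_mono) auto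
    then show ?thesis by (simp add: power_divide)
  qed
  have Fh: "F (v, j) = h j" if "j \<le> height v" for j
    using that h0[of j] by (auto simp: F_def B_def)
  have F0: "F (u, j) = 0" if "u \<noteq> v \<or> j = 0 \<or> 2 * l \<le> j" for u j
    using that by (auto simp: F_def B_def)
  have supp: "K.supp F" by (rule K.suppI) (simp add: F_def)
  have "energy EG F \<le> ennreal (2 / real l)"
  proof (subst energy_le_iff; (intro allI impI)?)
    fix A assume A: "finite A" "A \<subseteq> EG"
    let ?S = "(\<lambda>j. ((v, j), (v, Suc j))) ` {..<2 * l} \<union> (\<lambda>j. ((v, Suc j), (v, j))) ` {..<2 * l}"
    have "(\<Sum>(x, y)\<in>A. (F x - F y)\<^sup>2) = (\<Sum>(x, y)\<in>A \<inter> ?S. (F x - F y)\<^sup>2)"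
    proof (rule sum.mono_neutral_right)
      show "\<forall>i\<in>A - A \<inter> ?S. (case i of (x, y) \<Rightarrow> (F x - F y)\<^sup>2) = 0"
      proof
        fix i assume i: "i \<in> A - A \<inter> ?S"
        obtain u m w n where [simp]: "i = ((u, m), (w, n))" by (metis surj_pair)
        have "((u, m), (w, n)) \<in> EG" using i A by auto
        then consider "m = 0" "n = 0" | "u = w" "m = Suc n" | "u = w" "n = Suc m" by (auto simp: EG_iff)
        then have "F (u, m) = 0 \<and> F (w, n) = 0"
        proof cases
          case 1
          then show ?thesis using F0 by simp
        next
          case 2
          then have "u \<noteq> v \<or> 2 * l \<le> n" using i by auto
          then show ?thesis using 2 F0[of u m] F0[of w n] by auto
        next
          case 3
          then have "u \<noteq> v \<or> 2 * l \<le> m" using i by auto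
          then show ?thesis using 3 F0[of u m] F0[of w n] by auto
        qed
        then show "(case i of (x, y) \<Rightarrow> (F x - F y)\<^sup>2) = 0" by simp
      qed
    qed (use A in auto)
    also have "\<dots> \<le> (\<Sum>(x, y)\<in>A \<inter> ?S. 1 / (real l)\<^sup>2)"
    proof (rule sum_mono)
      fix i assume i: "i \<in> A \<inter> ?S"
      then obtain j where "i = ((v, j), (v, Suc j)) \<or> i = ((v, Suc j), (v, j))" by auto
      moreover from this have "Suc j \<le> height v" using i A by (auto simp: EG_iff)
      ultimately show "(case i of (x, y) \<Rightarrow> (F x - F y)\<^sup>2) \<le> (case i of (x, y) \<Rightarrow> 1 / (real l)\<^sup>2)"
        using hlip[of j] by (auto simp: Fh power2_commute)
    qed
    also have "\<dots> = real (card (A \<inter> ?S)) * (1 / (real l)\<^sup>2)" by (simp add: case_prod_beta)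
    also have "\<dots> \<le> real (4 * l) * (1 / (real l)\<^sup>2)"
    proof (rule mult_right_mono)
      have "card (A \<inter> ?S) \<le> card ?S" by (intro card_mono) auto
      also have "\<dots> \<le> card ((\<lambda>j. ((v, j), (v, Suc j))) ` {..<2 * l}) + card ((\<lambda>j. ((v, Suc j), (v, j))) ` {..<2 * l})"
        by (rule card_Un_le)
      also have "\<dots> \<le> 2 * l + 2 * l"
        by (intro add_mono order_trans[OF card_image_le]) auto
      finally show "real (card (A \<inter> ?S)) \<le> real (4 * l)" by simp
    qed simp
    also have "\<dots> = 2 * (2 / real l)" using lpos by (simp add: power2_eq_square)
    finally show "(\<Sum>(x, y)\<in>A. (F x - F y)\<^sup>2) \<le> 2 * (2 / real l)" .
  qed simp
  then have dir: "G.dirichlet B F \<le> 2 / real l"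
    using K.energy_supp[OF supp] by (simp add: ennreal_le_iff)
  let ?z = "(v, l)"
  have zB: "?z \<in> B" using l False by (auto simp: B_def)
  have "F ?z = 1" using l hl by (simp add: Fh)
  then have "1 \<le> 2 * G.dirichlet B F * T.green2 ?z ?z"
    using T.green2_lower[OF zB supp] by simp
  moreover have "2 * G.dirichlet B F * T.green2 ?z ?z \<le> 2 * (2 / real l) * T.green2 ?z ?z"
    using dir T.green2_nonneg by (intro mult_right_mono) auto
  ultimately have "1 \<le> 4 / real l * T.green2 ?z ?z" by simp
  \<comment> \<open>Weakening \<open>l / 4\<close> to \<open>l / 8\<close> gives a strict
    inequality, which passes to some finite partial sum.\<close>
  then have "real l / 8 < T.green2 ?z ?z" using lpos by (simp add: field_simps)
  moreover have "(\<lambda>n. \<Sum>t\<le>n. G.kern B (2 * t) ?z ?z) \<longlonglongrightarrow> T.green2 ?z ?z"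
    using T.green2_sums by (simp add: sums_def_le)
  ultimately have "eventually (\<lambda>n. real l / 8 < (\<Sum>t\<le>n. G.kern B (2 * t) ?z ?z)) sequentially"
    by (rule order_tendstoD(1)[rotated])
  then obtain n where n: "real l / 8 < (\<Sum>t\<le>n. G.kern B (2 * t) ?z ?z)"
    by (auto simp: eventually_sequentially)
  have "8 / real l * (\<Sum>t\<le>n. G.kern B (2 * t) ?z ?z) \<le> G.wcoll (tooth_weight v) n ?z ?z"
  proof (rule K.kern_le_wcoll)
    fix y assume y: "y \<in> B"
    then obtain j where j: "y = (v, j)" "j < 2 * l" "j \<le> height v" by (auto simp: B_def)
    have "1 \<le> G.deg y" using y BV by (intro G.deg_ge_1) auto
    then have "8 / real l / G.deg y \<le> 8 / real l"
      using lpos by (simp add: divide_le_eq mult_le_cancel_left1)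
    also have "real j + 1 \<le> 2 * real l" using j(2) by linarith
    then have "8 / real l \<le> 16 / (real j + 1)" using lpos by (simp add: field_simps)
    also have "\<dots> = tooth_weight v y" using j by (simp add: tooth_weight_def)
    finally show "8 / real l / G.deg y \<le> tooth_weight v y" .
  qed (use lpos in \<open>auto simp: tooth_weight_nonneg\<close>)
  moreover have "1 \<le> 8 / real l * (\<Sum>t\<le>n. G.kern B (2 * t) ?z ?z)"
    using n lpos by (simp add: field_simps)
  ultimately show ?thesis by (intro exI[of _ n]) linarith
qed

lemma return_to_tooth_uniform:
  assumes v: "v \<in> V"
  shows "\<exists>M. \<forall>n\<ge>M. \<forall>l\<le>height v. 1 \<le> G.wcoll (tooth_weight v) n (v, l) (v, l)"
proof -
  obtain m where m: "\<And>l. l \<le> height v \<Longrightarrow> 1 \<le> G.wcoll (tooth_weight v) (m l) (v, l) (v, l)"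
    using return_to_tooth[OF v] by metis
  have "1 \<le> G.wcoll (tooth_weight v) n (v, l) (v, l)" if "(\<Sum>l\<le>height v. m l) \<le> n" "l \<le> height v" for n l
  proof -
    have "m l \<le> (\<Sum>l\<le>height v. m l)" using that by (intro member_le_sum) auto
    then show ?thesis
      using m[OF that(2)] G.wcoll_mono_time[of "tooth_weight v" "m l" n "(v, l)" "(v, l)"] that(1)
      by (simp add: tooth_weight_nonneg)
  qed
  then show ?thesis by blast
qed

text \<open>A step raises the level by at most one.\<close>

lemma kern_level: "n + t < l \<Longrightarrow> G.kern B t (v, n) (u, l) = 0"
proof (induction t arbitrary: v n)
  case (Suc t)
  have "G.avg (v, n) (\<lambda>x'. G.kern B t x' (u, l)) = G.avg (v, n) (\<lambda>_. 0)"
  proof (rule G.avg_cong)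
    fix y assume "((v, n), y) \<in> EG"
    then show "G.kern B t y (u, l) = 0" using Suc by (cases y) (auto simp: EG_iff)
  qed
  then show ?case by (simp add: G.killed_def)
qed auto

text \<open>The constant of \<open>total_sum\<close> does not depend on \<open>B\<close>, so
  \<open>B\<close> may be \<open>reach n x\<close>, where the killed and the free walk agree up to
  time \<open>n\<close>. Passing from densities to probabilities costs the square of the degree
  bound \<open>D\<close>.\<close>

lemma tooth_collisions:
  assumes x: "x \<in> VG" and \<gamma>: "\<kappa> < \<gamma>"
  shows "\<exists>K\<ge>0. \<forall>A n. finite A \<longrightarrow> A \<subseteq> V \<longrightarrow> (\<Sum>v\<in>A. G.wcoll (tooth_weight v) n x x) \<le> K"
proof -
  obtain D where D: "D \<ge> 1" "\<And>x. G.deg x \<le> D" using degree_bound by blast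
  obtain K where K: "\<And>B A n. heat_kernel VG EG B x \<Longrightarrow> finite A \<Longrightarrow> A \<subseteq> V \<Longrightarrow>
    (\<Sum>t<n. \<Sum>l\<le>snd x + t. 1 / (real l + 1) *
      (\<Sum>v\<in>{v \<in> A. l \<le> height v}. (heat_kernel.u EG B x t (v, l))\<^sup>2)) \<le> K"
    using total_sum[OF x \<gamma>] by blast
  have "(\<Sum>v\<in>A. G.wcoll (tooth_weight v) n x x) \<le> max 0 (16 * D\<^sup>2 * K)" if A: "finite A" "A \<subseteq> V" for A n
  proof -
    define B where "B = G.reach n x"
    have BV: "B \<subseteq> VG" unfolding B_def by (rule G.reach_subset[OF x])
    have xB: "x \<in> B" unfolding B_def using G.reach_mono[of 0 n x] by simp
    interpret HK: heat_kernel VG EG B x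
      by standard (use BV xB in \<open>auto simp: B_def G.finite_reach\<close>)
    define \<phi> where "\<phi> t v l = 16 / (real l + 1) * (G.transition t x (v, l))\<^sup>2" for t v l
    have \<phi>_le: "\<phi> t v l \<le> 16 * D\<^sup>2 * (1 / (real l + 1) * (HK.u t (v, l))\<^sup>2)"
      and \<phi>_0: "snd x + t < l \<Longrightarrow> \<phi> t v l = 0" if t: "t \<le> n" for t v l
    proof -
      have tr: "G.transition t x (v, l) = G.deg (v, l) * G.kern B t x (v, l)"
        using G.reach_mono[OF t, of x] BV by (intro G.transition_kern) (simp_all add: B_def)
      have "0 \<le> G.transition t x (v, l)"
        unfolding tr by (intro mult_nonneg_nonneg G.deg_nonneg G.kern_nonneg)
      moreover have "G.transition t x (v, l) \<le> D * HK.u t (v, l)"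
        unfolding tr using D by (intro mult_mono HK.kern_le_u G.kern_nonneg) auto
      ultimately have "(G.transition t x (v, l))\<^sup>2 \<le> D\<^sup>2 * (HK.u t (v, l))\<^sup>2"
        by (metis power_mono power_mult_distrib)
      then have "\<phi> t v l \<le> 16 / (real l + 1) * (D\<^sup>2 * (HK.u t (v, l))\<^sup>2)"
        unfolding \<phi>_def by (intro mult_left_mono) auto
      then show "\<phi> t v l \<le> 16 * D\<^sup>2 * (1 / (real l + 1) * (HK.u t (v, l))\<^sup>2)"
        by (simp add: mult_ac)
      show "\<phi> t v l = 0" if "snd x + t < l"
        using kern_level[of "snd x" t l B "fst x" v] that by (simp add: \<phi>_def tr)
    qed
    have wc: "G.wcoll (tooth_weight v) n x x = (\<Sum>t\<le>n. \<Sum>l\<le>height v. \<phi> t v l)" for v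
    proof -
      have "G.wcoll (tooth_weight v) n x x =
          (\<Sum>t\<le>n. \<Sum>z\<in>Pair v ` {..height v}. tooth_weight v z * (G.transition t x z * G.transition t x z))"
        by (rule G.wcoll_eq) (auto simp: tooth_weight_def image_iff prod_eq_iff)
      also have "\<dots> = (\<Sum>t\<le>n. \<Sum>l\<le>height v. \<phi> t v l)"
        by (rule sum.cong[OF refl], subst sum.reindex)
           (auto simp: inj_on_def \<phi>_def tooth_weight_def power2_eq_square)
      finally show ?thesis .
    qed
    have "(\<Sum>v\<in>A. G.wcoll (tooth_weight v) n x x) = (\<Sum>t\<le>n. \<Sum>v\<in>A. \<Sum>l\<le>height v. \<phi> t v l)"
      unfolding wc by (rule sum.swap)
    also have "\<dots> = (\<Sum>t\<le>n. \<Sum>l\<le>snd x + t. \<Sum>v\<in>{v \<in> A. l \<le> height v}. \<phi> t v l)"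
    proof (rule sum.cong[OF refl])
      fix t assume "t \<in> {..n}"
      then have t: "t \<le> n" by simp
      \<comment> \<open>By time \<open>t\<close> the walk has climbed to level
        \<open>snd x + t\<close> at most. With this range of levels, independent of
        \<open>v\<close>, the two sums can be exchanged.\<close>
      have "(\<Sum>l\<le>height v. \<phi> t v l) = (\<Sum>l\<le>snd x + t. if l \<le> height v then \<phi> t v l else 0)" for v
      proof -
        have "(\<Sum>l\<le>snd x + t. if l \<le> height v then \<phi> t v l else 0) = (\<Sum>l\<in>{..snd x + t} \<inter> {..height v}. \<phi> t v l)"
          by (subst sum.inter_restrict) auto
        also have "\<dots> = (\<Sum>l\<le>height v. \<phi> t v l)"
        proof (rule sum.mono_neutral_left)
          show "\<forall>i\<in>{..height v} - {..snd x + t} \<inter> {..height v}. \<phi> t v i = 0"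
          proof
            fix i assume "i \<in> {..height v} - {..snd x + t} \<inter> {..height v}"
            then have "snd x + t < i" by auto
            then show "\<phi> t v i = 0" by (rule \<phi>_0[OF t])
          qed
        qed auto
        finally show ?thesis by simp
      qed
      then have "(\<Sum>v\<in>A. \<Sum>l\<le>height v. \<phi> t v l) = (\<Sum>v\<in>A. \<Sum>l\<le>snd x + t. if l \<le> height v then \<phi> t v l else 0)"
        by (simp only:)
      also have "\<dots> = (\<Sum>l\<le>snd x + t. \<Sum>v\<in>A. if l \<le> height v then \<phi> t v l else 0)"
        by (rule sum.swap)
      also have "\<dots> = (\<Sum>l\<le>snd x + t. \<Sum>v\<in>{v \<in> A. l \<le> height v}. \<phi> t v l)"
        by (rule sum.cong[OF refl]) (rule sum.inter_filter[OF A(1), symmetric])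
      finally show "(\<Sum>v\<in>A. \<Sum>l\<le>height v. \<phi> t v l) = (\<Sum>l\<le>snd x + t. \<Sum>v\<in>{v \<in> A. l \<le> height v}. \<phi> t v l)" .
    qed
    also have "\<dots> \<le> (\<Sum>t\<le>n. \<Sum>l\<le>snd x + t. \<Sum>v\<in>{v \<in> A. l \<le> height v}.
        16 * D\<^sup>2 * (1 / (real l + 1) * (HK.u t (v, l))\<^sup>2))"
      by (intro sum_mono \<phi>_le) auto
    also have "\<dots> = 16 * D\<^sup>2 * (\<Sum>t<Suc n. \<Sum>l\<le>snd x + t. 1 / (real l + 1) *
        (\<Sum>v\<in>{v \<in> A. l \<le> height v}. (HK.u t (v, l))\<^sup>2))"
      unfolding lessThan_Suc_atMost by (simp only: sum_distrib_left)
    also have "\<dots> \<le> 16 * D\<^sup>2 * K"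
      by (rule mult_left_mono[OF K[OF HK.heat_kernel_axioms A]]) simp
    finally show ?thesis by simp
  qed
  then show ?thesis by (intro exI[of _ "max 0 (16 * D\<^sup>2 * K)"]) auto
qed

lemma finite_collisions:
  assumes \<gamma>: "\<kappa> < \<gamma>"
  shows "finite_collision_property VG EG"
proof -
  have bij: "bij_betw (from_nat_into V) UNIV V"
    using countable_V infinite by (rule bij_betw_from_nat_into)
  let ?v = "from_nat_into V"
  have vV: "?v i \<in> V" for i using bij by (auto simp: bij_betw_def)
  have inj: "inj ?v" using bij by (simp add: bij_betw_def)
  let ?S = "\<lambda>i. Pair (?v i) ` {..height (?v i)}"
  show ?thesis
  proof (rule G.finite_collision_propertyI[where S = ?S])
    show "finite (?S i)" for i by simp
    show "VG \<subseteq> (\<Union>i. ?S i)"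
    proof
      fix p assume p: "p \<in> VG"
      obtain u n where [simp]: "p = (u, n)" by (cases p)
      have u: "u \<in> V" "n \<le> height u" using p by (auto simp: VG_iff)
      then obtain i where "u = ?v i" using bij by (auto simp: bij_betw_def)
      then show "p \<in> (\<Union>i. ?S i)" using u by auto
    qed
  next
    fix x assume x: "x \<in> VG"
    obtain K where K: "\<And>A n. finite A \<Longrightarrow> A \<subseteq> V \<Longrightarrow> (\<Sum>v\<in>A. G.wcoll (tooth_weight v) n x x) \<le> K"
      using tooth_collisions[OF x \<gamma>] by blast
    obtain M where M: "\<And>i n l. M i \<le> n \<Longrightarrow> l \<le> height (?v i) \<Longrightarrow>
        1 \<le> G.wcoll (tooth_weight (?v i)) n (?v i, l) (?v i, l)"
      using return_to_tooth_uniform[OF vV] by metis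
    define P where "P i n = 1 - G.stay (\<lambda>_. {(x, y). \<not> (x = y \<and> x \<in> ?S i)}) n x x" for i n
    have P_mono: "incseq (P i)" for i
      unfolding P_def by (intro incseq_SucI diff_left_mono G.stay_antimono x)
    have P01: "0 \<le> P i n" "P i n \<le> 1" for i n
      using G.stay_le_1[OF x x] G.stay_nonneg by (auto simp: P_def)
    \<comment> \<open>The probability that a collision ever occurs in tooth
      \<open>i\<close>.\<close>
    define b where "b i = lim (P i)" for i
    have P_lim: "P i \<longlonglongrightarrow> b i" for i
    proof -
      have "\<forall>n. P i n \<le> 1" using P01 by simp
      with P_mono[of i] obtain L where "P i \<longlonglongrightarrow> L" by (rule incseq_convergent)
      then show ?thesis by (simp add: b_def limI)
    qed
    have Pb: "P i n \<le> b i" for i n using incseq_le[OF P_mono P_lim] .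
    have "(\<Sum>i<N. b i) \<le> K" for N
    proof (rule LIMSEQ_le_const2)
      show "(\<lambda>n. \<Sum>i<N. P i n) \<longlonglongrightarrow> (\<Sum>i<N. b i)" by (intro tendsto_sum P_lim)
      have "(\<Sum>i<N. P i n) \<le> K" for n
      proof -
        \<comment> \<open>One number of extra steps that serves the first \<open>N\<close> teeth at
          once; the bound \<open>K\<close> is uniform in the number of steps.\<close>
        define m where "m = (\<Sum>i<N. M i)"
        have "(\<Sum>i<N. P i n) \<le> (\<Sum>i<N. G.wcoll (tooth_weight (?v i)) (n + m) x x)"
          unfolding P_def
        proof (intro sum_mono G.hit_le_wcoll tooth_weight_nonneg x)
          fix i z assume "i \<in> {..<N}" and z: "z \<in> ?S i"
          then have "M i \<le> m" unfolding m_def by (intro member_le_sum) auto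
          then show "1 \<le> G.wcoll (tooth_weight (?v i)) m z z" using z M by auto
        qed
        also have "\<dots> = (\<Sum>v\<in>?v ` {..<N}. G.wcoll (tooth_weight v) (n + m) x x)"
          using inj by (subst sum.reindex) (auto simp: inj_on_def)
        also have "\<dots> \<le> K" using vV by (intro K) auto
        finally show ?thesis .
      qed
      then show "\<exists>N'. \<forall>n\<ge>N'. (\<Sum>i<N. P i n) \<le> K" by blast
    qed
    moreover have "0 \<le> b i" for i by (rule order_trans[OF P01(1) Pb])
    ultimately have "summable b" by (intro summableI_nonneg_bounded[of _ K])
    then show "\<exists>b. summable b \<and> (\<forall>i n. 1 - G.stay (\<lambda>_. {(x, y). \<not> (x = y \<and> x \<in> ?S i)}) n x x \<le> b i)"
      using Pb unfolding P_def by blast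
  next
    fix x z assume x: "x \<in> VG" and z: "z \<in> VG"
    obtain K where K: "\<And>A n. finite A \<Longrightarrow> A \<subseteq> V \<Longrightarrow> (\<Sum>v\<in>A. G.wcoll (tooth_weight v) n x x) \<le> K"
      using tooth_collisions[OF x \<gamma>] by blast
    obtain v l where vl: "z = (v, l)" by (cases z)
    have v: "v \<in> V" "l \<le> height v" using z by (auto simp: vl VG_iff)
    \<comment> \<open>The weight at \<open>z\<close> is the positive constant \<open>q\<close>, so
      the bounded weighted sum over its tooth controls the collisions at \<open>z\<close>.\<close>
    define q where "q = 16 / (real l + 1)"
    have q: "0 < q" by (simp add: q_def)
    have "(\<Sum>t<n. G.transition t x z * G.transition t x z) \<le> K / q" for n
    proof -
      have "q * (\<Sum>t<n. G.transition t x z * G.transition t x z) \<le>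
          (\<Sum>t\<le>n. \<Sum>y\<in>Pair v ` {..height v}. tooth_weight v y * (G.transition t x y * G.transition t x y))"
        unfolding sum_distrib_left
      proof (rule order_trans[OF sum_mono sum_mono2])
        fix t assume "t \<in> {..<n}"
        have "q * (G.transition t x z * G.transition t x z) = tooth_weight v z * (G.transition t x z * G.transition t x z)"
          using v by (simp add: q_def vl tooth_weight_def)
        also have "\<dots> \<le> (\<Sum>y\<in>Pair v ` {..height v}. tooth_weight v y * (G.transition t x y * G.transition t x y))"
          using v by (intro member_le_sum) (auto simp: vl tooth_weight_nonneg)
        finally show "q * (G.transition t x z * G.transition t x z) \<le>
            (\<Sum>y\<in>Pair v ` {..height v}. tooth_weight v y * (G.transition t x y * G.transition t x y))" .
      qed (auto intro!: sum_nonneg mult_nonneg_nonneg[OF tooth_weight_nonneg])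
      also have "\<dots> = G.wcoll (tooth_weight v) n x x"
        by (rule G.wcoll_eq[symmetric]) (auto simp: tooth_weight_def image_iff prod_eq_iff)
      also have "\<dots> \<le> K" using K[of "{v}" n] v by simp
      finally show ?thesis using q by (simp add: field_simps)
    qed
    then show "summable (\<lambda>t. G.transition t x z * G.transition t x z)"
      by (intro summableI_nonneg_bounded[of _ "K / q"]) auto
  qed
qed

end

theorem theorem3p2:
  fixes V :: "'a set" and E :: "'a rel" and \<alpha> \<beta> \<gamma> c C :: real and o\<^sub>0 :: 'a
  assumes "simple_graph V E" and "connected_graph V E" and "infinite V" and "bounded_degree V E"
    and "1 \<le> \<alpha>" and "\<alpha> \<le> 2" and "2 \<le> \<beta>" and "\<beta> \<le> \<alpha> + 1" and "\<alpha> < \<beta>"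
    and "0 < c" and "c \<le> C"
    and volume: "\<And>v k. v \<in> V \<Longrightarrow> 1 \<le> k \<Longrightarrow>
          c * real k powr \<alpha> \<le> real (card (graph_ball V E v k)) \<and>
          real (card (graph_ball V E v k)) \<le> C * real k powr \<alpha>"
    and resistance: "\<And>u v. u \<in> V \<Longrightarrow> v \<in> V \<Longrightarrow> u \<noteq> v \<Longrightarrow>
          ennreal (c * real (graph_dist E u v) powr (\<beta> - \<alpha>)) \<le> eff_resistance E {u} {v} \<and>
          eff_resistance E {u} {v} \<le> ennreal (C * real (graph_dist E u v) powr (\<beta> - \<alpha>))"
    and "o\<^sub>0 \<in> V" and "0 < \<gamma>"
  shows "(\<gamma> \<le> \<beta> - \<alpha> \<longrightarrow>
            infinite_collision_property (comb_verts V (power_profile E o\<^sub>0 \<gamma>))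
              (comb_edges V E (power_profile E o\<^sub>0 \<gamma>))) \<and>
         (\<gamma> > \<beta> - \<alpha> \<longrightarrow>
            finite_collision_property (comb_verts V (power_profile E o\<^sub>0 \<gamma>))
              (comb_edges V E (power_profile E o\<^sub>0 \<gamma>)))"
proof -
  interpret comb_graph V E \<alpha> "\<beta> - \<alpha>" c C o\<^sub>0 \<gamma>
    using assms by unfold_locales auto
  show ?thesis using infinite_collisions finite_collisions by simp
qed

end
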